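(* Let $0=\gamma_0<\gamma_1<\gamma_2<\cdots<\gamma_n$ denote $n$ random times and define $\Delta_i:=\gamma_i-\gamma_{i-1}$. Define $\tau_{\theta,i}:=\tau_\theta(\gamma_i)-\tau_\theta(\gamma_{i-1})$, and $r_i=e^{\lambda\gamma_i}$ for $i=1,\dots,n$, with $r_0=0$. Then it follows that, conditional on $(\Delta_1,\ldots,\Delta_n)$, for $i=1,\dots,n$, $$\lambda\tau_{\theta,i}=(1-e^{-\lambda\Delta_i})e^{-\lambda\gamma_{i-1}}\left[v_\theta(0)+\sum_{j=1}^{i-1}r_jT_jM_j\right]+T_i[1-M_i],$$ where $(T_i,M_i)$ are conditionally independent pairs independent of $v_\theta(0)$. Additionally, for each fixed $i$, $T_i$ and $M_i$ are independent with distributions specified by $T_i\overset d=T_{\theta\lambda\Delta_i}$ and $M_i\overset d=M_{(\theta\lambda\Delta_i)F_{\lambda\Delta_i}}$. If the $\Delta_i$ for $i=1,\ldots,n$ are independent, then unconditionally the pairs $(T_i,M_i)$ are independent.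
   Context: $\theta,\lambda>0$. $T_c$ is a Gamma random variable with shape $c$ and scale $1$. $G_\theta$ is the homogeneous Gamma process (subordinator with $E[e^{-\omega G_\theta(t)}]=(1+\omega)^{-\theta t}$); $v_\theta(t)=e^{-\lambda t}v_\theta(0)+e^{-\lambda t}\int_0^te^{\lambda y}G_\theta(d\lambda y)$ with $v_\theta(0)$ positive and independent of $G_\theta$ (here $\int_0^{t} g(y)G_\theta(d\lambda y):=\int_0^{\lambda t}g(s/\lambda)G_\theta(ds)$), and $\tau_\theta(t)=\int_0^tv_\theta(s)ds$. For $a>0$, $F_a$ is the distribution on $[e^{-a},1]$ with density $1/(au)$. For a probability measure $H$ and $c>0$, $M_{cH}=\int xP_{cH}(dx)$, where $P_{cH}$ is the Dirichlet process with shape measure $cH$ (Gamma random measure with shape measure $cH$ divided by its total mass).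
   Formalization: The Gamma process G_θ is assumed independent of v_θ(0) and the random times γ_0,…,γ_n jointly; for times that depend on G_θ the stated conditional laws of (T_i, M_i) can fail. *)

theory Defs
  imports "HOL-Probability.Probability"
begin

section \<open>Gamma laws, Gamma random measures and Dirichlet means\<close>

text \<open>The law of \<open>T\<^sub>c\<close>. A Gamma variable with shape \<open>0\<close> is identically zero; this case is needed
  when a shape measure vanishes on a set.\<close>

definition gamma_law :: "real \<Rightarrow> real measure" where
  "gamma_law c =
    (if c = 0 then return borel 0
     else density lborel
       (\<lambda>x. ennreal (if 0 < x then x powr (c - 1) * exp (- x) / Gamma c else 0)))"

definition F_law :: "real \<Rightarrow> real measure" where
  "F_law a = density lborel (\<lambda>u. ennreal (if exp (- a) \<le> u \<and> u \<le> 1 then 1 / (a * u) else 0))"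

definition gamma_random_measure ::
    "'w measure \<Rightarrow> 'x measure \<Rightarrow> ('w \<Rightarrow> 'x measure) \<Rightarrow> bool" where
  "gamma_random_measure N \<alpha> \<mu> \<longleftrightarrow>
     prob_space N \<and>
     (\<forall>w\<in>space N. sets (\<mu> w) = sets \<alpha> \<and> finite_measure (\<mu> w)) \<and>
     (\<forall>A\<in>sets \<alpha>. (\<lambda>w. measure (\<mu> w) A) \<in> borel_measurable N \<and>
        distr N borel (\<lambda>w. measure (\<mu> w) A) = gamma_law (measure \<alpha> A)) \<and>
     (\<forall>(k::nat) A. (\<forall>i<k. A i \<in> sets \<alpha>) \<longrightarrow> disjoint_family_on A {..<k} \<longrightarrow>
        prob_space.indep_vars N (\<lambda>_. borel) (\<lambda>i w. measure (\<mu> w) (A i)) {..<k})"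

text \<open>On the null event where the Gamma random measure vanishes, so does its normalisation
  (\<open>inverse 0 = \<infinity>\<close> and \<open>\<infinity> * 0 = 0\<close> in \<open>ennreal\<close>).\<close>

definition dirichlet_process ::
    "'w measure \<Rightarrow> 'x measure \<Rightarrow> ('w \<Rightarrow> 'x measure) \<Rightarrow> bool" where
  "dirichlet_process N \<alpha> P \<longleftrightarrow>
     (\<exists>\<mu>. gamma_random_measure N \<alpha> \<mu> \<and>
          P = (\<lambda>w. scale_measure (inverse (emeasure (\<mu> w) (space \<alpha>))) (\<mu> w)))"

text \<open>The law of \<open>\<integral> x P(dx)\<close> for a Dirichlet process \<open>P\<close> with shape measure \<open>\<alpha>\<close>. It depends only
  on \<open>\<alpha>\<close>. The sample space is taken over the type of measures itself, which is no
  restriction: the law of a random measure lives there.\<close>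

definition dirichlet_mean_law :: "real measure \<Rightarrow> real measure" where
  "dirichlet_mean_law \<alpha> =
     (THE \<nu>. \<exists>(N :: real measure measure) P. dirichlet_process N \<alpha> P \<and>
        \<nu> = distr N borel (\<lambda>w. \<integral>x. x \<partial>(P w)))"

section \<open>Gamma process, the Ornstein-Uhlenbeck process it drives, and the integrated process\<close>

definition subordinator :: "'a measure \<Rightarrow> (real \<Rightarrow> 'a \<Rightarrow> real) \<Rightarrow> bool" where
  "subordinator M G \<longleftrightarrow>
     prob_space M \<and>
     (\<forall>t\<ge>0. G t \<in> borel_measurable M) \<and>
     (AE w in M. G 0 w = 0) \<and>
     (AE w in M. mono_on {0..} (\<lambda>t. G t w) \<and>
        (\<forall>t\<ge>0. continuous (at_right t) (\<lambda>s. G s w))) \<and>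
     (\<forall>(k::nat) t. 0 \<le> t 0 \<longrightarrow> (\<forall>i<k. t i \<le> t (Suc i)) \<longrightarrow>
        prob_space.indep_vars M (\<lambda>_. borel) (\<lambda>i w. G (t (Suc i)) w - G (t i) w) {..<k}) \<and>
     (\<forall>s\<ge>0. \<forall>t\<ge>0. distr M borel (\<lambda>w. G (s + t) w - G s w) = distr M borel (G t))"

definition gamma_process :: "'a measure \<Rightarrow> real \<Rightarrow> (real \<Rightarrow> 'a \<Rightarrow> real) \<Rightarrow> bool" where
  "gamma_process M \<theta> G \<longleftrightarrow> subordinator M G \<and>
     (\<forall>t\<ge>0. \<forall>u\<ge>0. (\<integral>w. exp (- u * G t w) \<partial>M) = (1 + u) powr (- \<theta> * t))"

text \<open>The integral of \<open>g(y) G(d(lam * y))\<close> over \<open>y\<close> from \<open>0\<close> to \<open>t\<close>, i.e. the pathwise Stieltjes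
  integral of \<open>g(s/lam) G(ds)\<close> from \<open>0\<close> to \<open>lam * t\<close>. Paths are indexed by \<open>{0..}\<close> and are extended
  constantly to negative times because \<open>interval_measure\<close> wants a function on all reals.\<close>

definition sub_integral ::
    "real \<Rightarrow> (real \<Rightarrow> 'a \<Rightarrow> real) \<Rightarrow> (real \<Rightarrow> real) \<Rightarrow> real \<Rightarrow> 'a \<Rightarrow> real" where
  "sub_integral lam G g t w =
     (LINT s:{0<..lam * t}|interval_measure (\<lambda>s. G (max 0 s) w). g (s / lam))"

definition ou_process ::
    "real \<Rightarrow> (real \<Rightarrow> 'a \<Rightarrow> real) \<Rightarrow> ('a \<Rightarrow> real) \<Rightarrow> real \<Rightarrow> 'a \<Rightarrow> real" where
  "ou_process lam G v0 t w =
     exp (- lam * t) * v0 w + exp (- lam * t) * sub_integral lam G (\<lambda>y. exp (lam * y)) t w"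

definition int_ou ::
    "real \<Rightarrow> (real \<Rightarrow> 'a \<Rightarrow> real) \<Rightarrow> ('a \<Rightarrow> real) \<Rightarrow> real \<Rightarrow> 'a \<Rightarrow> real" where
  "int_ou lam G v0 t w = (LINT s:{0..t}|lborel. ou_process lam G v0 s w)"

section \<open>Random times\<close>

definition Delta :: "(nat \<Rightarrow> 'a \<Rightarrow> real) \<Rightarrow> nat \<Rightarrow> 'a \<Rightarrow> real" where
  "Delta \<gamma> i w = \<gamma> i w - \<gamma> (i - 1) w"

definition tau_incr ::
    "real \<Rightarrow> (real \<Rightarrow> 'a \<Rightarrow> real) \<Rightarrow> ('a \<Rightarrow> real) \<Rightarrow> (nat \<Rightarrow> 'a \<Rightarrow> real) \<Rightarrow> nat \<Rightarrow> 'a \<Rightarrow> real" where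
  "tau_incr lam G v0 \<gamma> i w = int_ou lam G v0 (\<gamma> i w) w - int_ou lam G v0 (\<gamma> (i - 1) w) w"

definition r_coeff :: "real \<Rightarrow> (nat \<Rightarrow> 'a \<Rightarrow> real) \<Rightarrow> nat \<Rightarrow> 'a \<Rightarrow> real" where
  "r_coeff lam \<gamma> i w = (if i = 0 then 0 else exp (lam * \<gamma> i w))"

definition Delta_vec :: "(nat \<Rightarrow> 'a \<Rightarrow> real) \<Rightarrow> nat \<Rightarrow> 'a \<Rightarrow> nat \<Rightarrow> real" where
  "Delta_vec \<gamma> n w = (\<lambda>i\<in>{1..n}. Delta \<gamma> i w)"

definition sigma_Delta :: "'a measure \<Rightarrow> (nat \<Rightarrow> 'a \<Rightarrow> real) \<Rightarrow> nat \<Rightarrow> 'a measure" where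
  "sigma_Delta M \<gamma> n = vimage_algebra (space M) (Delta_vec \<gamma> n) (PiM {1..n} (\<lambda>_. borel))"

section \<open>Independence, conditional independence and conditional laws\<close>

text \<open>Unlike \<open>indep_var\<close> of the library, the two variables may have values in different types.\<close>

definition indep_rv ::
    "'a measure \<Rightarrow> 'b measure \<Rightarrow> ('a \<Rightarrow> 'b) \<Rightarrow> 'c measure \<Rightarrow> ('a \<Rightarrow> 'c) \<Rightarrow> bool" where
  "indep_rv M N X N' Y \<longleftrightarrow>
     X \<in> measurable M N \<and> Y \<in> measurable M N' \<and>
     prob_space.indep_set M {X -` A \<inter> space M | A. A \<in> sets N} {Y -` B \<inter> space M | B. B \<in> sets N'}"

definition prob_given :: "'a measure \<Rightarrow> 'a measure \<Rightarrow> 'a set \<Rightarrow> 'a \<Rightarrow> real" where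
  "prob_given M F E = real_cond_exp M F (indicator E)"

definition cond_indep_vars ::
    "'a measure \<Rightarrow> 'a measure \<Rightarrow> ('i \<Rightarrow> 'b measure) \<Rightarrow> ('i \<Rightarrow> 'a \<Rightarrow> 'b) \<Rightarrow> 'i set \<Rightarrow> bool" where
  "cond_indep_vars M F N X I \<longleftrightarrow>
     (\<forall>i\<in>I. X i \<in> measurable M (N i)) \<and>
     (\<forall>J A. J \<subseteq> I \<longrightarrow> finite J \<longrightarrow> (\<forall>j\<in>J. A j \<in> sets (N j)) \<longrightarrow>
        (AE w in M. prob_given M F {x \<in> space M. \<forall>j\<in>J. X j x \<in> A j} w =
           (\<Prod>j\<in>J. prob_given M F {x \<in> space M. X j x \<in> A j} w)))"

definition cond_indep_var ::
    "'a measure \<Rightarrow> 'a measure \<Rightarrow> 'b measure \<Rightarrow> ('a \<Rightarrow> 'b) \<Rightarrow> 'c measure \<Rightarrow> ('a \<Rightarrow> 'c) \<Rightarrow> bool" where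
  "cond_indep_var M F N X N' Y \<longleftrightarrow>
     X \<in> measurable M N \<and> Y \<in> measurable M N' \<and>
     (\<forall>A\<in>sets N. \<forall>B\<in>sets N'.
        AE w in M. prob_given M F {x \<in> space M. X x \<in> A \<and> Y x \<in> B} w =
           prob_given M F {x \<in> space M. X x \<in> A} w * prob_given M F {x \<in> space M. Y x \<in> B} w)"

definition has_cond_law ::
    "'a measure \<Rightarrow> 'a measure \<Rightarrow> 'b measure \<Rightarrow> ('a \<Rightarrow> 'b) \<Rightarrow> ('a \<Rightarrow> 'b measure) \<Rightarrow> bool" where
  "has_cond_law M F N X K \<longleftrightarrow>
     X \<in> measurable M N \<and>
     (\<forall>A\<in>sets N. AE w in M. prob_given M F {x \<in> space M. X x \<in> A} w = measure (K w) A)"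

end

theory Submission
  imports Defs
begin

text \<open>The pairs are explicit functionals of the driving path. With \<open>b = lam * \<gamma> i\<close> and
  \<open>a = lam * \<gamma> (i - 1)\<close>, \<open>T i\<close> is the mass \<open>G b - G a\<close> that the Stieltjes measure \<open>dG\<close> puts on
  \<open>{a<..b}\<close>, and \<open>D i\<close> (the \<open>M\<^sub>i\<close> of the informal statement) is the mean of \<open>exp (x - b)\<close> under \<open>dG\<close>
  normalised on that interval. Hence \<open>T i * D i\<close> is the discounted integral of \<open>exp (x - b)\<close>, and the
  Stieltjes integral in the Ornstein-Uhlenbeck process up to \<open>\<gamma> i\<close> is the sum of the
  \<open>exp (lam * \<gamma> j) * T j * D j\<close> for \<open>j \<le> i\<close>. Integration by parts expresses \<open>lam * \<tau>\<close> at each time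
  by the path and this integral (\<open>int_ou_eq\<close>); subtracting at consecutive times gives
  the identity, path by path.

  For deterministic times everything about the laws is read off one formula
  (\<open>laplace_borel\<close>): the Laplace functional of \<open>dG\<close> is the exponential of minus the
  \<open>\<theta> * lborel\<close>-integral of \<open>ln (1 + f)\<close>. Together with uniqueness of Laplace transforms it gives, first, the
  independence of the pairs on disjoint intervals, since \<open>ln (1 + f)\<close> splits over them; second, the
  Gamma law of \<open>T i\<close>; third, the fact that the image of \<open>dG\<close> on this interval under \<open>\<lambda>x. exp (x - b)\<close> is a Gamma
  random measure whose shape is \<open>\<theta> * (b - a)\<close> times the law of \<open>exp (x - b)\<close> for uniform \<open>x\<close>, which is
  \<open>F_law (b - a)\<close>, so that \<open>D i\<close> has a Dirichlet mean law (\<open>ratio_law\<close>). As that law is specified as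
  the unique law arising from any realisation of the Dirichlet process, its uniqueness has to be
  proved as well; again the Laplace functional of an arbitrary Gamma random measure decides.
  Finally \<open>T i\<close> and \<open>D i\<close> are independent because tilting by \<open>exp (- r * T i)\<close> only rescales the
  Gamma measure, and \<open>D i\<close> is invariant under scaling (\<open>ratio_indep_total\<close>).

  The passage to random times is a freezing argument (\<open>prob_given_freezing\<close>): the path is
  independent of \<open>v0\<close> and the times, so conditionally on the spacings, events about the pairs have the
  probability that they have for the frozen spacings. This needs functionals that are jointly
  measurable in path and times, which is arranged by reconstructing the path from its values at
  rational times.\<close>

section \<open>Laplace transforms determine laws\<close>

text \<open>The transform at the integers gives all moments of \<open>exp (- x)\<close>, a bounded variable. Its
  characteristic function is therefore determined by expanding the exponential series, and Levy's
  uniqueness theorem finishes the proof.\<close>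

lemma finite_measure_eq_laplace:
  fixes M N :: "real measure"
  assumes fin: "finite_measure M" "finite_measure N"
    and sets: "sets M = sets borel" "sets N = sets borel"
    and pos: "AE x in M. 0 \<le> x" "AE x in N. 0 \<le> x"
    and eq: "\<And>u. 0 \<le> u \<Longrightarrow> (\<integral>x. exp (- u * x) \<partial>M) = (\<integral>x. exp (- u * x) \<partial>N)"
  shows "M = N"
proof -
  note [measurable_cong] = sets
  interpret M: finite_measure M by fact
  interpret N: finite_measure N by fact
  have sp: "space M = UNIV" "space N = UNIV"
    using sets_eq_imp_space_eq[OF sets(1)] sets_eq_imp_space_eq[OF sets(2)] by auto
  define c where "c = measure M UNIV"
  have cN: "c = measure N UNIV" using eq[of 0] by (simp add: c_def sp)
  show ?thesis
  proof (cases "c = 0")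
    case True
    have "emeasure M A = 0" "emeasure N A = 0" for A
      using M.emeasure_eq_measure[of UNIV] N.emeasure_eq_measure[of UNIV]
        True cN c_def emeasure_space[of M A] emeasure_space[of N A] sp
      by (auto simp: le_zero_eq)
    then show ?thesis using sets by (intro measure_eqI) auto
  next
    case False
    then have c: "c > 0" by (simp add: c_def less_le)
    have key: "(\<integral>x. iexp (t * exp (- x)) \<partial>K) = (\<Sum>k. (\<i> * t)^k / fact k * of_real (\<integral>x. exp (- real k * x) \<partial>K))"
      if K: "finite_measure K" "sets K = sets borel" "AE x in K. 0 \<le> x" for K :: "real measure" and t :: real
    proof -
      note [measurable_cong] = K(2)
      interpret K: finite_measure K by fact
      define f where "f k x = (\<i> * t)^k / fact k * of_real (exp (- real k * x))" for k x
      have int0: "integrable K (\<lambda>x. exp (- real k * x))" for k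
        by (rule K.integrable_const_bound[where B=1]) (use K(3) in auto)
      have int: "integrable K (f k)" for k
        unfolding f_def by (intro integrable_mult_right integrable_of_real int0)
      have nf: "norm (f k x) = \<bar>t\<bar>^k / fact k * exp (- real k * x)" for k x
        by (simp add: f_def norm_mult norm_divide norm_power)
      have sm: "f k x = (\<i> * of_real (t * exp (- x)))^k /\<^sub>R fact k" for k x
        by (simp add: f_def power_mult_distrib scaleR_conv_of_real divide_simps flip: exp_of_nat_mult of_real_power)
      have s1: "summable (\<lambda>k. norm (f k x))" for x
        unfolding sm by (rule summable_norm_exp)
      have "(\<lambda>k. integral\<^sup>L K (f k)) sums (\<integral>x. (\<Sum>k. f k x) \<partial>K)"
      proof (rule sums_integral[OF int])
        show "AE x in K. summable (\<lambda>i. norm (f i x))" using s1 by simp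
        have b: "(\<integral>x. norm (f k x) \<partial>K) \<le> measure K UNIV * (\<bar>t\<bar>^k /\<^sub>R fact k)" for k
        proof -
          have "(\<integral>x. norm (f k x) \<partial>K) \<le> (\<integral>x. \<bar>t\<bar>^k / fact k \<partial>K)"
            unfolding nf by (intro integral_mono_AE integrable_mult_right int0 K.integrable_const)
              (use K(3) in \<open>auto intro!: mult_left_le divide_right_mono\<close>)
          also have "\<dots> = measure K UNIV * (\<bar>t\<bar>^k /\<^sub>R fact k)"
            using sets_eq_imp_space_eq[OF K(2)] by (simp add: divide_inverse mult.commute)
          finally show ?thesis .
        qed
        show "summable (\<lambda>k. \<integral>x. norm (f k x) \<partial>K)"
          by (rule summable_comparison_test[OF _ summable_mult[OF summable_exp_generic[of "\<bar>t\<bar>"], of "measure K UNIV"]])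
             (use b in \<open>auto intro!: exI[of _ 0]\<close>)
      qed
      moreover have "(\<Sum>k. f k x) = iexp (t * exp (- x))" for x
        unfolding sm by (simp add: exp_def)
      ultimately have "(\<integral>x. iexp (t * exp (- x)) \<partial>K) = (\<Sum>k. integral\<^sup>L K (f k))"
        by (simp add: sums_iff)
      also have "\<dots> = (\<Sum>k. (\<i> * t)^k / fact k * of_real (\<integral>x. exp (- real k * x) \<partial>K))"
        unfolding f_def by (simp only: integral_mult_right_zero integral_complex_of_real)
      finally show ?thesis .
    qed
    have iexp_eq: "(\<integral>x. iexp (t * exp (- x)) \<partial>M) = (\<integral>x. iexp (t * exp (- x)) \<partial>N)" for t
      by (simp only: key[OF fin(1) sets(1) pos(1)] key[OF fin(2) sets(2) pos(2)]) (simp only: eq of_nat_0_le_iff)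
    \<comment> \<open>Normalising by the common total mass \<open>c\<close> makes characteristic functions applicable.\<close>
    define E where "E K = distr (density K (\<lambda>_. ennreal (1 / c))) borel (\<lambda>x::real. exp (- x))" for K
    have rd: "real_distribution (E K)" if "finite_measure K" "sets K = sets borel" "measure K UNIV = c" for K
    proof -
      note [measurable_cong] = that(2)
      interpret K: finite_measure K by fact
      have spK: "space K = UNIV" using sets_eq_imp_space_eq[OF that(2)] by simp
      have "emeasure (density K (\<lambda>_. ennreal (1 / c))) UNIV = ennreal (1 / c) * emeasure K UNIV"
        using spK by (simp add: emeasure_density nn_integral_cmult that(2))
      also have "\<dots> = 1"
        using c by (simp add: K.emeasure_eq_measure that(3) flip: ennreal_mult)
      finally have "prob_space (density K (\<lambda>_. ennreal (1 / c)))"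
        by (intro prob_spaceI) (simp add: spK)
      then interpret D: prob_space "density K (\<lambda>_. ennreal (1 / c))" .
      show ?thesis unfolding E_def
        by (intro D.real_distribution_distr) (simp add: measurable_density_eq1)
    qed
    have "char (E M) t = char (E N) t" for t
    proof -
      have "char (E K) t = (1 / c) *\<^sub>R (\<integral>x. iexp (t * exp (- x)) \<partial>K)"
        if "sets K = sets borel" for K
      proof -
        note [measurable_cong] = that
        show ?thesis unfolding E_def char_def using c
          by (subst integral_distr) (auto simp: integral_density)
      qed
      then show ?thesis using iexp_eq sets by simp
    qed
    then have EE: "E M = E N"
      by (intro Levy_uniqueness rd fin sets) (auto simp: c_def cN[unfolded c_def])
    have recover: "density (distr (E K) borel (\<lambda>y. - ln y)) (\<lambda>_. ennreal c) = K"
      if "sets K = sets borel" for K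
    proof -
      note [measurable_cong] = that
      have "distr (E K) borel (\<lambda>y. - ln y) = density K (\<lambda>_. ennreal (1 / c))"
        unfolding E_def by (subst distr_distr) (auto simp: comp_def that intro!: distr_id2)
      then show ?thesis
        using c by (simp add: density_density_eq flip: ennreal_mult) (simp add: density_1)
    qed
    show ?thesis using recover[OF sets(1)] recover[OF sets(2)] unfolding EE by (rule trans[OF sym])
  qed
qed

lemma integral_indicator_distr_density:
  assumes [measurable]: "w \<in> borel_measurable M" "X \<in> M \<rightarrow>\<^sub>M N" "B \<in> sets N"
    and w: "\<And>x. 0 \<le> (w x :: real)"
  shows "(\<integral>x. (indicator B x :: real) \<partial>distr (density M (\<lambda>x. ennreal (w x))) N X) =
    (\<integral>x. w x * indicator B (X x) \<partial>M)"
proof -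
  have "(\<integral>x. (indicator B x :: real) \<partial>distr (density M (\<lambda>x. ennreal (w x))) N X) =
    (\<integral>x. (indicator B (X x) :: real) \<partial>density M (\<lambda>x. ennreal (w x)))"
    by (rule integral_distr) measurable
  also have "\<dots> = (\<integral>x. w x *\<^sub>R indicator B (X x) \<partial>M)"
    by (rule integral_density) (use w in auto)
  finally show ?thesis by simp
qed

text \<open>Carrying a weight along lets one variable at a time be treated: the indicators already
  obtained and the exponentials still to be inverted are the weight.\<close>

lemma weighted_laplace_unique:
  fixes X :: "'a \<Rightarrow> real" and Y :: "'b \<Rightarrow> real"
  assumes fin: "finite_measure M" "finite_measure N"
    and [measurable]: "X \<in> borel_measurable M" "Y \<in> borel_measurable N"
      "w \<in> borel_measurable M" "v \<in> borel_measurable N"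
    and pos: "AE x in M. 0 \<le> X x" "AE x in N. 0 \<le> Y x"
    and w: "\<And>x. 0 \<le> w x" "\<And>x. w x \<le> (1::real)" and v: "\<And>x. 0 \<le> v x" "\<And>x. v x \<le> (1::real)"
    and eq: "\<And>u. 0 \<le> u \<Longrightarrow> (\<integral>x. w x * exp (- u * X x) \<partial>M) = (\<integral>x. v x * exp (- u * Y x) \<partial>N)"
    and B[measurable]: "B \<in> sets borel"
  shows "(\<integral>x. w x * indicator B (X x) \<partial>M) = (\<integral>x. v x * indicator B (Y x) \<partial>N)"
proof -
  have fd: "finite_measure (distr (density K (\<lambda>x. ennreal (g x))) borel Z)"
    if "finite_measure K" and [measurable]: "g \<in> borel_measurable K" "Z \<in> borel_measurable K"
      and "\<And>x. 0 \<le> g x" "\<And>x. g x \<le> (1::real)" for K :: "'c measure" and g and Z :: "'c \<Rightarrow> real"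
  proof (intro finite_measure.finite_measure_distr)
    interpret K: finite_measure K by fact
    have "(\<integral>\<^sup>+x. ennreal (g x) \<partial>K) \<le> (\<integral>\<^sup>+x. 1 \<partial>K)"
      using that(5) by (intro nn_integral_mono) (simp add: ennreal_le_1)
    then show "finite_measure (density K (\<lambda>x. ennreal (g x)))"
      by (intro finite_measureI) (auto simp: emeasure_density nn_integral_indicator top_unique cong: nn_integral_cong_simp)
    show "Z \<in> borel_measurable (density K (\<lambda>x. ennreal (g x)))" by simp
  qed
  have eqm: "distr (density M (\<lambda>x. ennreal (w x))) borel X = distr (density N (\<lambda>x. ennreal (v x))) borel Y"
  proof (rule finite_measure_eq_laplace)
    fix u :: real assume "0 \<le> u"
    from eq[OF this] show "(\<integral>x. exp (- u * x) \<partial>distr (density M (\<lambda>x. ennreal (w x))) borel X) =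
      (\<integral>x. exp (- u * x) \<partial>distr (density N (\<lambda>x. ennreal (v x))) borel Y)"
      using w v by (simp add: integral_distr integral_density)
  qed (use pos w v fin in \<open>auto intro!: fd simp: AE_distr_iff AE_density\<close>)
  have "(\<integral>x. indicator B x \<partial>distr (density M (\<lambda>x. ennreal (w x))) borel X) =
      (\<integral>x. (indicator B x :: real) \<partial>distr (density N (\<lambda>x. ennreal (v x))) borel Y)"
    by (simp only: eqm)
  then show ?thesis using w v by (subst (asm) (1 2) integral_indicator_distr_density) auto
qed

lemma weighted_laplace_unique_pair:
  fixes X :: "'a \<Rightarrow> real \<times> real" and Y :: "'b \<Rightarrow> real \<times> real"
  assumes fin: "finite_measure M" "finite_measure N"
    and X[measurable]: "X \<in> M \<rightarrow>\<^sub>M borel \<Otimes>\<^sub>M borel" and Y[measurable]: "Y \<in> N \<rightarrow>\<^sub>M borel \<Otimes>\<^sub>M borel"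
    and mw[measurable]: "w \<in> borel_measurable M" and mv[measurable]: "v \<in> borel_measurable N"
    and pos: "AE x in M. 0 \<le> fst (X x) \<and> 0 \<le> snd (X x)" "AE x in N. 0 \<le> fst (Y x) \<and> 0 \<le> snd (Y x)"
    and w: "\<And>x. 0 \<le> w x" "\<And>x. w x \<le> (1::real)" and v: "\<And>x. 0 \<le> v x" "\<And>x. v x \<le> (1::real)"
    and eq: "\<And>s t. 0 \<le> s \<Longrightarrow> 0 \<le> t \<Longrightarrow> (\<integral>x. w x * exp (- (s * fst (X x) + t * snd (X x))) \<partial>M) =
        (\<integral>x. v x * exp (- (s * fst (Y x) + t * snd (Y x))) \<partial>N)"
  shows "distr (density M (\<lambda>x. ennreal (w x))) (borel \<Otimes>\<^sub>M borel) X =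
         distr (density N (\<lambda>x. ennreal (v x))) (borel \<Otimes>\<^sub>M borel) Y" (is "?P = ?Q")
proof -
  interpret M: finite_measure M by fact
  interpret N: finite_measure N by fact
  \<comment> \<open>The truncation \<open>max 0\<close> bounds the weights everywhere, not only almost everywhere.\<close>
  have m2[measurable]: "(\<lambda>x. snd (X x)) \<in> borel_measurable M" "(\<lambda>x. fst (X x)) \<in> borel_measurable M"
    "(\<lambda>x. snd (Y x)) \<in> borel_measurable N" "(\<lambda>x. fst (Y x)) \<in> borel_measurable N"
    by measurable
  have 1: "(\<integral>x. w x * exp (- t * max 0 (snd (X x))) * indicator A (fst (X x)) \<partial>M) =
        (\<integral>x. v x * exp (- t * max 0 (snd (Y x))) * indicator A (fst (Y x)) \<partial>N)"
    if t: "0 \<le> t" and A: "A \<in> sets borel" for t A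
  proof (rule weighted_laplace_unique[OF fin _ _ _ _ _ _ _ _ _ _ _ A])
    fix u :: real assume "0 \<le> u"
    have "(\<integral>x. w x * exp (- t * max 0 (snd (X x))) * exp (- u * fst (X x)) \<partial>M) =
       (\<integral>x. w x * exp (- (u * fst (X x) + t * snd (X x))) \<partial>M)"
      by (rule integral_cong_AE) (use pos(1) in \<open>auto simp: max_def simp flip: exp_add\<close>)
    also have "\<dots> = (\<integral>x. v x * exp (- (u * fst (Y x) + t * snd (Y x))) \<partial>N)"
      by (rule eq) fact+
    also have "\<dots> = (\<integral>x. v x * exp (- t * max 0 (snd (Y x))) * exp (- u * fst (Y x)) \<partial>N)"
      by (rule integral_cong_AE) (use pos(2) in \<open>auto simp: max_def simp flip: exp_add\<close>)
    finally show "(\<integral>x. w x * exp (- t * max 0 (snd (X x))) * exp (- u * fst (X x)) \<partial>M) =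
       (\<integral>x. v x * exp (- t * max 0 (snd (Y x))) * exp (- u * fst (Y x)) \<partial>N)" .
  qed (use pos w v t in \<open>auto intro!: mult_le_one\<close>)
  have 2: "(\<integral>x. (w x * indicator A (fst (X x))) * indicator B (snd (X x)) \<partial>M) =
        (\<integral>x. (v x * indicator A (fst (Y x))) * indicator B (snd (Y x)) \<partial>N)"
    if A[measurable]: "A \<in> sets borel" and B: "B \<in> sets borel" for A B
  proof (rule weighted_laplace_unique[OF fin _ _ _ _ _ _ _ _ _ _ _ B])
    fix u :: real assume "0 \<le> u"
    have "(\<integral>x. w x * indicator A (fst (X x)) * exp (- u * snd (X x)) \<partial>M) =
       (\<integral>x. w x * exp (- u * max 0 (snd (X x))) * indicator A (fst (X x)) \<partial>M)"
      by (rule integral_cong_AE) (use pos(1) in \<open>auto simp: max_def\<close>)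
    also have "\<dots> = (\<integral>x. v x * exp (- u * max 0 (snd (Y x))) * indicator A (fst (Y x)) \<partial>N)"
      by (rule 1) fact+
    also have "\<dots> = (\<integral>x. v x * indicator A (fst (Y x)) * exp (- u * snd (Y x)) \<partial>N)"
      by (rule integral_cong_AE) (use pos(2) in \<open>auto simp: max_def\<close>)
    finally show "(\<integral>x. w x * indicator A (fst (X x)) * exp (- u * snd (X x)) \<partial>M) =
       (\<integral>x. v x * indicator A (fst (Y x)) * exp (- u * snd (Y x)) \<partial>N)" .
  qed (use pos w v in \<open>auto intro!: mult_le_one simp: indicator_def\<close>)
  have box: "emeasure (distr (density K (\<lambda>x. ennreal (g x))) (borel \<Otimes>\<^sub>M borel) Z) (A \<times> B) =
      ennreal (\<integral>x. g x * indicator A (fst (Z x)) * indicator B (snd (Z x)) \<partial>K)"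
    if "finite_measure K" and [measurable]: "g \<in> borel_measurable K" "Z \<in> K \<rightarrow>\<^sub>M borel \<Otimes>\<^sub>M borel"
      "A \<in> sets borel" "B \<in> sets borel"
      and g: "\<And>x. 0 \<le> g x" "\<And>x. g x \<le> (1::real)" for K :: "'c measure" and g and Z :: "'c \<Rightarrow> real \<times> real" and A B
  proof -
    interpret K: finite_measure K by fact
    have [measurable]: "(\<lambda>x. snd (Z x)) \<in> borel_measurable K" "(\<lambda>x. fst (Z x)) \<in> borel_measurable K"
      by measurable
    have "emeasure (distr (density K (\<lambda>x. ennreal (g x))) (borel \<Otimes>\<^sub>M borel) Z) (A \<times> B) =
       (\<integral>\<^sup>+x. ennreal (g x) * indicator (Z -` (A \<times> B) \<inter> space K) x \<partial>K)"
      by (simp add: emeasure_distr emeasure_density)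
    also have "\<dots> = (\<integral>\<^sup>+x. ennreal (g x * indicator A (fst (Z x)) * indicator B (snd (Z x))) \<partial>K)"
      by (intro nn_integral_cong) (auto simp: indicator_def mem_Times_iff)
    also have "\<dots> = ennreal (\<integral>x. g x * indicator A (fst (Z x)) * indicator B (snd (Z x)) \<partial>K)"
      by (intro nn_integral_eq_integral K.integrable_const_bound[where B=1])
        (use g in \<open>auto simp: indicator_def\<close>)
    finally show ?thesis .
  qed
  show ?thesis
  proof (rule measure_eqI_generator_eq)
    let ?E = "{A \<times> B | A B. A \<in> sets (borel :: real measure) \<and> B \<in> sets (borel :: real measure)}"
    show "Int_stable ?E" by (rule Int_stable_pair_measure_generator)
    show "?E \<subseteq> Pow UNIV" by auto
    show "sets ?P = sigma_sets UNIV ?E" "sets ?Q = sigma_sets UNIV ?E"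
      by (simp_all add: sets_pair_measure)
    show "range (\<lambda>_. UNIV) \<subseteq> ?E" by (auto intro!: exI[of _ UNIV])
    show "(\<Union>i::nat. UNIV) = (UNIV :: (real \<times> real) set)" by simp
    fix Z assume "Z \<in> ?E"
    then obtain A B where Z: "Z = A \<times> B" "A \<in> sets borel" "B \<in> sets borel" by auto
    show "emeasure ?P Z = emeasure ?Q Z"
      unfolding Z(1) using Z(2,3) w v by (simp add: box fin 2)
  next
    have "emeasure ?P (UNIV \<times> UNIV) \<noteq> \<infinity>"
      by (subst box) (use w fin in auto)
    then show "emeasure ?P UNIV \<noteq> \<infinity>" by simp
  qed
qed

lemma distr_eq_laplace_pair:
  fixes X :: "'a \<Rightarrow> real \<times> real" and Y :: "'b \<Rightarrow> real \<times> real"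
  assumes "finite_measure M" "finite_measure N"
    and [measurable]: "X \<in> M \<rightarrow>\<^sub>M borel \<Otimes>\<^sub>M borel" "Y \<in> N \<rightarrow>\<^sub>M borel \<Otimes>\<^sub>M borel"
    and "AE x in M. 0 \<le> fst (X x) \<and> 0 \<le> snd (X x)" "AE x in N. 0 \<le> fst (Y x) \<and> 0 \<le> snd (Y x)"
    and "\<And>s t. 0 \<le> s \<Longrightarrow> 0 \<le> t \<Longrightarrow> (\<integral>x. exp (- (s * fst (X x) + t * snd (X x))) \<partial>M) =
        (\<integral>x. exp (- (s * fst (Y x) + t * snd (Y x))) \<partial>N)"
  shows "distr M (borel \<Otimes>\<^sub>M borel) X = distr N (borel \<Otimes>\<^sub>M borel) Y"
proof -
  have "distr (density M (\<lambda>x. ennreal 1)) (borel \<Otimes>\<^sub>M borel) X =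
      distr (density N (\<lambda>x. ennreal 1)) (borel \<Otimes>\<^sub>M borel) Y"
    by (rule weighted_laplace_unique_pair) (use assms in auto)
  then show ?thesis by (simp add: density_1)
qed

lemma (in prob_space) indep_varsI:
  assumes I: "finite I" and X: "\<And>i. i \<in> I \<Longrightarrow> X i \<in> M \<rightarrow>\<^sub>M N i"
    and eq: "\<And>A. (\<And>i. i \<in> I \<Longrightarrow> A i \<in> sets (N i)) \<Longrightarrow>
      prob {x \<in> space M. \<forall>i\<in>I. X i x \<in> A i} = (\<Prod>i\<in>I. prob {x \<in> space M. X i x \<in> A i})"
  shows "indep_vars N X I"
proof (cases "I = {}")
  case True then show ?thesis by (simp add: indep_vars_def indep_sets_def)
next
  case False
  have top: "space M \<in> {X i -` A \<inter> space M |A. A \<in> sets (N i)}" if "i \<in> I" for i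
    using measurable_space[OF X[OF that]] by (intro CollectI exI[of _ "space (N i)"]) auto
  have "prob (\<Inter> (A ` I)) = (\<Prod>i\<in>I. prob (A i))"
    if A: "A \<in> (\<Pi> i\<in>I. {X i -` A \<inter> space M |A. A \<in> sets (N i)})" for A
  proof -
    have "\<forall>i\<in>I. \<exists>B. B \<in> sets (N i) \<and> A i = X i -` B \<inter> space M"
      using A by (auto dest!: Pi_mem)
    then obtain B where B: "\<And>i. i \<in> I \<Longrightarrow> B i \<in> sets (N i)" "\<And>i. i \<in> I \<Longrightarrow> A i = X i -` B i \<inter> space M"
      by metis
    have "\<Inter> (A ` I) = {x \<in> space M. \<forall>i\<in>I. X i x \<in> B i}" "A i = {x \<in> space M. X i x \<in> B i}" if "i \<in> I" for i
      using B(2) that False by auto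
    then show ?thesis using eq[of B] B(1) False by (auto intro!: prod.cong)
  qed
  then show ?thesis
    unfolding indep_vars_def2 using measurable_sets[OF X] top X
    by (subst indep_sets_finite[OF False I]) auto
qed

lemma (in prob_space) expectation_indicator_rv:
  assumes "X \<in> M \<rightarrow>\<^sub>M N" "B \<in> sets N"
  shows "(\<integral>w. (indicator B (X w) :: real) \<partial>M) = prob {w \<in> space M. X w \<in> B}"
proof -
  have "(\<integral>w. (indicator B (X w) :: real) \<partial>M) = (\<integral>w. (indicator {w \<in> space M. X w \<in> B} w :: real) \<partial>M)"
    by (intro Bochner_Integration.integral_cong) (auto simp: indicator_def)
  then show ?thesis by (simp add: Int_absorb2)
qed

text \<open>In the factorised transform, the exponentials are replaced by indicators one index at a time;
  at each step both sides are Laplace transforms, in the arguments of that index, of the law of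
  \<open>Z j\<close> under a weight.\<close>

lemma (in prob_space) indep_vars_laplace_pair:
  fixes Z :: "'i \<Rightarrow> 'a \<Rightarrow> real \<times> real"
  assumes I: "finite I"
    and Z[measurable]: "\<And>i. i \<in> I \<Longrightarrow> Z i \<in> M \<rightarrow>\<^sub>M borel \<Otimes>\<^sub>M borel"
    and pos: "\<And>i x. i \<in> I \<Longrightarrow> x \<in> space M \<Longrightarrow> 0 \<le> fst (Z i x) \<and> 0 \<le> snd (Z i x)"
    and eq: "\<And>s t. (\<And>i. 0 \<le> s i) \<Longrightarrow> (\<And>i. 0 \<le> t i) \<Longrightarrow>
        (\<integral>x. (\<Prod>i\<in>I. exp (- (s i * fst (Z i x) + t i * snd (Z i x)))) \<partial>M) =
        (\<Prod>i\<in>I. \<integral>x. exp (- (s i * fst (Z i x) + t i * snd (Z i x))) \<partial>M)"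
  shows "indep_vars (\<lambda>_. borel \<Otimes>\<^sub>M borel) Z I"
proof (rule indep_varsI[OF I Z])
  define e where "e s t i x = (if x \<in> space M \<and> i \<in> I then exp (- (s i * fst (Z i x) + t i * snd (Z i x))) else 0)"
    for s t :: "'i \<Rightarrow> real" and i x
  have e01: "0 \<le> e s t i x" "e s t i x \<le> 1" if "\<And>i. 0 \<le> s i" "\<And>i. 0 \<le> t i" for s t i x
  proof -
    have "0 \<le> s i * fst (Z i x) + t i * snd (Z i x)" if "i \<in> I" "x \<in> space M"
      using pos[OF that] \<open>\<And>i. 0 \<le> s i\<close>[of i] \<open>\<And>i. 0 \<le> t i\<close>[of i] by simp
    then show "0 \<le> e s t i x" "e s t i x \<le> 1"
      unfolding e_def by (auto simp del: minus_add_distrib)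
  qed
  have [measurable]: "(\<lambda>x. snd (Z i x)) \<in> borel_measurable M" "(\<lambda>x. fst (Z i x)) \<in> borel_measurable M"
    if "i \<in> I" for i using Z[OF that] by measurable
  have me[measurable]: "e s t i \<in> borel_measurable M" if "i \<in> I" for s t i
    unfolding e_def using that by measurable
  have eq': "(\<integral>x. (\<Prod>i\<in>I. e s t i x) \<partial>M) = (\<Prod>i\<in>I. \<integral>x. e s t i x \<partial>M)"
    if st: "\<And>i. 0 \<le> s i" "\<And>i. 0 \<le> t i" for s t
  proof -
    have "(\<integral>x. (\<Prod>i\<in>I. e s t i x) \<partial>M) = (\<integral>x. (\<Prod>i\<in>I. exp (- (s i * fst (Z i x) + t i * snd (Z i x)))) \<partial>M)"
      by (intro Bochner_Integration.integral_cong) (auto simp: e_def)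
    also have "\<dots> = (\<Prod>i\<in>I. \<integral>x. exp (- (s i * fst (Z i x) + t i * snd (Z i x))) \<partial>M)"
      using st by (rule eq)
    also have "\<dots> = (\<Prod>i\<in>I. \<integral>x. e s t i x \<partial>M)"
      by (intro prod.cong Bochner_Integration.integral_cong) (auto simp: e_def)
    finally show ?thesis .
  qed
  \<comment> \<open>Indices in \<open>J\<close> have been converted to indicators.\<close>
  have step: "(\<integral>x. (\<Prod>i\<in>J. indicator (A i) (Z i x)) * (\<Prod>i\<in>I-J. e s t i x) \<partial>M) =
      (\<Prod>i\<in>J. prob {x \<in> space M. Z i x \<in> A i}) * (\<Prod>i\<in>I-J. \<integral>x. e s t i x \<partial>M)"
    if "J \<subseteq> I" and A: "\<And>i. i \<in> I \<Longrightarrow> A i \<in> sets (borel \<Otimes>\<^sub>M borel)"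
      and st: "\<And>i. 0 \<le> s i" "\<And>i. 0 \<le> t i" for J A s t
    using finite_subset[OF that(1) I] that(1,3,4)
  proof (induction J arbitrary: s t rule: finite_induct)
    case empty then show ?case by (simp add: eq')
  next
    case (insert j J)
    have j: "j \<in> I" "I - J = insert j (I - insert j J)" "finite (I - insert j J)"
      using insert.hyps insert.prems I by auto
    have JI: "J \<subseteq> I" using insert.prems by auto
    have st: "\<And>i. 0 \<le> s i" "\<And>i. 0 \<le> t i" using insert.prems by auto
    define w where "w x = (\<Prod>i\<in>J. indicator (A i) (Z i x)) * (\<Prod>i\<in>I-insert j J. e s t i x)" for x
    define c where "c = (\<Prod>i\<in>J. prob {x \<in> space M. Z i x \<in> A i}) * (\<Prod>i\<in>I-insert j J. \<integral>x. e s t i x \<partial>M)"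
    have w01: "0 \<le> w x" "w x \<le> 1" for x
      unfolding w_def using e01[of s t] st
      by (auto intro!: mult_le_one prod_le_1 mult_nonneg_nonneg prod_nonneg simp: indicator_def)
    have ie: "(\<integral>x. e s t i x \<partial>M) \<le> 1" "0 \<le> (\<integral>x. e s t i x \<partial>M)" if "i \<in> I" for i
      using e01[OF st] by (auto intro!: integral_le_const integral_nonneg integrable_const_bound[where B=1] me[OF that])
    have c01: "0 \<le> c" "c \<le> 1"
      unfolding c_def using ie JI
      by (auto intro!: mult_le_one prod_le_1 mult_nonneg_nonneg prod_nonneg)
    have wm[measurable]: "w \<in> borel_measurable M"
      unfolding w_def using JI A by (intro borel_measurable_times borel_measurable_prod measurable_compose[OF Z borel_measurable_indicator]) auto
    have D: "distr (density M (\<lambda>x. ennreal (w x))) (borel \<Otimes>\<^sub>M borel) (Z j) =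
         distr (density M (\<lambda>x. ennreal c)) (borel \<Otimes>\<^sub>M borel) (Z j)"
    proof (rule weighted_laplace_unique_pair)
      fix p q :: real assume pq: "0 \<le> p" "0 \<le> q"
      define s' t' where "s' = s(j := p)" and "t' = t(j := q)"
      have o: "e s' t' i = e s t i" if "i \<noteq> j" for i
        using that by (auto simp: e_def s'_def t'_def fun_eq_iff)
      have "(\<integral>x. w x * exp (- (p * fst (Z j x) + q * snd (Z j x))) \<partial>M) =
         (\<integral>x. (\<Prod>i\<in>J. indicator (A i) (Z i x)) * (\<Prod>i\<in>I-J. e s' t' i x) \<partial>M)"
        unfolding j(2) using j(1,3)
        by (intro Bochner_Integration.integral_cong)
          (auto simp: w_def o e_def[of _ _ j] s'_def[THEN fun_cong] t'_def[THEN fun_cong] intro!: prod.cong o[THEN fun_cong, symmetric])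
      also have "\<dots> = (\<Prod>i\<in>J. prob {x \<in> space M. Z i x \<in> A i}) * (\<Prod>i\<in>I-J. \<integral>x. e s' t' i x \<partial>M)"
        by (rule insert.IH) (use JI st pq in \<open>auto simp: s'_def t'_def\<close>)
      also have "\<dots> = c * (\<integral>x. e s' t' j x \<partial>M)"
        unfolding j(2) using j(3) by (auto simp: c_def o intro!: prod.cong)
      also have "\<dots> = c * (\<integral>x. exp (- (p * fst (Z j x) + q * snd (Z j x))) \<partial>M)"
        using j(1) by (intro arg_cong2[where f="(*)"] refl Bochner_Integration.integral_cong) (auto simp: e_def s'_def t'_def)
      finally show "(\<integral>x. w x * exp (- (p * fst (Z j x) + q * snd (Z j x))) \<partial>M) =
          (\<integral>x. c * exp (- (p * fst (Z j x) + q * snd (Z j x))) \<partial>M)" by simp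
    qed (use j(1) w01 c01 pos in \<open>auto intro: finite_measure_axioms\<close>)
    have "(\<integral>x. indicator (A j) x \<partial>distr (density M (\<lambda>x. ennreal (w x))) (borel \<Otimes>\<^sub>M borel) (Z j)) =
         (\<integral>x. (indicator (A j) x :: real) \<partial>distr (density M (\<lambda>x. ennreal c)) (borel \<Otimes>\<^sub>M borel) (Z j))"
      by (simp only: D)
    then have "(\<integral>x. w x * indicator (A j) (Z j x) \<partial>M) = (\<integral>x. c * indicator (A j) (Z j x) \<partial>M)"
      by (subst (asm) (1 2) integral_indicator_distr_density) (use j(1) w01 c01 A[OF j(1)] in auto)
    also have "\<dots> = c * prob {x \<in> space M. Z j x \<in> A j}"
      using expectation_indicator_rv[OF Z[OF j(1)] A[OF j(1)]] by simp
    finally show ?case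
      using insert.hyps by (simp add: w_def c_def mult_ac)
  qed
  fix A :: "'i \<Rightarrow> (real \<times> real) set"
  assume A: "\<And>i. i \<in> I \<Longrightarrow> A i \<in> sets (borel \<Otimes>\<^sub>M borel)"
  have E: "{x \<in> space M. \<forall>i\<in>I. Z i x \<in> A i} \<in> events"
    using I A measurable_sets[OF Z A] by (intro sets.sets_Collect_finite_All) (auto simp: vimage_def Int_def conj_commute)
  have "prob {x \<in> space M. \<forall>i\<in>I. Z i x \<in> A i} = (\<integral>x. indicator {x \<in> space M. \<forall>i\<in>I. Z i x \<in> A i} x \<partial>M)"
    using E by simp
  also have "\<dots> = (\<integral>x. (\<Prod>i\<in>I. indicator (A i) (Z i x)) \<partial>M)"
  proof (rule Bochner_Integration.integral_cong[OF refl])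
    fix x assume "x \<in> space M"
    then show "indicator {x \<in> space M. \<forall>i\<in>I. Z i x \<in> A i} x = (\<Prod>i\<in>I. indicator (A i) (Z i x) :: real)"
      using I prod_zero[OF I, of "\<lambda>i. indicator (A i) (Z i x) :: real"]
      by (cases "\<forall>i\<in>I. Z i x \<in> A i") (auto simp: indicator_def)
  qed
  also have "\<dots> = (\<Prod>i\<in>I. prob {x \<in> space M. Z i x \<in> A i})"
    using step[of I A "\<lambda>_. 0" "\<lambda>_. 0"] A by simp
  finally show "prob {x \<in> space M. \<forall>i\<in>I. Z i x \<in> A i} = (\<Prod>i\<in>I. prob {x \<in> space M. Z i x \<in> A i})" .
qed

section \<open>The Gamma law\<close>

lemma sets_gamma_law[simp, measurable_cong]: "sets (gamma_law c) = sets borel"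
  by (simp add: gamma_law_def)

lemma space_gamma_law[simp]: "space (gamma_law c) = UNIV"
  by (simp add: gamma_law_def)

lemma nn_integral_exp_gamma_law:
  assumes c: "0 < c" and u: "0 \<le> u"
  shows "(\<integral>\<^sup>+x. ennreal (exp (- u * x)) \<partial>gamma_law c) = ennreal ((1 + u) powr (- c))"
proof -
  define g where "g t = ennreal (indicator {0..} t * t powr (c - 1) / exp t)" for t :: real
  have g[measurable]: "g \<in> borel_measurable borel" unfolding g_def by measurable
  define J where "J = (\<integral>\<^sup>+x. g (0 + (1 + u) * x) \<partial>lborel)"
  have "ennreal (Gamma c) = (\<integral>\<^sup>+t. g t \<partial>lborel)"
    unfolding g_def using Gamma_conv_nn_integral_real[OF c] by simp
  also have "\<dots> = ennreal (1 + u) * J"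
    unfolding J_def using u by (subst nn_integral_real_affine[where c="1 + u" and t=0]) auto
  finally have J: "ennreal (1 + u) * J = ennreal (Gamma c)" by simp
  have Gc: "Gamma c > 0" using c by (rule Gamma_real_pos)
  have pt: "ennreal (if 0 < x then x powr (c - 1) * exp (- x) / Gamma c else 0) * ennreal (exp (- u * x)) =
      ennreal ((1 + u) powr (1 - c) / Gamma c) * g (0 + (1 + u) * x)" for x
  proof (cases "0 < x")
    case True
    have "(x powr (c - 1) * exp (- x) / Gamma c) * exp (- u * x) =
      ((1 + u) powr (1 - c) / Gamma c) * (((1 + u) * x) powr (c - 1) / exp ((1 + u) * x))"
    proof -
      have "(1 + u) powr (1 - c) * (1 + u) powr (c - 1) = 1"
        using u by (simp flip: powr_add)
      then have "(1 + u) powr (1 - c) * ((1 + u) * x) powr (c - 1) = x powr (c - 1)"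
        using True u by (simp add: powr_mult mult.assoc[symmetric])
      moreover have "exp (- x) * exp (- u * x) = inverse (exp ((1 + u) * x))"
        by (simp add: distrib_right flip: exp_add exp_minus)
      ultimately show ?thesis
        by (simp add: divide_inverse mult_ac)
    qed
    then show ?thesis using True u Gc
      by (simp add: g_def flip: ennreal_mult)
  next
    case False
    then show ?thesis using u by (cases "x = 0") (auto simp: g_def indicator_def zero_le_mult_iff)
  qed
  have "(\<integral>\<^sup>+x. ennreal (exp (- u * x)) \<partial>gamma_law c) =
      (\<integral>\<^sup>+x. ennreal (if 0 < x then x powr (c - 1) * exp (- x) / Gamma c else 0) * ennreal (exp (- u * x)) \<partial>lborel)"
    unfolding gamma_law_def using c by (simp add: nn_integral_density)
  also have "\<dots> = ennreal ((1 + u) powr (1 - c) / Gamma c) * J"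
    unfolding pt J_def by (rule nn_integral_cmult) simp
  also have "(1 + u) powr (1 - c) / Gamma c = ((1 + u) powr (- c) / Gamma c) * (1 + u)"
    using u by (simp add: powr_diff powr_minus divide_inverse)
  also have "ennreal (((1 + u) powr (- c) / Gamma c) * (1 + u)) * J =
      ennreal ((1 + u) powr (- c) / Gamma c) * (ennreal (1 + u) * J)"
    using u Gc by (subst ennreal_mult) (auto simp: mult.assoc simp del: ennreal_plus)
  also have "\<dots> = ennreal ((1 + u) powr (- c))"
    unfolding J using Gc u by (simp flip: ennreal_mult)
  finally show ?thesis .
qed

lemma prob_space_gamma_law:
  assumes "0 \<le> c" shows "prob_space (gamma_law c)"
proof (cases "c = 0")
  case True then show ?thesis by (simp add: gamma_law_def prob_space_return)
next
  case False
  then have "0 < c" using assms by simp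
  from nn_integral_exp_gamma_law[OF this, of 0] show ?thesis
    by (intro prob_spaceI) simp
qed

lemma AE_gamma_law_pos: "0 < c \<Longrightarrow> AE x in gamma_law c. 0 < x"
  unfolding gamma_law_def by (simp add: AE_density)

lemma AE_gamma_law_nonneg: "0 \<le> c \<Longrightarrow> AE x in gamma_law c. 0 \<le> x"
proof (cases "c = 0")
  case True
  have "AE x in return borel (0::real). 0 \<le> x" by (subst AE_return) auto
  moreover have "gamma_law c = return borel 0" using \<open>c = 0\<close> by (simp add: gamma_law_def)
  ultimately show ?thesis by (simp only:)
next
  case False
  assume "0 \<le> c"
  with False AE_gamma_law_pos[of c] show ?thesis by (auto elim: AE_mp)
qed

lemma gamma_law_laplace:
  assumes "0 \<le> c" "0 \<le> u"
  shows "(\<integral>x. exp (- u * x) \<partial>gamma_law c) = (1 + u) powr (- c)"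
proof (cases "c = 0")
  case True then show ?thesis using assms by (simp add: gamma_law_def integral_return)
next
  case False
  then have c: "0 < c" using assms by simp
  show ?thesis
    by (subst integral_eq_nn_integral) (use nn_integral_exp_gamma_law[OF c assms(2)] assms(2) in auto)
qed

lemma (in prob_space) distr_eq_gamma_law:
  assumes c: "0 \<le> c" and X[measurable]: "X \<in> borel_measurable M" and pos: "AE w in M. 0 \<le> X w"
    and L: "\<And>u. 0 \<le> u \<Longrightarrow> (\<integral>w. exp (- u * X w) \<partial>M) = (1 + u) powr (- c)"
  shows "distr M borel X = gamma_law c"
proof (rule finite_measure_eq_laplace)
  show "finite_measure (distr M borel X)" by (intro finite_measure_distr) simp
  show "finite_measure (gamma_law c)"
    using prob_space_gamma_law[OF c] by (rule prob_space.finite_measure)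
  fix u :: real assume u: "0 \<le> u"
  have "(\<integral>x. exp (- u * x) \<partial>distr M borel X) = (\<integral>w. exp (- u * X w) \<partial>M)"
    by (rule integral_distr) auto
  then show "(\<integral>x. exp (- u * x) \<partial>distr M borel X) = (\<integral>x. exp (- u * x) \<partial>gamma_law c)"
    by (simp only: L[OF u] gamma_law_laplace[OF c u])
qed (use c pos in \<open>auto simp: AE_distr_iff AE_gamma_law_nonneg\<close>)

section \<open>Laplace functionals of Gamma random measures\<close>

text \<open>States, at the single function \<open>f\<close>, the value of the Laplace functional that characterises Gamma random
  measures with shape measure \<open>\<alpha>\<close>. Measurability of the integral is included so that the property can be carried through
  limits.\<close>

definition gamma_laplace_at :: "'w measure \<Rightarrow> ('w \<Rightarrow> 'x measure) \<Rightarrow> 'x measure \<Rightarrow> ('x \<Rightarrow> real) \<Rightarrow> bool" where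
  "gamma_laplace_at N \<mu> \<alpha> f \<longleftrightarrow>
     (\<lambda>w. \<integral>x. f x \<partial>\<mu> w) \<in> borel_measurable N \<and>
     (\<integral>w. exp (- (\<integral>x. f x \<partial>\<mu> w)) \<partial>N) = exp (- (\<integral>x. ln (1 + f x) \<partial>\<alpha>))"

text \<open>Dominated convergence on the three levels \<open>\<mu> w\<close>, \<open>N\<close> and \<open>\<alpha>\<close>.\<close>

lemma gamma_laplace_at_limit:
  assumes N: "prob_space N" and \<alpha>: "finite_measure \<alpha>"
    and \<mu>: "\<And>w. w \<in> space N \<Longrightarrow> sets (\<mu> w) = sets \<alpha> \<and> finite_measure (\<mu> w)"
    and F: "\<And>m. gamma_laplace_at N \<mu> \<alpha> (F m)"
    and meas: "\<And>m. F m \<in> borel_measurable \<alpha>"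
    and bnd: "\<And>m x. 0 \<le> F m x \<and> F m x \<le> B"
    and lim: "\<And>x. x \<in> space \<alpha> \<Longrightarrow> (\<lambda>m. F m x) \<longlonglongrightarrow> f x"
  shows "gamma_laplace_at N \<mu> \<alpha> f"
proof -
  interpret N: prob_space N by fact
  interpret \<alpha>: finite_measure \<alpha> by fact
  have fm[measurable]: "f \<in> borel_measurable \<alpha>"
    by (rule borel_measurable_LIMSEQ_real[OF lim meas])
  note [measurable] = meas
  have c: "(\<lambda>m. \<integral>x. F m x \<partial>\<mu> w) \<longlonglongrightarrow> (\<integral>x. f x \<partial>\<mu> w)" if w: "w \<in> space N" for w
  proof -
    interpret m: finite_measure "\<mu> w" using \<mu>[OF w] by simp
    have [measurable_cong]: "sets (\<mu> w) = sets \<alpha>" and sp: "space (\<mu> w) = space \<alpha>"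
      using \<mu>[OF w] by (auto dest: sets_eq_imp_space_eq)
    show ?thesis
      by (rule integral_dominated_convergence[where w="\<lambda>_. B"]) (use bnd lim sp in auto)
  qed
  have m: "(\<lambda>w. \<integral>x. F m x \<partial>\<mu> w) \<in> borel_measurable N" for m
    using F by (simp add: gamma_laplace_at_def)
  have M[measurable]: "(\<lambda>w. \<integral>x. f x \<partial>\<mu> w) \<in> borel_measurable N"
    by (rule borel_measurable_LIMSEQ_real[OF c m])
  note [measurable] = m
  have "(\<lambda>m. \<integral>w. exp (- (\<integral>x. F m x \<partial>\<mu> w)) \<partial>N) \<longlonglongrightarrow> (\<integral>w. exp (- (\<integral>x. f x \<partial>\<mu> w)) \<partial>N)"
  proof (rule integral_dominated_convergence[where w="\<lambda>_. 1"])
    show "AE w in N. norm (exp (- (\<integral>x. F m x \<partial>\<mu> w))) \<le> 1" for m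
      using bnd by (auto intro!: integral_nonneg)
    show "AE w in N. (\<lambda>m. exp (- (\<integral>x. F m x \<partial>\<mu> w))) \<longlonglongrightarrow> exp (- (\<integral>x. f x \<partial>\<mu> w))"
      using c by (auto intro!: tendsto_intros)
  qed auto
  moreover have "(\<lambda>m. \<integral>w. exp (- (\<integral>x. F m x \<partial>\<mu> w)) \<partial>N) \<longlonglongrightarrow> exp (- (\<integral>x. ln (1 + f x) \<partial>\<alpha>))"
  proof -
    have "(\<lambda>m. \<integral>x. ln (1 + F m x) \<partial>\<alpha>) \<longlonglongrightarrow> (\<integral>x. ln (1 + f x) \<partial>\<alpha>)"
    proof (rule integral_dominated_convergence[where w="\<lambda>_. B"])
      show "AE x in \<alpha>. norm (ln (1 + F m x)) \<le> B" for m
        by (intro AE_I2) (use bnd ln_add_one_self_le_self in \<open>auto intro: order_trans\<close>)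
      have "0 \<le> f x" if "x \<in> space \<alpha>" for x
        by (rule LIMSEQ_le_const[OF lim[OF that]]) (use bnd in auto)
      then show "AE x in \<alpha>. (\<lambda>m. ln (1 + F m x)) \<longlonglongrightarrow> ln (1 + f x)"
        using lim by (auto intro!: tendsto_intros simp: add_nonneg_eq_0_iff)
    qed auto
    then have "(\<lambda>m. exp (- (\<integral>x. ln (1 + F m x) \<partial>\<alpha>))) \<longlonglongrightarrow> exp (- (\<integral>x. ln (1 + f x) \<partial>\<alpha>))"
      by (intro tendsto_intros)
    then show ?thesis using F by (simp add: gamma_laplace_at_def)
  qed
  ultimately have "(\<integral>w. exp (- (\<integral>x. f x \<partial>\<mu> w)) \<partial>N) = exp (- (\<integral>x. ln (1 + f x) \<partial>\<alpha>))"
    by (rule LIMSEQ_unique)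
  with M show ?thesis by (simp add: gamma_laplace_at_def)
qed

lemma integral_finitely_many_values:
  fixes h :: "'x \<Rightarrow> nat" and g :: "nat \<Rightarrow> real"
  assumes "finite_measure \<nu>" and h[measurable]: "h \<in> \<nu> \<rightarrow>\<^sub>M count_space UNIV"
    and k: "\<And>x. x \<in> space \<nu> \<Longrightarrow> h x < k"
  shows "(\<integral>x. g (h x) \<partial>\<nu>) = (\<Sum>j<k. g j * measure \<nu> {x\<in>space \<nu>. h x = j})"
proof -
  interpret finite_measure \<nu> by fact
  have "(\<integral>x. g (h x) \<partial>\<nu>) = (\<integral>x. (\<Sum>j<k. g j * indicator {x\<in>space \<nu>. h x = j} x) \<partial>\<nu>)"
  proof (rule Bochner_Integration.integral_cong[OF refl])
    fix x assume x: "x \<in> space \<nu>"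
    have "(\<Sum>j<k. g j * indicator {x\<in>space \<nu>. h x = j} x) = (\<Sum>j<k. if j = h x then g j else 0)"
      using x by (intro sum.cong) (auto simp: indicator_def)
    also have "\<dots> = g (h x)" using k[OF x] by (simp add: sum.delta')
    finally show "g (h x) = (\<Sum>j<k. g j * indicator {x\<in>space \<nu>. h x = j} x)" by simp
  qed
  also have "\<dots> = (\<Sum>j<k. g j * measure \<nu> {x\<in>space \<nu>. h x = j})"
    by (subst Bochner_Integration.integral_sum) (auto intro!: sum.cong integrable_real_mult_indicator simp: Int_absorb2 less_top[symmetric])
  finally show ?thesis .
qed

text \<open>For a function with finitely many values the formula is the product, over the level sets, of
  the Laplace transforms of independent Gamma variables; \<open>f\<close> is the limit of such functions, obtained by
  rounding it down to multiples of \<open>1 / Suc m\<close>.\<close>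

lemma gamma_random_measure_laplace:
  fixes \<alpha> :: "'x measure"
  assumes G: "gamma_random_measure N \<alpha> \<mu>" and \<alpha>: "finite_measure \<alpha>"
    and f[measurable]: "f \<in> borel_measurable \<alpha>" and bnd: "\<And>x. 0 \<le> f x \<and> f x \<le> B"
  shows "gamma_laplace_at N \<mu> \<alpha> f"
proof -
  interpret N: prob_space N using G by (simp add: gamma_random_measure_def)
  interpret \<alpha>: finite_measure \<alpha> by fact
  have \<mu>: "sets (\<mu> w) = sets \<alpha> \<and> finite_measure (\<mu> w)" if "w \<in> space N" for w
    using G that by (simp add: gamma_random_measure_def)
  have m\<mu>: "(\<lambda>w. measure (\<mu> w) A) \<in> borel_measurable N"
      "distr N borel (\<lambda>w. measure (\<mu> w) A) = gamma_law (measure \<alpha> A)" if "A \<in> sets \<alpha>" for A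
    using G that by (auto simp: gamma_random_measure_def)
  have ind: "N.indep_vars (\<lambda>_. borel) (\<lambda>i w. measure (\<mu> w) (A i)) {..<k}"
    if "\<And>i. A i \<in> sets \<alpha>" "disjoint_family A" for A and k :: nat
    using G that unfolding gamma_random_measure_def
    by (auto simp: disjoint_family_on_def)
  have B0: "0 \<le> B" using bnd[of undefined] by linarith
  define F where "F m x = real (nat \<lfloor>real (Suc m) * f x\<rfloor>) / real (Suc m)" for m x
  show ?thesis
  proof (rule gamma_laplace_at_limit[OF N.prob_space_axioms \<alpha> \<mu>, where F=F and B=B])
    fix m
    define h where "h x = nat \<lfloor>real (Suc m) * f x\<rfloor>" for x
    define g where "g j = real j / real (Suc m)" for j
    define k where "k = Suc (nat \<lfloor>real (Suc m) * B\<rfloor>)"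
    define A where "A j = {x \<in> space \<alpha>. h x = j}" for j
    have h[measurable]: "h \<in> \<alpha> \<rightarrow>\<^sub>M count_space UNIV" unfolding h_def by measurable
    have hk: "h x < k" for x
      unfolding h_def k_def using bnd[of x] by (auto intro!: nat_mono floor_mono mult_left_mono simp: less_Suc_eq_le)
    have A[measurable]: "A j \<in> sets \<alpha>" for j unfolding A_def by measurable
    have disj: "disjoint_family A" by (auto simp: disjoint_family_on_def A_def)
    have F: "F m = (\<lambda>x. g (h x))" by (simp add: F_def g_def h_def fun_eq_iff)
    have g0: "0 \<le> g j" for j by (simp add: g_def)
    have int: "(\<integral>x. F m x \<partial>\<mu> w) = (\<Sum>j<k. g j * measure (\<mu> w) (A j))" if w: "w \<in> space N" for w
    proof -
      have [measurable_cong]: "sets (\<mu> w) = sets \<alpha>" and sp: "space (\<mu> w) = space \<alpha>"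
        using \<mu>[OF w] by (auto dest: sets_eq_imp_space_eq)
      show ?thesis unfolding F
        by (subst integral_finitely_many_values[where k=k]) (use \<mu>[OF w] hk sp in \<open>auto simp: A_def\<close>)
    qed
    have meas: "(\<lambda>w. \<integral>x. F m x \<partial>\<mu> w) \<in> borel_measurable N"
      by (subst measurable_cong[OF int], assumption) (intro borel_measurable_sum borel_measurable_times borel_measurable_const m\<mu>(1) A)
    have "(\<integral>w. exp (- (\<integral>x. F m x \<partial>\<mu> w)) \<partial>N) = (\<integral>w. (\<Prod>j<k. exp (- g j * measure (\<mu> w) (A j))) \<partial>N)"
      by (intro Bochner_Integration.integral_cong refl) (simp add: int sum_negf flip: exp_sum)
    also have "\<dots> = (\<Prod>j<k. \<integral>w. exp (- g j * measure (\<mu> w) (A j)) \<partial>N)"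
    proof (rule N.indep_vars_lebesgue_integral)
      show "N.indep_vars (\<lambda>_. borel) (\<lambda>j w. exp (- g j * measure (\<mu> w) (A j))) {..<k}"
        by (rule N.indep_vars_compose2[OF ind[OF A disj]]) simp
      show "integrable N (\<lambda>w. exp (- g j * measure (\<mu> w) (A j)))" for j
        by (rule N.integrable_const_bound[where B=1]) (use g0 m\<mu>(1) in auto)
    qed simp
    also have "\<dots> = (\<Prod>j<k. exp (- (measure \<alpha> (A j) * ln (1 + g j))))"
    proof (rule prod.cong[OF refl])
      fix j
      have "(\<integral>w. exp (- g j * measure (\<mu> w) (A j)) \<partial>N) = (\<integral>x. exp (- g j * x) \<partial>distr N borel (\<lambda>w. measure (\<mu> w) (A j)))"
        by (rule integral_distr[symmetric]) (auto intro: m\<mu>(1))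
      also have "\<dots> = (1 + g j) powr (- measure \<alpha> (A j))"
        using g0[of j] by (simp only: m\<mu>(2)[OF A] gamma_law_laplace measure_nonneg)
      finally show "(\<integral>w. exp (- g j * measure (\<mu> w) (A j)) \<partial>N) = exp (- (measure \<alpha> (A j) * ln (1 + g j)))"
        using g0[of j] by (simp add: powr_def)
    qed
    also have "\<dots> = exp (- (\<Sum>j<k. ln (1 + g j) * measure \<alpha> (A j)))"
      by (simp add: sum_negf mult.commute flip: exp_sum)
    also have "(\<Sum>j<k. ln (1 + g j) * measure \<alpha> (A j)) = (\<integral>x. ln (1 + F m x) \<partial>\<alpha>)"
      unfolding F A_def by (rule integral_finitely_many_values[symmetric]) (use hk \<alpha> in auto)
    finally show "gamma_laplace_at N \<mu> \<alpha> (F m)"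
      using meas by (simp add: gamma_laplace_at_def)
    show "F m \<in> borel_measurable \<alpha>" unfolding F by measurable
  next
    fix m x
    have "real (nat \<lfloor>real (Suc m) * f x\<rfloor>) \<le> real (Suc m) * f x"
      using bnd[of x] by (simp add: of_nat_floor)
    also have "\<dots> \<le> B * real (Suc m)" using bnd[of x] by (simp add: mult.commute mult_left_mono)
    finally show "0 \<le> F m x \<and> F m x \<le> B" by (simp add: F_def divide_le_eq)
  next
    fix x
    show "(\<lambda>m. F m x) \<longlonglongrightarrow> f x"
    proof (rule tendsto_sandwich)
      show "\<forall>\<^sub>F m in sequentially. f x - 1 / real (Suc m) \<le> F m x"
      proof (intro always_eventually allI)
        fix m
        define y where "y = real (Suc m) * f x"
        have y: "0 \<le> y" "f x = y / real (Suc m)" using bnd[of x] by (auto simp: y_def)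
        have "y - 1 \<le> real (nat \<lfloor>y\<rfloor>)" using y by linarith
        then have "(y - 1) / real (Suc m) \<le> real (nat \<lfloor>y\<rfloor>) / real (Suc m)"
          by (intro divide_right_mono) auto
        then show "f x - 1 / real (Suc m) \<le> F m x"
          unfolding F_def y_def[symmetric] by (simp only: y(2) diff_divide_distrib)
      qed
      show "\<forall>\<^sub>F m in sequentially. F m x \<le> f x"
      proof (intro always_eventually allI)
        fix m
        have "real (nat \<lfloor>real (Suc m) * f x\<rfloor>) \<le> real (Suc m) * f x"
          using bnd[of x] by (simp add: of_nat_floor)
        then show "F m x \<le> f x" by (simp add: F_def field_simps)
      qed
      show "(\<lambda>m. f x - 1 / real (Suc m)) \<longlonglongrightarrow> f x"
        using tendsto_diff[OF tendsto_const LIMSEQ_inverse_real_of_nat, of "f x"] by (simp add: inverse_eq_divide)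
    qed simp
  qed
qed

section \<open>Bounded Borel functions as iterated limits of continuous functions\<close>

text \<open>The bounded Baire functions. All bounded nonnegative Borel functions are among them, so a property of
  bounded functions that holds for continuous functions and survives bounded pointwise limits holds for
  all of those. For a nonlinear property such as the Laplace formula this replaces the monotone class
  theorem.\<close>

inductive baire :: "(real \<Rightarrow> real) \<Rightarrow> bool" where
  cont: "continuous_on UNIV f \<Longrightarrow> (\<And>x. \<bar>f x\<bar> \<le> B) \<Longrightarrow> baire f"
| lim: "(\<And>n. baire (F n)) \<Longrightarrow> (\<And>n x. \<bar>F n x\<bar> \<le> B) \<Longrightarrow> (\<And>x. (\<lambda>n. F n x) \<longlonglongrightarrow> f x) \<Longrightarrow> baire f"

lemma baire_bounded: "baire f \<Longrightarrow> \<exists>B. \<forall>x. \<bar>f x\<bar> \<le> B"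
proof (induction rule: baire.induct)
  case (lim F B f)
  have "\<bar>f x\<bar> \<le> B" for x
    by (rule LIMSEQ_le_const2[OF tendsto_rabs[OF lim(3)]]) (use lim(2) in auto)
  then show ?case by blast
qed blast

lemma baire_measurable: "baire f \<Longrightarrow> f \<in> borel_measurable borel"
proof (induction rule: baire.induct)
  case (cont f B) then show ?case by (simp add: borel_measurable_continuous_onI)
next
  case (lim F B f) show ?case by (rule borel_measurable_LIMSEQ_real[OF lim(3) lim(4)])
qed

text \<open>Closure under addition takes two inductions: with one summand continuous, and then in general.\<close>

lemma baire_add_continuous:
  "baire f \<Longrightarrow> continuous_on UNIV g \<Longrightarrow> (\<And>x. \<bar>g x\<bar> \<le> C) \<Longrightarrow> baire (\<lambda>x. g x + f x)"
proof (induction rule: baire.induct)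
  case (cont f B)
  show ?case
    by (rule baire.cont[where B="C + B"])
       (use cont in \<open>auto intro!: continuous_intros order_trans[OF abs_triangle_ineq] add_mono\<close>)
next
  case (lim F B f)
  show ?case
    by (rule baire.lim[where B="C + B" and F="\<lambda>n x. g x + F n x"])
       (use lim in \<open>auto intro!: tendsto_intros order_trans[OF abs_triangle_ineq] add_mono\<close>)
qed

lemma baire_add: "baire f \<Longrightarrow> baire g \<Longrightarrow> baire (\<lambda>x. f x + g x)"
proof (induction rule: baire.induct)
  case (cont f B) then show ?case by (intro baire_add_continuous)
next
  case (lim F B f)
  from baire_bounded[OF lim(5)] obtain C where "\<And>x. \<bar>g x\<bar> \<le> C" by blast
  note C = this
  show ?case
  proof (rule baire.lim[where B="B + C" and F="\<lambda>n x. F n x + g x"])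
    show "baire (\<lambda>x. F n x + g x)" for n using lim(4,5) .
    show "\<bar>F n x + g x\<bar> \<le> B + C" for n x
      using lim(2)[of n x] C[of x] by linarith
    show "(\<lambda>n. F n x + g x) \<longlonglongrightarrow> f x + g x" for x
      using lim(3) by (rule tendsto_add) simp
  qed
qed

lemma baire_cmult: "baire f \<Longrightarrow> baire (\<lambda>x. c * f x)"
proof (induction rule: baire.induct)
  case (cont f B)
  show ?case
    by (rule baire.cont[where B="\<bar>c\<bar> * B"])
       (use cont in \<open>auto intro!: continuous_intros mult_left_mono simp: abs_mult\<close>)
next
  case (lim F B f)
  show ?case
    by (rule baire.lim[where B="\<bar>c\<bar> * B" and F="\<lambda>n x. c * F n x"])
       (use lim in \<open>auto intro!: tendsto_intros mult_left_mono simp: abs_mult\<close>)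
qed

lemma baire_const: "baire (\<lambda>_. c)"
  by (rule baire.cont[where B="\<bar>c\<bar>"]) auto

lemma baire_sum: "(\<And>i. i < n \<Longrightarrow> baire (f i)) \<Longrightarrow> baire (\<lambda>x. \<Sum>i<n. f i x)" for n :: nat
  by (induction n) (auto intro!: baire_const baire_add)

text \<open>Piecewise linear functions of slope \<open>- n\<close> converge to the indicator.\<close>

lemma baire_indicator_atMost: "baire (indicator {..a})"
proof (rule baire.lim[where B=1])
  fix n :: nat
  show "baire (\<lambda>y. max 0 (min 1 (1 - real n * (y - a))))"
    by (rule baire.cont[where B=1]) (auto intro!: continuous_intros)
  show "\<bar>max 0 (min 1 (1 - real n * (x - a)))\<bar> \<le> 1" for x by auto
next
  fix x
  show "(\<lambda>n. max 0 (min 1 (1 - real n * (x - a)))) \<longlonglongrightarrow> indicator {..a} x"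
  proof (cases "x \<le> a")
    case True
    have "1 \<le> 1 - real n * (x - a)" for n using True by (simp add: mult_le_0_iff)
    then have "max 0 (min 1 (1 - real n * (x - a))) = indicator {..a} x" for n
      using True by (simp add: min_def max_def)
    then show ?thesis by simp
  next
    case False
    obtain m :: nat where m: "1 < real m * (x - a)"
      using ex_less_of_nat_mult[of "x - a" 1] False by auto
    have "max 0 (min 1 (1 - real n * (x - a))) = indicator {..a} x" if "m \<le> n" for n
    proof -
      have "real m * (x - a) \<le> real n * (x - a)" using False that by (intro mult_right_mono) auto
      then have "1 - real n * (x - a) < 0" using m by linarith
      then show ?thesis using False by simp
    qed
    then show ?thesis by (intro tendsto_eventually eventually_sequentiallyI)
  qed
qed

text \<open>The sets with Baire indicator form a Dynkin system that contains the half-lines.\<close>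

lemma baire_indicator:
  assumes "A \<in> sets borel" shows "baire (indicator A)"
proof -
  have sg: "A \<in> sigma_sets UNIV (range (\<lambda>a::real. {..a}))"
    using assms by (simp add: borel_eq_atMost)
  have st: "Int_stable (range (\<lambda>a::real. {..a}))"
    by (auto simp: Int_stable_def intro!: image_eqI)
  have sub: "range (\<lambda>a::real. {..a}) \<subseteq> Pow UNIV" by simp
  from st sub sg show ?thesis
  proof (induction rule: sigma_sets_induct_disjoint)
    case (compl A)
    have "baire (\<lambda>x. 1 + (-1) * indicator A x)" by (intro baire_add baire_const baire_cmult compl)
    moreover have "(\<lambda>x. 1 + (-1) * indicator A x) = (indicator (UNIV - A) :: real \<Rightarrow> real)"
      by (auto simp: fun_eq_iff indicator_def)
    ultimately show ?case by simp
  next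
    case (union A)
    show ?case
    proof (rule baire.lim[where B=1])
      fix n :: nat
      have "(\<lambda>x. \<Sum>i<n. indicator (A i) x) = (indicator (\<Union>i<n. A i) :: real \<Rightarrow> real)"
        by (rule ext, rule indicator_UN_disjoint[symmetric])
           (use union(1) in \<open>auto simp: disjoint_family_on_def\<close>)
      moreover have "baire (\<lambda>x. \<Sum>i<n. indicator (A i) x)" using union by (intro baire_sum)
      ultimately show "baire (indicator (\<Union>i<n. A i))" by simp
      show "\<bar>indicator (\<Union>i<n. A i) x\<bar> \<le> (1::real)" for x by (simp add: indicator_def)
    qed (rule LIMSEQ_indicator_UN)
  next
    case empty
    show ?case using baire_const[of 0] by (simp add: fun_eq_iff indicator_def)
  qed (auto intro: baire_indicator_atMost)
qed

lemma borel_imp_baire: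
  assumes "f \<in> borel_measurable borel" "\<And>x. 0 \<le> f x" "\<And>x. f x \<le> B"
  shows "baire f"
proof -
  have "(\<forall>x. f x \<le> B) \<longrightarrow> baire f" for B
    using assms(1,2)
  proof (induction arbitrary: B rule: borel_measurable_induct_real)
    case (set A) then show ?case by (simp add: baire_indicator)
  next
    case (mult u c)
    show ?case
    proof (cases "c = 0")
      case True then show ?thesis by (simp add: baire_const)
    next
      case False
      with mult(1) have c: "0 < c" by simp
      show ?thesis
      proof
        assume "\<forall>x. c * u x \<le> B"
        then have "\<forall>x. u x \<le> B / c" using c by (simp add: le_divide_eq mult.commute)
        then show "baire (\<lambda>x. c * u x)" using mult(4)[of "B / c"] by (simp add: baire_cmult)
      qed
    qed
  next
    case (add u v)
    show ?case
    proof
      assume B: "\<forall>x. v x + u x \<le> B"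
      have "\<forall>x. v x \<le> B" "\<forall>x. u x \<le> B"
        using B add(2,4) by (meson add_increasing add_increasing2 order.refl order_trans)+
      then show "baire (\<lambda>x. v x + u x)" using add by (intro baire_add) auto
    qed
  next
    case (seq U)
    show ?case
    proof
      assume B: "\<forall>x. f x \<le> B"
      have le: "U n x \<le> B" for n x
        using incseq_le[of "\<lambda>n. U n x" "f x" n] seq(3) seq(4)[of x] B[rule_format, of x]
        by (force simp: incseq_def le_fun_def)
      show "baire f"
      proof (rule baire.lim[where F=U and B=B])
        show "baire (U n)" for n using seq(5) le by blast
      qed (use seq(2,4) le in \<open>auto simp: abs_of_nonneg\<close>)
    qed
  qed
  then show ?thesis using assms(3) by blast
qed

section \<open>The Laplace functional of a Gamma process\<close>

lemma integral_density_indicator: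
  fixes f :: "real \<Rightarrow> real"
  assumes [measurable_cong]: "sets \<nu> = sets borel" and [measurable]: "A \<in> sets borel" "f \<in> borel_measurable borel"
  shows "(\<integral>x. f x \<partial>density \<nu> (indicator A)) = (\<integral>x. indicator A x * f x \<partial>\<nu>)"
proof -
  have "density \<nu> (indicator A) = density \<nu> (\<lambda>x. ennreal (indicator A x))"
    by (simp add: ennreal_indicator)
  then show ?thesis by (simp add: integral_density)
qed

text \<open>Rounding up to the grid of mesh \<open>K / Suc m\<close> turns the integral into a right endpoint
  Riemann-Stieltjes sum, for any measure that is finite on \<open>{0<..K}\<close>.\<close>

lemma integral_right_endpoint_sum:
  fixes g :: "real \<Rightarrow> real"
  assumes \<nu>[measurable_cong]: "sets \<nu> = sets borel" and fin: "emeasure \<nu> {0<..K} < \<infinity>"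
    and K: "0 < K" and g[measurable]: "g \<in> borel_measurable borel"
  shows "(\<integral>x. g (K * of_int \<lceil>real (Suc m) * x / K\<rceil> / real (Suc m)) \<partial>density \<nu> (indicator {0<..K})) =
    (\<Sum>i<Suc m. g (K * real (Suc i) / real (Suc m)) * measure \<nu> {K * real i / real (Suc m) <.. K * real (Suc i) / real (Suc m)})"
proof -
  define t where "t i = K * real i / real (Suc m)" for i
  have tS: "t (Suc m) = K" "t 0 = 0" by (simp_all add: t_def)
  have tmono: "t i \<le> t j" if "i \<le> j" for i j
    unfolding t_def using that K by (intro divide_right_mono mult_left_mono) auto
  have pt: "indicator {0<..K} x * g (K * of_int \<lceil>real (Suc m) * x / K\<rceil> / real (Suc m)) =
      (\<Sum>i<Suc m. g (t (Suc i)) * indicator {t i <.. t (Suc i)} x)" for x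
  proof (cases "0 < x \<and> x \<le> K")
    case False
    have "indicator {t i <.. t (Suc i)} x = (0::real)" if "i < Suc m" for i
      using False tmono[of 0 i] tmono[of "Suc i" "Suc m"] that tS by (auto simp: indicator_def)
    then show ?thesis using False by (simp del: sum.lessThan_Suc)
  next
    case True
    define j where "j = nat \<lceil>real (Suc m) * x / K\<rceil> - 1"
    have pos: "0 < real (Suc m) * x / K" using True K by simp
    have le: "real (Suc m) * x / K \<le> real (Suc m)" using True K by (simp add: divide_le_eq mult_left_mono)
    have cl: "0 < \<lceil>real (Suc m) * x / K\<rceil>" "\<lceil>real (Suc m) * x / K\<rceil> \<le> int (Suc m)"
      using pos le by (simp, simp only: ceiling_le_iff of_int_of_nat_eq)
    have j: "j < Suc m" "of_int \<lceil>real (Suc m) * x / K\<rceil> = real (Suc j)"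
      using cl unfolding j_def by linarith+
    have xi: "x \<in> {t i <.. t (Suc i)} \<longleftrightarrow> i = j" for i
    proof -
      have "x \<in> {t i <.. t (Suc i)} \<longleftrightarrow> real i < real (Suc m) * x / K \<and> real (Suc m) * x / K \<le> real (Suc i)"
        using K by (simp add: t_def divide_less_eq le_divide_eq less_divide_eq divide_le_eq mult.commute del: of_nat_Suc)
      also have "\<dots> \<longleftrightarrow> \<lceil>real (Suc m) * x / K\<rceil> = int (Suc i)"
        by (simp add: ceiling_eq_iff)
      also have "\<dots> \<longleftrightarrow> i = j" using j(2) by linarith
      finally show ?thesis .
    qed
    have "(\<Sum>i<Suc m. g (t (Suc i)) * indicator {t i <.. t (Suc i)} x) = (\<Sum>i<Suc m. if i = j then g (t (Suc i)) else 0)"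
      by (intro sum.cong refl) (auto simp: indicator_def xi simp del: greaterThanAtMost_iff)
    also have "\<dots> = g (t (Suc j))" using j(1) by (simp add: sum.delta del: sum.lessThan_Suc)
    finally show ?thesis using True j(2) by (simp add: t_def indicator_def del: sum.lessThan_Suc)
  qed
  have finI: "emeasure \<nu> {t i <.. t (Suc i)} < \<infinity>" if "i < Suc m" for i
  proof -
    have "{t i <.. t (Suc i)} \<subseteq> {0<..K}" using tmono[of 0 i] tmono[of "Suc i" "Suc m"] that tS by auto
    then have "emeasure \<nu> {t i <.. t (Suc i)} \<le> emeasure \<nu> {0<..K}" by (intro emeasure_mono) auto
    then show ?thesis using fin by (rule le_less_trans)
  qed
  have "(\<integral>x. g (K * of_int \<lceil>real (Suc m) * x / K\<rceil> / real (Suc m)) \<partial>density \<nu> (indicator {0<..K})) =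
     (\<integral>x. indicator {0<..K} x * g (K * of_int \<lceil>real (Suc m) * x / K\<rceil> / real (Suc m)) \<partial>\<nu>)"
    by (rule integral_density_indicator) (use \<nu> in measurable)
  also have "\<dots> = (\<integral>x. (\<Sum>i<Suc m. g (t (Suc i)) * indicator {t i <.. t (Suc i)} x) \<partial>\<nu>)"
    by (simp only: pt)
  also have "\<dots> = (\<Sum>i<Suc m. g (t (Suc i)) * measure \<nu> {t i <.. t (Suc i)})"
    using finI sets_eq_imp_space_eq[OF \<nu>]
    by (subst Bochner_Integration.integral_sum)
       (auto intro!: integrable_mult_right integrable_real_indicator simp: less_top simp del: sum.lessThan_Suc)
  finally show ?thesis by (simp only: t_def)
qed

text \<open>A Gamma process all of whose paths are nondecreasing and right-continuous, so that every path
  has a Stieltjes measure. The index ranges over the whole line since \<open>interval_measure\<close> takes functions on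
  the reals; the assumptions on the law concern times from \<open>0\<close> on.\<close>

locale gamma_paths = prob_space M for M :: "'a measure" +
  fixes \<theta> :: real and F :: "'a \<Rightarrow> real \<Rightarrow> real"
  assumes theta: "0 < \<theta>"
    and mono: "\<And>w s t. s \<le> t \<Longrightarrow> F w s \<le> F w t"
    and right_cont: "\<And>w t. continuous (at_right t) (F w)"
    and meas[measurable]: "\<And>t. (\<lambda>w. F w t) \<in> borel_measurable M"
    and indep_incr: "\<And>(k::nat) t. 0 \<le> t 0 \<Longrightarrow> (\<And>i. i < k \<Longrightarrow> t i \<le> t (Suc i)) \<Longrightarrow>
        indep_vars (\<lambda>_. borel) (\<lambda>i w. F w (t (Suc i)) - F w (t i)) {..<k}"
    and laplace_incr: "\<And>s t u. 0 \<le> s \<Longrightarrow> s \<le> t \<Longrightarrow> 0 \<le> u \<Longrightarrow>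
        (\<integral>w. exp (- u * (F w t - F w s)) \<partial>M) = (1 + u) powr (- (\<theta> * (t - s)))"
begin

abbreviation path_measure :: "'a \<Rightarrow> real measure" where
  "path_measure w \<equiv> interval_measure (F w)"

lemma emeasure_path: "a \<le> b \<Longrightarrow> emeasure (path_measure w) {a<..b} = ennreal (F w b - F w a)"
  using mono right_cont by (intro emeasure_interval_measure_Ioc) auto

lemma measure_path: "a \<le> b \<Longrightarrow> measure (path_measure w) {a<..b} = F w b - F w a"
  by (simp add: measure_def emeasure_path mono)

lemma emeasure_path_finite: "emeasure (path_measure w) {a<..b} < \<infinity>"
  by (cases "a \<le> b") (auto simp: emeasure_path)

text \<open>Restricting to \<open>{0<..K}\<close> gives finite measures, for which bounded functions are integrable.\<close>

definition jumps :: "real \<Rightarrow> 'a \<Rightarrow> real measure" where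
  "jumps K w = density (path_measure w) (indicator {0<..K})"

definition intensity :: "real \<Rightarrow> real measure" where
  "intensity K = density (density lborel (\<lambda>_. ennreal \<theta>)) (indicator {0<..K})"

lemma sets_jumps[simp, measurable_cong]: "sets (jumps K w) = sets borel"
  and space_jumps[simp]: "space (jumps K w) = UNIV"
  and sets_intensity[simp, measurable_cong]: "sets (intensity K) = sets borel"
  and space_intensity[simp]: "space (intensity K) = UNIV"
  by (simp_all add: jumps_def intensity_def)

lemma finite_jumps: "finite_measure (jumps K w)"
  using emeasure_path_finite[of w 0 K]
  by (intro finite_measureI) (auto simp: jumps_def emeasure_density)

lemma emeasure_theta_lborel: "A \<in> sets borel \<Longrightarrow> emeasure (density lborel (\<lambda>_. ennreal \<theta>)) A = ennreal \<theta> * emeasure lborel A"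
  by (simp add: emeasure_density nn_integral_cmult)

lemma finite_intensity: "finite_measure (intensity K)"
  by (intro finite_measureI)
     (cases "0 \<le> K"; auto simp: intensity_def emeasure_density nn_integral_cmult ennreal_mult_eq_top_iff
       emeasure_theta_lborel emeasure_lborel_Ioc)

lemma integral_jumps:
  fixes f :: "real \<Rightarrow> real"
  shows "f \<in> borel_measurable borel \<Longrightarrow> (\<integral>x. f x \<partial>jumps K w) = (\<integral>x. indicator {0<..K} x * f x \<partial>path_measure w)"
  unfolding jumps_def by (subst integral_density_indicator) auto

lemma integral_intensity:
  fixes f :: "real \<Rightarrow> real"
  shows "f \<in> borel_measurable borel \<Longrightarrow> (\<integral>x. f x \<partial>intensity K) = \<theta> * (\<integral>x. indicator {0<..K} x * f x \<partial>lborel)"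
  unfolding intensity_def using theta
  by (subst integral_density_indicator) (auto simp: integral_density)

text \<open>The Riemann sums of \<open>f\<close> are linear combinations of independent increments, so the formula
  holds for them by the Laplace transform of the increments; let the mesh tend to zero.\<close>

lemma laplace_continuous:
  assumes K: "0 < K" and f: "continuous_on UNIV f" and bnd: "\<And>x. 0 \<le> f x \<and> f x \<le> B"
  shows "gamma_laplace_at M (jumps K) (intensity K) f"
proof (rule gamma_laplace_at_limit[OF prob_space_axioms finite_intensity, where B=B and
      F="\<lambda>m x. f (K * of_int \<lceil>real (Suc m) * x / K\<rceil> / real (Suc m))"])
  have fm[measurable]: "f \<in> borel_measurable borel"
    using f by (rule borel_measurable_continuous_onI)
  show "sets (jumps K w) = sets (intensity K) \<and> finite_measure (jumps K w)" for w
    by (simp add: finite_jumps)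
  show "(\<lambda>x. f (K * of_int \<lceil>real (Suc m) * x / K\<rceil> / real (Suc m))) \<in> borel_measurable (intensity K)" for m
    by measurable
  show "0 \<le> f (K * of_int \<lceil>real (Suc m) * x / K\<rceil> / real (Suc m)) \<and> f (K * of_int \<lceil>real (Suc m) * x / K\<rceil> / real (Suc m)) \<le> B" for m x
    by (rule bnd)
next
  fix x
  have "(\<lambda>m. K * of_int \<lceil>real (Suc m) * x / K\<rceil> / real (Suc m)) \<longlonglongrightarrow> x"
  proof (rule tendsto_sandwich)
    show "\<forall>\<^sub>F m in sequentially. x \<le> K * of_int \<lceil>real (Suc m) * x / K\<rceil> / real (Suc m)"
    proof (intro always_eventually allI)
      fix m
      have "real (Suc m) * x / K \<le> of_int \<lceil>real (Suc m) * x / K\<rceil>" by simp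
      then show "x \<le> K * of_int \<lceil>real (Suc m) * x / K\<rceil> / real (Suc m)"
        using K by (simp add: field_simps del: of_nat_Suc le_of_int_ceiling)
    qed
    show "\<forall>\<^sub>F m in sequentially. K * of_int \<lceil>real (Suc m) * x / K\<rceil> / real (Suc m) \<le> x + K * (1 / real (Suc m))"
    proof (intro always_eventually allI)
      fix m
      have "of_int \<lceil>real (Suc m) * x / K\<rceil> \<le> real (Suc m) * x / K + 1" by (rule of_int_ceiling_le_add_one)
      then have "K * of_int \<lceil>real (Suc m) * x / K\<rceil> \<le> K * (real (Suc m) * x / K + 1)" 
        using K by (intro mult_left_mono) auto
      also have "\<dots> = real (Suc m) * (x + K * (1 / real (Suc m)))"
        using K by (simp add: field_simps del: of_nat_Suc)
      finally show "K * of_int \<lceil>real (Suc m) * x / K\<rceil> / real (Suc m) \<le> x + K * (1 / real (Suc m))"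
        by (simp add: divide_le_eq mult.commute del: of_nat_Suc)
    qed
    have "(\<lambda>m. x + K * (1 / real (Suc m))) \<longlonglongrightarrow> x + K * 0"
      using LIMSEQ_inverse_real_of_nat by (intro tendsto_intros) (simp add: inverse_eq_divide)
    then show "(\<lambda>m. x + K * (1 / real (Suc m))) \<longlonglongrightarrow> x" by simp
  qed simp
  then show "(\<lambda>m. f (K * of_int \<lceil>real (Suc m) * x / K\<rceil> / real (Suc m))) \<longlonglongrightarrow> f x"
    using f by (intro isCont_tendsto_compose[of x f]) (auto simp: continuous_on_eq_continuous_at)
next
  fix m
  have fm[measurable]: "f \<in> borel_measurable borel"
    using f by (rule borel_measurable_continuous_onI)
  define t where "t i = K * real i / real (Suc m)" for i
  define c where "c i = f (t (Suc i))" for i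
  have t: "0 \<le> t 0" "t i \<le> t (Suc i)" "0 \<le> t i" for i
    using K by (auto simp: t_def intro!: divide_right_mono mult_left_mono)
  have c: "0 \<le> c i" for i using bnd by (simp add: c_def)
  have int: "(\<integral>x. f (K * of_int \<lceil>real (Suc m) * x / K\<rceil> / real (Suc m)) \<partial>jumps K w) =
      (\<Sum>i<Suc m. c i * (F w (t (Suc i)) - F w (t i)))" for w
    unfolding jumps_def
    by (subst integral_right_endpoint_sum)
       (use K emeasure_path_finite[of w 0 K] t(2) in \<open>simp_all add: measure_path[symmetric] t_def c_def del: sum.lessThan_Suc of_nat_Suc\<close>)
  have int2: "(\<integral>x. ln (1 + f (K * of_int \<lceil>real (Suc m) * x / K\<rceil> / real (Suc m))) \<partial>intensity K) =
      (\<Sum>i<Suc m. ln (1 + c i) * (\<theta> * (t (Suc i) - t i)))"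
  proof -
    have "measure (density lborel (\<lambda>_. ennreal \<theta>)) {t i <.. t (Suc i)} = \<theta> * (t (Suc i) - t i)" for i
      using t(2)[of i] theta by (simp add: measure_def emeasure_theta_lborel flip: ennreal_mult)
    moreover have "emeasure (density lborel (\<lambda>_. ennreal \<theta>)) {0<..K} < \<infinity>"
      using K by (simp add: emeasure_theta_lborel ennreal_mult_less_top)
    ultimately show ?thesis
      unfolding intensity_def
      using integral_right_endpoint_sum[of "density lborel (\<lambda>_. ennreal \<theta>)" K "\<lambda>x. ln (1 + f x)" m] K
      by (simp add: t_def[symmetric] c_def del: sum.lessThan_Suc of_nat_Suc)
  qed
  have ind: "indep_vars (\<lambda>_. borel) (\<lambda>i w. F w (t (Suc i)) - F w (t i)) {..<Suc m}"
    by (rule indep_incr) (use t in auto)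
  have "(\<integral>w. exp (- (\<integral>x. f (K * of_int \<lceil>real (Suc m) * x / K\<rceil> / real (Suc m)) \<partial>jumps K w)) \<partial>M) =
     (\<integral>w. (\<Prod>i<Suc m. exp (- c i * (F w (t (Suc i)) - F w (t i)))) \<partial>M)"
    unfolding int by (simp add: sum_negf del: sum.lessThan_Suc prod.lessThan_Suc flip: exp_sum)
  also have "\<dots> = (\<Prod>i<Suc m. \<integral>w. exp (- c i * (F w (t (Suc i)) - F w (t i))) \<partial>M)"
  proof (rule indep_vars_lebesgue_integral)
    show "indep_vars (\<lambda>_. borel) (\<lambda>i w. exp (- c i * (F w (t (Suc i)) - F w (t i)))) {..<Suc m}"
      by (rule indep_vars_compose2[OF ind]) simp
    show "integrable M (\<lambda>w. exp (- c i * (F w (t (Suc i)) - F w (t i))))" for i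
      by (rule integrable_const_bound[where B=1]) (use c mono t in \<open>auto simp: mult_le_0_iff\<close>)
  qed simp
  also have "\<dots> = (\<Prod>i<Suc m. exp (- (ln (1 + c i) * (\<theta> * (t (Suc i) - t i)))))"
  proof (rule prod.cong[OF refl])
    fix i
    have "1 + c i \<noteq> 0" using c[of i] by linarith
    then show "(\<integral>w. exp (- c i * (F w (t (Suc i)) - F w (t i))) \<partial>M) = exp (- (ln (1 + c i) * (\<theta> * (t (Suc i) - t i))))"
      using c[of i] t by (subst laplace_incr) (auto simp: powr_def mult_ac)
  qed
  also have "\<dots> = exp (- (\<Sum>i<Suc m. ln (1 + c i) * (\<theta> * (t (Suc i) - t i))))"
    by (simp add: sum_negf del: sum.lessThan_Suc prod.lessThan_Suc flip: exp_sum)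
  finally show "gamma_laplace_at M (jumps K) (intensity K) (\<lambda>x. f (K * of_int \<lceil>real (Suc m) * x / K\<rceil> / real (Suc m)))"
    unfolding gamma_laplace_at_def int2[symmetric] unfolding int by simp
qed

text \<open>The induction runs through functions of either sign, hence the positive part.\<close>

lemma laplace_borel:
  assumes K: "0 < K" and f: "f \<in> borel_measurable borel" and bnd: "\<And>x. 0 \<le> f x \<and> f x \<le> B"
  shows "gamma_laplace_at M (jumps K) (intensity K) f"
proof -
  have "baire f" using f bnd by (intro borel_imp_baire[where B=B]) auto
  then have "gamma_laplace_at M (jumps K) (intensity K) (\<lambda>x. max 0 (f x))"
  proof (induction rule: baire.induct)
    case (cont f B)
    show ?case
    proof (rule laplace_continuous[OF K, where B="max 0 B"])
      show "continuous_on UNIV (\<lambda>x. max 0 (f x))" using cont by (intro continuous_intros)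
      show "0 \<le> max 0 (f x) \<and> max 0 (f x) \<le> max 0 B" for x
        using cont(2)[of x] by (auto simp: abs_le_iff max_def)
    qed
  next
    case (lim F' B f)
    show ?case
    proof (rule gamma_laplace_at_limit[OF prob_space_axioms finite_intensity, where B="max 0 B" and F="\<lambda>n x. max 0 (F' n x)"])
      show "gamma_laplace_at M (jumps K) (intensity K) (\<lambda>x. max 0 (F' n x))" for n by (rule lim(4))
      show "(\<lambda>x. max 0 (F' n x)) \<in> borel_measurable (intensity K)" for n
        using baire_measurable[OF lim(1)[of n]] by simp
      show "0 \<le> max 0 (F' n x) \<and> max 0 (F' n x) \<le> max 0 B" for n x
        using lim(2)[of n x] by (auto simp: abs_le_iff max_def)
      show "(\<lambda>n. max 0 (F' n x)) \<longlonglongrightarrow> max 0 (f x)" for x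
        by (intro tendsto_intros lim(3))
    qed (simp add: finite_jumps)
  qed
  then show ?thesis using bnd by (simp add: max_absorb2)
qed

end

section \<open>Independence of a Gamma total and a normalised mean\<close>

text \<open>The hypothesis says that under the law with density proportional to \<open>exp (- r * T)\<close> the pair
  \<open>(X, T)\<close> is distributed as \<open>(X, T) / (1 + r)\<close> was before. The ratio does not see this scaling, so
  its law is the same under all these tilted laws. Hence the Laplace transform of \<open>T\<close> on the event
  that the ratio lies in \<open>B\<close> is proportional to that of \<open>T\<close>, which is independence.\<close>

lemma (in prob_space) ratio_indep_total:
  fixes X T :: "'a \<Rightarrow> real"
  assumes X[measurable]: "X \<in> borel_measurable M" and T[measurable]: "T \<in> borel_measurable M"
    and pos: "\<And>w. 0 \<le> X w" "\<And>w. 0 \<le> T w" and c: "0 \<le> c"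
    and scale: "\<And>r s u. 0 \<le> r \<Longrightarrow> 0 \<le> s \<Longrightarrow> 0 \<le> u \<Longrightarrow>
      (\<integral>w. exp (- (s * X w + (u + r) * T w)) \<partial>M) =
      (1 + r) powr (- c) * (\<integral>w. exp (- (s * (X w / (1 + r)) + u * (T w / (1 + r)))) \<partial>M)"
    and A: "A \<in> sets borel" and B[measurable]: "B \<in> sets borel"
  shows "prob {w \<in> space M. T w \<in> A \<and> X w / T w \<in> B} =
    prob {w \<in> space M. T w \<in> A} * prob {w \<in> space M. X w / T w \<in> B}"
proof -
  define p where "p = prob {w \<in> space M. X w / T w \<in> B}"
  have p: "(\<integral>w. indicator B (X w / T w) \<partial>M) = p"
    unfolding p_def by (rule expectation_indicator_rv[where N=borel]) measurable
  have tilt: "(\<integral>w. indicator B (X w / T w) * exp (- r * T w) \<partial>M) = p * (1 + r) powr (- c)" if r: "0 \<le> r" for r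
  proof -
    define Y where "Y w = (X w / (1 + r), T w / (1 + r))" for w
    have Y[measurable]: "Y \<in> M \<rightarrow>\<^sub>M borel \<Otimes>\<^sub>M borel" unfolding Y_def by measurable
    have le1: "(1 + r) powr (- c) \<le> 1" using r c by (simp add: powr_minus ge_one_powr_ge_zero inverse_le_1_iff)
    have R[measurable]: "{p. fst p / snd p \<in> B} \<in> sets (borel \<Otimes>\<^sub>M (borel :: real measure))"
    proof -
      have "(\<lambda>p. fst p / snd p) \<in> (borel \<Otimes>\<^sub>M (borel :: real measure)) \<rightarrow>\<^sub>M borel" by measurable
      from measurable_sets[OF this B] show ?thesis by (simp add: vimage_def space_pair_measure)
    qed
    have D: "distr (density M (\<lambda>w. ennreal (exp (- r * T w)))) (borel \<Otimes>\<^sub>M borel) (\<lambda>w. (X w, T w)) =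
      distr (density M (\<lambda>w. ennreal ((1 + r) powr (- c)))) (borel \<Otimes>\<^sub>M borel) Y"
    proof (rule weighted_laplace_unique_pair)
      fix s u :: real assume su: "0 \<le> s" "0 \<le> u"
      have "(\<integral>w. exp (- r * T w) * exp (- (s * fst (X w, T w) + u * snd (X w, T w))) \<partial>M) =
        (\<integral>w. exp (- (s * X w + (u + r) * T w)) \<partial>M)"
        by (intro Bochner_Integration.integral_cong) (auto simp: algebra_simps simp flip: exp_add)
      also have "\<dots> = (\<integral>w. (1 + r) powr (- c) * exp (- (s * fst (Y w) + u * snd (Y w))) \<partial>M)"
        unfolding scale[OF r su] Y_def by simp
      finally show "(\<integral>w. exp (- r * T w) * exp (- (s * fst (X w, T w) + u * snd (X w, T w))) \<partial>M) =
        (\<integral>w. (1 + r) powr (- c) * exp (- (s * fst (Y w) + u * snd (Y w))) \<partial>M)" .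
    qed (use pos r le1 in \<open>auto simp: finite_measure_axioms Y_def\<close>)
    have "(\<integral>x. (indicator {p. fst p / snd p \<in> B} x :: real) \<partial>distr (density M (\<lambda>w. ennreal (exp (- r * T w)))) (borel \<Otimes>\<^sub>M borel) (\<lambda>w. (X w, T w))) =
      (\<integral>x. (indicator {p. fst p / snd p \<in> B} x :: real) \<partial>distr (density M (\<lambda>w. ennreal ((1 + r) powr (- c)))) (borel \<Otimes>\<^sub>M borel) Y)"
      by (simp only: D)
    then have "(\<integral>w. exp (- r * T w) * indicator {p. fst p / snd p \<in> B} (X w, T w) \<partial>M) =
       (\<integral>w. (1 + r) powr (- c) * indicator {p. fst p / snd p \<in> B} (Y w) \<partial>M)"
      by (subst (asm) (1 2) integral_indicator_distr_density) auto
    moreover have "indicator {p. fst p / snd p \<in> B} (Y w) = (indicator B (X w / T w) :: real)" for w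
      using r by (simp add: Y_def indicator_def)
    moreover have "indicator {p. fst p / snd p \<in> B} (X w, T w) = (indicator B (X w / T w) :: real)" for w
      by (simp add: indicator_def)
    ultimately show ?thesis by (simp add: p mult.commute)
  qed
  have p01: "0 \<le> p" "p \<le> 1" by (simp_all add: p_def)
  have "(\<integral>w. indicator B (X w / T w) * indicator A (T w) \<partial>M) = (\<integral>w. p * indicator A (T w) \<partial>M)"
  proof (rule weighted_laplace_unique)
    fix r :: real assume r: "0 \<le> r"
    have "(\<integral>w. exp (- r * T w) \<partial>M) = (1 + r) powr (- c)"
      using scale[OF r order.refl order.refl] by (simp add: prob_space)
    then show "(\<integral>w. indicator B (X w / T w) * exp (- r * T w) \<partial>M) = (\<integral>w. p * exp (- r * T w) \<partial>M)"
      using tilt[OF r] by simp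
  qed (use pos p01 A in \<open>auto simp: finite_measure_axioms indicator_def\<close>)
  moreover have "(\<integral>w. indicator B (X w / T w) * indicator A (T w) \<partial>M) = prob {w \<in> space M. T w \<in> A \<and> X w / T w \<in> B}"
  proof -
    have "(\<integral>w. indicator (A \<times> B) (T w, X w / T w) \<partial>M) = prob {w \<in> space M. (T w, X w / T w) \<in> A \<times> B}"
      using A by (intro expectation_indicator_rv[where N="borel \<Otimes>\<^sub>M borel"]) auto
    then show ?thesis by (simp add: indicator_times mult.commute)
  qed
  moreover have "(\<integral>w. indicator A (T w) \<partial>M) = prob {w \<in> space M. T w \<in> A}"
    by (rule expectation_indicator_rv[OF T A])
  ultimately show ?thesis by (simp add: p_def mult.commute)
qed

section \<open>Random measures from their Laplace functional\<close>

lemma nn_integral_kernel_measurable: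
  assumes \<kappa>: "\<And>w. w \<in> space N \<Longrightarrow> sets (\<kappa> w) = sets \<alpha>"
    and E: "\<And>A. A \<in> sets \<alpha> \<Longrightarrow> (\<lambda>w. emeasure (\<kappa> w) A) \<in> borel_measurable N"
    and f: "f \<in> borel_measurable \<alpha>"
  shows "(\<lambda>w. \<integral>\<^sup>+x. f x \<partial>\<kappa> w) \<in> borel_measurable N"
  using f
proof (induction rule: borel_measurable_induct)
  case (cong f g)
  have "(\<integral>\<^sup>+x. f x \<partial>\<kappa> w) = (\<integral>\<^sup>+x. g x \<partial>\<kappa> w)" if "w \<in> space N" for w
    using cong(3) sets_eq_imp_space_eq[OF \<kappa>[OF that]] by (intro nn_integral_cong) auto
  then show ?case by (rule measurable_cong[THEN iffD2]) (use cong(4) in simp_all)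
next
  case (set A)
  have "(\<integral>\<^sup>+x. indicator A x \<partial>\<kappa> w) = emeasure (\<kappa> w) A" if "w \<in> space N" for w
    using set \<kappa>[OF that] by simp
  then show ?case by (rule measurable_cong[THEN iffD2]) (use E[OF set] in simp_all)
next
  case (mult u c)
  have "(\<integral>\<^sup>+x. c * u x \<partial>\<kappa> w) = c * (\<integral>\<^sup>+x. u x \<partial>\<kappa> w)" if w: "w \<in> space N" for w
    using mult(2) unfolding measurable_cong_sets[OF \<kappa>[OF w, symmetric] refl] by (rule nn_integral_cmult)
  then show ?case by (rule measurable_cong[THEN iffD2]) (use mult(4) in simp_all)
next
  case (add u v)
  have "(\<integral>\<^sup>+x. v x + u x \<partial>\<kappa> w) = (\<integral>\<^sup>+x. v x \<partial>\<kappa> w) + (\<integral>\<^sup>+x. u x \<partial>\<kappa> w)" if w: "w \<in> space N" for w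
    using add(3,1) unfolding measurable_cong_sets[OF \<kappa>[OF w, symmetric] refl] by (rule nn_integral_add)
  then show ?case by (rule measurable_cong[THEN iffD2]) (use add(6,7) in simp_all)
next
  case (seq U)
  have "(\<integral>\<^sup>+x. (SUP i. U i) x \<partial>\<kappa> w) = (SUP i. \<integral>\<^sup>+x. U i x \<partial>\<kappa> w)" if w: "w \<in> space N" for w
    unfolding SUP_apply
    using seq(3,1) unfolding measurable_cong_sets[OF \<kappa>[OF w, symmetric] refl]
    by (rule nn_integral_monotone_convergence_SUP)
  then show ?case by (rule measurable_cong[THEN iffD2]) (use seq(5) in simp_all)
qed

lemma integral_kernel_measurable:
  fixes f :: "'x \<Rightarrow> real"
  assumes \<kappa>: "\<And>w. w \<in> space N \<Longrightarrow> sets (\<kappa> w) = sets \<alpha>"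
    and E: "\<And>A. A \<in> sets \<alpha> \<Longrightarrow> (\<lambda>w. emeasure (\<kappa> w) A) \<in> borel_measurable N"
    and f[measurable]: "f \<in> borel_measurable \<alpha>"
  shows "(\<lambda>w. \<integral>x. f x \<partial>\<kappa> w) \<in> borel_measurable N"
proof -
  have *: "(\<integral>x. f x \<partial>\<kappa> w) = (if (\<integral>\<^sup>+x. ennreal (norm (f x)) \<partial>\<kappa> w) < \<infinity>
      then enn2real (\<integral>\<^sup>+x. ennreal (f x) \<partial>\<kappa> w) - enn2real (\<integral>\<^sup>+x. ennreal (- f x) \<partial>\<kappa> w) else 0)" if "w \<in> space N" for w
  proof -
    have "f \<in> borel_measurable (\<kappa> w)" using f unfolding measurable_cong_sets[OF \<kappa>[OF that, symmetric] refl] .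
    then have "integrable (\<kappa> w) f \<longleftrightarrow> (\<integral>\<^sup>+x. ennreal (norm (f x)) \<partial>\<kappa> w) < \<infinity>"
      by (simp add: integrable_iff_bounded)
    then show ?thesis by (auto simp: real_lebesgue_integral_def not_integrable_integral_eq)
  qed
  have [measurable]: "(\<lambda>w. \<integral>\<^sup>+x. ennreal (norm (f x)) \<partial>\<kappa> w) \<in> borel_measurable N"
      "(\<lambda>w. \<integral>\<^sup>+x. ennreal (f x) \<partial>\<kappa> w) \<in> borel_measurable N"
      "(\<lambda>w. \<integral>\<^sup>+x. ennreal (- f x) \<partial>\<kappa> w) \<in> borel_measurable N"
    by (rule nn_integral_kernel_measurable[OF \<kappa> E]; (assumption | measurable))+
  show ?thesis by (subst measurable_cong[OF *]) measurable
qed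

text \<open>Converse of \<open>gamma_random_measure_laplace\<close>: on combinations of indicators of disjoint sets the
  functional factorises, which gives independence and the Gamma laws at once.\<close>

lemma gamma_random_measureI:
  assumes N: "prob_space N" and \<alpha>: "finite_measure \<alpha>"
    and \<mu>: "\<And>w. w \<in> space N \<Longrightarrow> sets (\<mu> w) = sets \<alpha> \<and> finite_measure (\<mu> w)"
    and L: "\<And>f B. f \<in> borel_measurable \<alpha> \<Longrightarrow> (\<And>x. 0 \<le> f x \<and> f x \<le> B) \<Longrightarrow> gamma_laplace_at N \<mu> \<alpha> f"
  shows "gamma_random_measure N \<alpha> \<mu>"
proof -
  interpret N: prob_space N by fact
  interpret \<alpha>: finite_measure \<alpha> by fact
  have int: "(\<integral>x. c * indicator A x \<partial>\<mu> w) = c * measure (\<mu> w) A" if "w \<in> space N" "A \<in> sets \<alpha>" for A w and c :: real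
  proof -
    have "A \<inter> space (\<mu> w) = A"
      using \<mu>[OF that(1)] that(2) sets.sets_into_space[of A "\<mu> w"] by auto
    then show ?thesis by simp
  qed
  have meas[measurable]: "(\<lambda>w. measure (\<mu> w) A) \<in> borel_measurable N" if "A \<in> sets \<alpha>" for A
  proof -
    have "gamma_laplace_at N \<mu> \<alpha> (\<lambda>x. 1 * indicator A x)"
      using that by (intro L[where B=1]) (auto simp: indicator_def)
    then have "(\<lambda>w. \<integral>x. 1 * (indicator A x :: real) \<partial>\<mu> w) \<in> borel_measurable N"
      unfolding gamma_laplace_at_def ..
    also have "?this \<longleftrightarrow> ?thesis" by (intro measurable_cong trans[OF int[OF _ that]] mult_1)
    finally show ?thesis .
  qed
  have multi: "(\<integral>w. exp (- (\<Sum>i<k. u i * measure (\<mu> w) (A i))) \<partial>N) = exp (- (\<Sum>i<k. ln (1 + u i) * measure \<alpha> (A i)))"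
    if A: "\<And>i. i < k \<Longrightarrow> A i \<in> sets \<alpha>" "disjoint_family_on A {..<k}" and u: "\<And>i. 0 \<le> u i" for k :: nat and A u
  proof -
    define f where "f x = (\<Sum>i<k. u i * indicator (A i) x)" for x
    have fm: "f \<in> borel_measurable \<alpha>" unfolding f_def using A by (intro borel_measurable_sum borel_measurable_times) auto
    have "0 \<le> f x \<and> f x \<le> (\<Sum>i<k. u i)" for x
    proof -
      have "0 \<le> u i * indicator (A i) x" "u i * indicator (A i) x \<le> u i" for i
        using u[of i] by (simp_all add: indicator_def)
      then show ?thesis unfolding f_def by (intro conjI sum_nonneg sum_mono)
    qed
    from L[OF fm this] have "(\<integral>w. exp (- (\<integral>x. f x \<partial>\<mu> w)) \<partial>N) = exp (- (\<integral>x. ln (1 + f x) \<partial>\<alpha>))"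
      by (simp add: gamma_laplace_at_def)
    moreover have "(\<integral>x. f x \<partial>\<mu> w) = (\<Sum>i<k. u i * measure (\<mu> w) (A i))" if w: "w \<in> space N" for w
    proof -
      interpret m: finite_measure "\<mu> w" using \<mu>[OF w] by simp
      show ?thesis unfolding f_def using \<mu>[OF w] A
        by (subst Bochner_Integration.integral_sum)
           (auto simp: int[OF w] intro!: integrable_mult_right integrable_real_indicator simp: less_top[symmetric])
    qed
    moreover have "(\<integral>x. ln (1 + f x) \<partial>\<alpha>) = (\<Sum>i<k. ln (1 + u i) * measure \<alpha> (A i))"
    proof -
      have "ln (1 + f x) = (\<Sum>i<k. ln (1 + u i) * indicator (A i) x)" for x
      proof (cases "\<exists>j<k. x \<in> A j")
        case True
        then obtain j where j: "j < k" "x \<in> A j" by auto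
        then have ind: "indicator (A i) x = (if i = j then 1 else 0 :: real)" if "i < k" for i
          using A(2) that by (auto simp: disjoint_family_on_def indicator_def)
        have "f x = (\<Sum>i<k. if i = j then u i else 0)" "(\<Sum>i<k. ln (1 + u i) * indicator (A i) x) = (\<Sum>i<k. if i = j then ln (1 + u i) else 0)"
          unfolding f_def by (intro sum.cong; simp add: ind)+
        then show ?thesis using j by (simp add: sum.delta)
      next
        case False
        then show ?thesis by (simp add: f_def)
      qed
      then show ?thesis using A
        by (simp only:) (subst Bochner_Integration.integral_sum,
           auto intro!: integrable_mult_right integrable_real_indicator sum.cong
             simp: less_top[symmetric] Int_absorb2 sets.sets_into_space)
    qed
    moreover have "(\<integral>w. exp (- (\<integral>x. f x \<partial>\<mu> w)) \<partial>N) = (\<integral>w. exp (- (\<Sum>i<k. u i * measure (\<mu> w) (A i))) \<partial>N)"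
      by (intro Bochner_Integration.integral_cong refl) (simp only: calculation(2))
    ultimately show ?thesis by simp
  qed
  have single: "(\<integral>w. exp (- (u * measure (\<mu> w) A)) \<partial>N) = exp (- (ln (1 + u) * measure \<alpha> A))"
    if "A \<in> sets \<alpha>" "0 \<le> u" for A u
    using multi[of 1 "\<lambda>_. A" "\<lambda>_. u"] that by (simp add: disjoint_family_on_def)
  show ?thesis
    unfolding gamma_random_measure_def
  proof (intro conjI ballI allI impI)
    fix A assume A: "A \<in> sets \<alpha>"
    show "distr N borel (\<lambda>w. measure (\<mu> w) A) = gamma_law (measure \<alpha> A)"
    proof (rule N.distr_eq_gamma_law)
      fix u :: real assume u: "0 \<le> u"
      then have "1 + u \<noteq> 0" by linarith
      then show "(\<integral>w. exp (- u * measure (\<mu> w) A) \<partial>N) = (1 + u) powr (- measure \<alpha> A)"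
        using single[OF A u] by (simp add: powr_def mult.commute)
    qed (use A in auto)
  next
    fix k :: nat and A
    assume A: "\<forall>i<k. A i \<in> sets \<alpha>" and dis: "disjoint_family_on A {..<k}"
    \<comment> \<open>A single variable is treated as a pair with second component \<open>0\<close>.\<close>
    have "N.indep_vars (\<lambda>_. borel \<Otimes>\<^sub>M borel) (\<lambda>i w. (measure (\<mu> w) (A i), 0 :: real)) {..<k}"
    proof (rule N.indep_vars_laplace_pair)
      fix s t :: "nat \<Rightarrow> real" assume st: "\<And>i. 0 \<le> s i" "\<And>i. 0 \<le> t i"
      have "(\<integral>w. (\<Prod>i<k. exp (- (s i * fst (measure (\<mu> w) (A i), 0 :: real) + t i * snd (measure (\<mu> w) (A i), 0 :: real)))) \<partial>N)
         = (\<integral>w. exp (- (\<Sum>i<k. s i * measure (\<mu> w) (A i))) \<partial>N)"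
        by (simp add: sum_negf flip: exp_sum)
      also have "\<dots> = exp (- (\<Sum>i<k. ln (1 + s i) * measure \<alpha> (A i)))"
        by (rule multi) (use A dis st in auto)
      also have "\<dots> = (\<Prod>i<k. \<integral>w. exp (- (s i * measure (\<mu> w) (A i))) \<partial>N)"
        using A st by (simp add: single sum_negf exp_sum[symmetric])
      finally show "(\<integral>w. (\<Prod>i<k. exp (- (s i * fst (measure (\<mu> w) (A i), 0 :: real) + t i * snd (measure (\<mu> w) (A i), 0 :: real)))) \<partial>N) =
        (\<Prod>i<k. \<integral>w. exp (- (s i * fst (measure (\<mu> w) (A i), 0 :: real) + t i * snd (measure (\<mu> w) (A i), 0 :: real))) \<partial>N)"
        by simp
    qed (use A in \<open>auto intro!: measurable_Pair\<close>)
    then have "N.indep_vars (\<lambda>_. borel) (\<lambda>i w. fst (measure (\<mu> w) (A i), 0 :: real)) {..<k}"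
      by (rule N.indep_vars_compose2) simp
    then show "N.indep_vars (\<lambda>_. borel) (\<lambda>i w. measure (\<mu> w) (A i)) {..<k}" by simp
  qed (use N \<mu> meas in auto)
qed

text \<open>Transport to the space of measures with the \<open>\<sigma>\<close>-algebra generated by the evaluations. The Dirichlet mean
  law is specified through Dirichlet processes on a sample space whose points are measures.\<close>

lemma gamma_random_measure_on_measures:
  assumes G: "gamma_random_measure M \<alpha> \<mu>" and \<alpha>: "finite_measure \<alpha>"
  shows "\<exists>N. gamma_random_measure N \<alpha> (\<lambda>m. m)"
proof -
  interpret M: prob_space M using G by (simp add: gamma_random_measure_def)
  have \<mu>: "sets (\<mu> w) = sets \<alpha> \<and> finite_measure (\<mu> w)" if "w \<in> space M" for w
    using G that by (simp add: gamma_random_measure_def)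
  define \<Omega> where "\<Omega> = {m. sets m = sets \<alpha> \<and> finite_measure m}"
  define \<S> where "\<S> = sigma \<Omega> {(\<lambda>m. measure m A) -` B \<inter> \<Omega> | A B. A \<in> sets \<alpha> \<and> B \<in> sets (borel :: real measure)}"
  have sp: "space \<S> = \<Omega>" unfolding \<S>_def by (rule space_measure_of) auto
  have ev[measurable]: "(\<lambda>m. measure m A) \<in> borel_measurable \<S>" if "A \<in> sets \<alpha>" for A
  proof (rule measurableI)
    fix B :: "real set" assume "B \<in> sets borel"
    then have "(\<lambda>m. measure m A) -` B \<inter> \<Omega> \<in> sigma_sets \<Omega> {(\<lambda>m. measure m A) -` B \<inter> \<Omega> | A B. A \<in> sets \<alpha> \<and> B \<in> sets (borel :: real measure)}"
      using that by (intro sigma_sets.Basic) auto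
    then show "(\<lambda>m. measure m A) -` B \<inter> space \<S> \<in> sets \<S>"
      unfolding sp by (simp add: \<S>_def sets_measure_of_conv) (auto split: if_splits)
  qed simp
  have \<mu>m[measurable]: "\<mu> \<in> M \<rightarrow>\<^sub>M \<S>"
    unfolding \<S>_def
  proof (rule measurable_measure_of)
    show "\<mu> -` Z \<inter> space M \<in> sets M"
      if "Z \<in> {(\<lambda>m. measure m A) -` B \<inter> \<Omega> | A B. A \<in> sets \<alpha> \<and> B \<in> sets (borel :: real measure)}" for Z
    proof -
      from that obtain A B where Z: "Z = (\<lambda>m. measure m A) -` B \<inter> \<Omega>" "A \<in> sets \<alpha>" "B \<in> sets borel" by auto
      have "\<mu> -` Z \<inter> space M = (\<lambda>w. measure (\<mu> w) A) -` B \<inter> space M"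
        using \<mu> by (auto simp: Z \<Omega>_def)
      also have "\<dots> \<in> sets M"
        using G Z(2,3) by (intro measurable_sets) (auto simp: gamma_random_measure_def)
      finally show ?thesis .
    qed
  qed (use \<mu> in \<open>auto simp: \<Omega>_def\<close>)
  define N where "N = distr M \<S> \<mu>"
  have spN: "space N = \<Omega>" by (simp add: N_def sp)
  have "gamma_random_measure N \<alpha> (\<lambda>m. m)"
  proof (rule gamma_random_measureI)
    show "prob_space N" unfolding N_def by (rule M.prob_space_distr) simp
    show "finite_measure \<alpha>" by fact
    show "sets m = sets \<alpha> \<and> finite_measure m" if "m \<in> space N" for m using that by (simp add: spN \<Omega>_def)
    fix f :: "'b \<Rightarrow> real" and B assume f: "f \<in> borel_measurable \<alpha>" and bnd: "\<And>x. 0 \<le> f x \<and> f x \<le> B"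
    have fm[measurable]: "(\<lambda>m. \<integral>x. f x \<partial>m) \<in> borel_measurable \<S>"
    proof (rule integral_kernel_measurable[OF _ _ f])
      show "sets m = sets \<alpha>" if "m \<in> space \<S>" for m using that by (simp add: sp \<Omega>_def)
      fix A assume A: "A \<in> sets \<alpha>"
      have "emeasure m A = ennreal (measure m A)" if "m \<in> space \<S>" for m
        using that by (simp add: sp \<Omega>_def finite_measure.emeasure_eq_measure)
      then show "(\<lambda>m. emeasure m A) \<in> borel_measurable \<S>" using A by (subst measurable_cong) auto
    qed
    have "(\<integral>m. exp (- (\<integral>x. f x \<partial>m)) \<partial>N) = (\<integral>w. exp (- (\<integral>x. f x \<partial>\<mu> w)) \<partial>M)"
      unfolding N_def by (rule integral_distr) measurable
    then show "gamma_laplace_at N (\<lambda>m. m) \<alpha> f"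
      using gamma_random_measure_laplace[OF G \<alpha> f bnd] fm
      by (simp add: gamma_laplace_at_def N_def)
  qed
  then show ?thesis by blast
qed

section \<open>Mass and discounted integral over an interval\<close>

text \<open>Substituting \<open>u = exp (x - d)\<close> turns the density \<open>1 / u\<close> on \<open>{exp (- d)..1}\<close> into Lebesgue measure
  on \<open>{0<..d}\<close>.\<close>

lemma scale_measure_F_law:
  assumes "0 < d" "0 < \<theta>"
  shows "scale_measure (ennreal (\<theta> * d)) (F_law d) =
    distr (density (density lborel (\<lambda>_. ennreal \<theta>)) (indicator {0<..d})) borel (\<lambda>x. exp (x - d))"
proof (rule measure_eqI)
  show "sets (scale_measure (ennreal (\<theta> * d)) (F_law d)) =
    sets (distr (density (density lborel (\<lambda>_. ennreal \<theta>)) (indicator {0<..d})) borel (\<lambda>x. exp (x - d)))"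
    by (simp add: F_law_def)
  fix A assume "A \<in> sets (scale_measure (ennreal (\<theta> * d)) (F_law d))"
  then have A[measurable]: "A \<in> sets borel" by (simp add: F_law_def)
  define f where "f u = indicator A u * (\<theta> / u)" for u :: real
  have f[measurable]: "f \<in> borel_measurable borel" unfolding f_def by measurable
  have "emeasure (scale_measure (ennreal (\<theta> * d)) (F_law d)) A =
     (\<integral>\<^sup>+u. ennreal (\<theta> * d) * (ennreal (if exp (- d) \<le> u \<and> u \<le> 1 then 1 / (d * u) else 0) * indicator A u) \<partial>lborel)"
    by (simp add: F_law_def emeasure_density nn_integral_cmult)
  also have "\<dots> = (\<integral>\<^sup>+u. ennreal (f u * indicator {exp (0 - d)..exp (d - d)} u) \<partial>lborel)"
  proof (rule nn_integral_cong)
    fix u :: real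
    show "ennreal (\<theta> * d) * (ennreal (if exp (- d) \<le> u \<and> u \<le> 1 then 1 / (d * u) else 0) * indicator A u) =
       ennreal (f u * indicator {exp (0 - d)..exp (d - d)} u)"
    proof (cases "exp (- d) \<le> u \<and> u \<le> 1")
      case True
      then have "0 < u" using exp_gt_zero[of "- d"] by linarith
      then show ?thesis using assms True
        by (auto simp: f_def indicator_def simp flip: ennreal_mult)
    qed (auto simp: indicator_def)
  qed
  also have "\<dots> = (\<integral>\<^sup>+x. ennreal (f (exp (x - d)) * exp (x - d) * indicator {0..d} x) \<partial>lborel)"
    by (rule nn_integral_substitution)
       (use assms in \<open>auto intro!: derivative_eq_intros continuous_intros simp: set_borel_measurable_def\<close>)
  also have "\<dots> = (\<integral>\<^sup>+x. ennreal \<theta> * (indicator {0<..d} x * indicator A (exp (x - d))) \<partial>lborel)"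
  proof (rule nn_integral_cong_AE)
    show "AE x in lborel. ennreal (f (exp (x - d)) * exp (x - d) * indicator {0..d} x) =
        ennreal \<theta> * (indicator {0<..d} x * indicator A (exp (x - d)))"
      using AE_lborel_singleton[of 0]
      by eventually_elim (auto simp: f_def indicator_def)
  qed
  also have "\<dots> = emeasure (distr (density (density lborel (\<lambda>_. ennreal \<theta>)) (indicator {0<..d})) borel (\<lambda>x. exp (x - d))) A"
  proof -
    have "indicator {0<..d} x * indicator A (exp (x - d)) = (indicator {0<..d} x * indicator ((\<lambda>x. exp (x - d)) -` A) x :: ennreal)" for x
      by (simp add: indicator_def)
    moreover have "(\<lambda>x. exp (x - d)) -` A \<in> sets borel"
      using measurable_sets[of "\<lambda>x. exp (x - d)" borel borel A] by simp
    ultimately show ?thesis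
      by (simp add: emeasure_distr emeasure_density nn_integral_density)
  qed
  finally show "emeasure (scale_measure (ennreal (\<theta> * d)) (F_law d)) A =
    emeasure (distr (density (density lborel (\<lambda>_. ennreal \<theta>)) (indicator {0<..d})) borel (\<lambda>x. exp (x - d))) A" .
qed

text \<open>The Laplace exponent, up to the factor \<open>\<theta>\<close>, of the pair formed by the discounted integral and the
  mass over an interval of length \<open>d\<close>.\<close>

definition log_integral :: "real \<Rightarrow> real \<Rightarrow> real \<Rightarrow> real" where
  "log_integral d s t = (\<integral>x. indicator {0<..d} x * ln (1 + (s * exp (x - d) + t)) \<partial>lborel)"

lemma log_integral_shift:
  "(\<integral>x. indicator {a<..b} x * ln (1 + (s * exp (x - b) + t)) \<partial>lborel) = log_integral (b - a) s t"
proof -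
  have "(\<integral>x. indicator {a<..b} x * ln (1 + (s * exp (x - b) + t)) \<partial>lborel) =
    \<bar>1\<bar> *\<^sub>R (\<integral>x. indicator {a<..b} (a + 1 * x) * ln (1 + (s * exp (a + 1 * x - b) + t)) \<partial>lborel)"
    by (rule lborel_integral_real_affine) simp
  also have "\<dots> = log_integral (b - a) s t"
    unfolding log_integral_def
    by (simp, intro Bochner_Integration.integral_cong refl) (auto simp: indicator_def algebra_simps)
  finally show ?thesis .
qed

lemma integrable_indicator_lborel_bounded:
  fixes g :: "real \<Rightarrow> real"
  assumes "g \<in> borel_measurable borel" "\<And>x. x \<in> {a<..b} \<Longrightarrow> \<bar>g x\<bar> \<le> B"
  shows "integrable lborel (\<lambda>x. indicator {a<..b} x * g x)"
proof (rule Bochner_Integration.integrable_bound[where f="\<lambda>x. B * indicator {a<..b} x"])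
  show "integrable lborel (\<lambda>x. B * indicator {a<..b} x)"
    by (cases "a \<le> b") (auto intro!: integrable_mult_right integrable_real_indicator)
  show "AE x in lborel. norm (indicator {a<..b} x * g x) \<le> norm (B * indicator {a<..b} x)"
    using assms(2) by (intro AE_I2) (force simp: indicator_def)
qed (use assms(1) in measurable)

lemma log_integral_0: "0 \<le> d \<Longrightarrow> log_integral d 0 t = d * ln (1 + t)"
  by (simp add: log_integral_def)

text \<open>This scaling of the exponent is what makes \<open>ratio_indep_total\<close> applicable.\<close>

lemma log_integral_scale:
  assumes "0 \<le> d" "0 \<le> r" "0 \<le> s" "0 \<le> u"
  shows "log_integral d s (u + r) = d * ln (1 + r) + log_integral d (s / (1 + r)) (u / (1 + r))"
proof -
  have p: "0 \<le> s / (1 + r)" "0 \<le> u / (1 + r)" using assms by auto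
  have "ln (1 + (s * exp (x - d) + (u + r))) = ln (1 + r) + ln (1 + (s / (1 + r) * exp (x - d) + u / (1 + r)))" for x
  proof -
    have nn: "0 \<le> s / (1 + r) * exp (x - d) + u / (1 + r)"
      by (intro add_nonneg_nonneg mult_nonneg_nonneg p) simp
    have "ln (1 + r) + ln (1 + (s / (1 + r) * exp (x - d) + u / (1 + r))) =
        ln ((1 + r) * (1 + (s / (1 + r) * exp (x - d) + u / (1 + r))))"
      using assms(2) nn by (subst ln_mult_pos) auto
    also have "(1 + r) * (1 + (s / (1 + r) * exp (x - d) + u / (1 + r))) = 1 + (s * exp (x - d) + (u + r))"
      using assms by (simp add: distrib_left)
    finally show ?thesis by simp
  qed
  then have "log_integral d s (u + r) = (\<integral>x. (indicator {0<..d} x * ln (1 + r)) +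
      indicator {0<..d} x * ln (1 + (s / (1 + r) * exp (x - d) + u / (1 + r))) \<partial>lborel)"
    by (simp add: log_integral_def distrib_left)
  also have "\<dots> = (\<integral>x. indicator {0<..d} x * ln (1 + r) \<partial>lborel) + log_integral d (s / (1 + r)) (u / (1 + r))"
    unfolding log_integral_def
  proof (rule Bochner_Integration.integral_add)
    show "integrable lborel (\<lambda>x. indicator {0<..d} x * ln (1 + r))"
      by (rule integrable_indicator_lborel_bounded[where B="\<bar>ln (1 + r)\<bar>"]) auto
    show "integrable lborel (\<lambda>x. indicator {0<..d} x * ln (1 + (s / (1 + r) * exp (x - d) + u / (1 + r))))"
    proof (rule integrable_indicator_lborel_bounded[where B="s / (1 + r) + u / (1 + r)"])
    fix x assume x: "x \<in> {0<..d}"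
    have e: "s / (1 + r) * exp (x - d) \<le> s / (1 + r)" using x p by (intro mult_left_le) auto
    have e0: "0 \<le> s / (1 + r) * exp (x - d)" by (intro mult_nonneg_nonneg p) simp
    have "ln (1 + (s / (1 + r) * exp (x - d) + u / (1 + r))) \<le> s / (1 + r) * exp (x - d) + u / (1 + r)"
      by (rule ln_add_one_self_le_self) (use e0 p in linarith)
    moreover have "0 \<le> ln (1 + (s / (1 + r) * exp (x - d) + u / (1 + r)))"
      using e0 p by (intro ln_ge_zero) linarith
    ultimately show "\<bar>ln (1 + (s / (1 + r) * exp (x - d) + u / (1 + r)))\<bar> \<le> s / (1 + r) + u / (1 + r)"
      using e by linarith
    qed measurable
  qed
  finally show ?thesis using assms(1) by simp
qed

context gamma_paths
begin

definition mass :: "real \<Rightarrow> real \<Rightarrow> 'a \<Rightarrow> real" where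
  "mass a b w = F w b - F w a"

definition discounted :: "real \<Rightarrow> real \<Rightarrow> 'a \<Rightarrow> real" where
  "discounted a b w = (\<integral>x. indicator {a<..b} x * exp (x - b) \<partial>path_measure w)"

lemma mass_nonneg: "a \<le> b \<Longrightarrow> 0 \<le> mass a b w" by (simp add: mass_def mono)
lemma mass_measurable[measurable]: "mass a b \<in> borel_measurable M" unfolding mass_def by measurable
lemma discounted_nonneg: "0 \<le> discounted a b w"
  unfolding discounted_def by (intro integral_nonneg_AE AE_I2) (simp add: indicator_def)

lemma bounded_on_interval:
  fixes s t x :: real
  assumes "0 \<le> s" "0 \<le> t"
  shows "0 \<le> indicator {a<..b} x * (s * exp (x - b) + t)" "indicator {a<..b} x * (s * exp (x - b) + t) \<le> s + t"
proof -
  have "s * exp (x - b) \<le> s" if "x \<le> b" using that assms by (intro mult_left_le) auto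
  moreover have "0 \<le> s * exp (x - b)" using assms by simp
  ultimately show "0 \<le> indicator {a<..b} x * (s * exp (x - b) + t)" "indicator {a<..b} x * (s * exp (x - b) + t) \<le> s + t"
    using assms by (auto simp: indicator_def)
qed

lemma integral_jumps_interval:
  assumes ab: "0 \<le> a" "a \<le> b" "b \<le> K" and st: "0 \<le> s" "0 \<le> t"
  shows "(\<integral>x. indicator {a<..b} x * (s * exp (x - b) + t) \<partial>jumps K w) = s * discounted a b w + t * mass a b w"
    and "integrable (jumps K w) (\<lambda>x. indicator {a<..b} x * (s * exp (x - b) + t))"
proof -
  interpret finite_measure "jumps K w" by (rule finite_jumps)
  have i: "integrable (jumps K w) (\<lambda>x. indicator {a<..b} x * (p * exp (x - b) + q))"
    if "0 \<le> p" "0 \<le> q" for p q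
    by (rule integrable_const_bound[where B="p + q"]) (use bounded_on_interval[OF that] in auto)
  have e: "(\<integral>x. indicator {a<..b} x * (p * exp (x - b) + q) \<partial>jumps K w) =
      (\<integral>x. indicator {a<..b} x * (p * exp (x - b) + q) \<partial>path_measure w)" for p q
    by (subst integral_jumps, measurable) (use ab in \<open>auto intro!: Bochner_Integration.integral_cong simp: indicator_def\<close>)
  have "(\<integral>x. indicator {a<..b} x * (s * exp (x - b) + t) \<partial>jumps K w) =
     (\<integral>x. s * (indicator {a<..b} x * (1 * exp (x - b) + 0)) + t * (indicator {a<..b} x * (0 * exp (x - b) + 1)) \<partial>jumps K w)"
    by (intro Bochner_Integration.integral_cong) (auto simp: indicator_def)
  also have "\<dots> = s * (\<integral>x. indicator {a<..b} x * (1 * exp (x - b) + 0) \<partial>jumps K w) + t * (\<integral>x. indicator {a<..b} x * (0 * exp (x - b) + 1) \<partial>jumps K w)"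
    using i[of 1 0] i[of 0 1] by (subst Bochner_Integration.integral_add) (auto intro!: integrable_mult_right)
  also have "\<dots> = s * discounted a b w + t * mass a b w"
    unfolding e using ab(2) by (simp add: discounted_def mass_def measure_path)
  finally show "(\<integral>x. indicator {a<..b} x * (s * exp (x - b) + t) \<partial>jumps K w) = s * discounted a b w + t * mass a b w" .
  show "integrable (jumps K w) (\<lambda>x. indicator {a<..b} x * (s * exp (x - b) + t))" using i st by blast
qed

lemma discounted_measurable[measurable]:
  assumes ab: "0 \<le> a" "a \<le> b"
  shows "discounted a b \<in> borel_measurable M"
proof -
  have "gamma_laplace_at M (jumps (b + 1)) (intensity (b + 1)) (\<lambda>x. indicator {a<..b} x * (1 * exp (x - b) + 0))"
    by (rule laplace_borel[where B="1 + 0"]) (use ab bounded_on_interval[of 1 0 a b] in auto)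
  then show ?thesis
    using integral_jumps_interval(1)[OF ab, of "b + 1" 1 0] by (simp add: gamma_laplace_at_def)
qed

text \<open>At each point at most one of the intervals contributes to the test function, so \<open>ln (1 + _)\<close> of the sum is the sum of the
  \<open>ln (1 + _)\<close>.\<close>

lemma laplace_intervals:
  assumes I: "finite I" and ab: "\<And>i. i \<in> I \<Longrightarrow> 0 \<le> a i" "\<And>i. i \<in> I \<Longrightarrow> a i \<le> b i"
    and disj: "disjoint_family_on (\<lambda>i. {a i<..b i}) I"
    and st: "\<And>i. 0 \<le> s i" "\<And>i. 0 \<le> t i"
  shows "(\<integral>w. exp (- (\<Sum>i\<in>I. s i * discounted (a i) (b i) w + t i * mass (a i) (b i) w)) \<partial>M) =
    exp (- (\<theta> * (\<Sum>i\<in>I. log_integral (b i - a i) (s i) (t i))))"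
proof -
  \<comment> \<open>A common horizon for all intervals.\<close>
  define K where "K = 1 + (\<Sum>i\<in>I. b i)"
  have b0: "0 \<le> b i" if "i \<in> I" for i using ab[OF that] by linarith
  have bK: "b i \<le> K" if "i \<in> I" for i
    using member_le_sum[of i I b] that b0 I by (simp add: K_def)
  have K: "0 < K" using b0 by (simp add: K_def add_pos_nonneg sum_nonneg)
  define g where "g i x = indicator {a i<..b i} x * (s i * exp (x - b i) + t i)" for i x
  define f where "f x = (\<Sum>i\<in>I. g i x)" for x
  have g: "0 \<le> g i x" "g i x \<le> s i + t i" for i x
    unfolding g_def by (rule bounded_on_interval[OF st])+
  have [measurable]: "g i \<in> borel_measurable borel" for i unfolding g_def by measurable
  have fm[measurable]: "f \<in> borel_measurable borel" unfolding f_def by measurable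
  have "0 \<le> f x \<and> f x \<le> (\<Sum>i\<in>I. s i + t i)" for x
    unfolding f_def using g by (auto intro!: sum_nonneg sum_mono)
  from laplace_borel[OF K fm this]
  have L: "(\<integral>w. exp (- (\<integral>x. f x \<partial>jumps K w)) \<partial>M) = exp (- (\<integral>x. ln (1 + f x) \<partial>intensity K))"
    by (simp add: gamma_laplace_at_def)
  have 1: "(\<integral>x. f x \<partial>jumps K w) = (\<Sum>i\<in>I. s i * discounted (a i) (b i) w + t i * mass (a i) (b i) w)" for w
    unfolding f_def g_def using integral_jumps_interval[OF ab bK st]
    by (subst Bochner_Integration.integral_sum) auto
  interpret int: finite_measure "intensity K" by (rule finite_intensity)
  have ln_f: "ln (1 + f x) = (\<Sum>i\<in>I. ln (1 + g i x))" for x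
  proof (cases "\<exists>j\<in>I. x \<in> {a j<..b j}")
    case True
    then obtain j where j: "j \<in> I" "x \<in> {a j<..b j}" by auto
    have "g i x = 0" if "i \<in> I" "i \<noteq> j" for i
    proof -
      have "x \<notin> {a i<..b i}" using disjoint_family_onD[OF disj that(1) j(1) that(2)] j(2) by blast
      then show ?thesis by (simp add: g_def indicator_def)
    qed
    then show ?thesis
      unfolding f_def using I j by (simp add: sum.remove[OF I j(1)])
  next
    case False
    then have "g i x = 0" if "i \<in> I" for i using that by (auto simp: g_def indicator_def)
    then show ?thesis by (simp add: f_def)
  qed
  have 2: "(\<integral>x. ln (1 + f x) \<partial>intensity K) = (\<Sum>i\<in>I. \<theta> * log_integral (b i - a i) (s i) (t i))"
    unfolding ln_f
  proof (subst Bochner_Integration.integral_sum)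
    fix i assume i: "i \<in> I"
    have "0 \<le> ln (1 + g i x)" "ln (1 + g i x) \<le> s i + t i" for x
      using g[of i x] ln_add_one_self_le_self[of "g i x"] by auto
    then show "integrable (intensity K) (\<lambda>x. ln (1 + g i x))"
      by (intro int.integrable_const_bound[where B="s i + t i"]) auto
  next
    have "(\<integral>x. ln (1 + g i x) \<partial>intensity K) = \<theta> * log_integral (b i - a i) (s i) (t i)" if i: "i \<in> I" for i
    proof -
      have "(\<integral>x. ln (1 + g i x) \<partial>intensity K) = \<theta> * (\<integral>x. indicator {0<..K} x * ln (1 + g i x) \<partial>lborel)"
        by (rule integral_intensity) measurable
      also have "(\<integral>x. indicator {0<..K} x * ln (1 + g i x) \<partial>lborel) =
         (\<integral>x. indicator {a i<..b i} x * ln (1 + (s i * exp (x - b i) + t i)) \<partial>lborel)"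
        using ab[OF i] bK[OF i] by (intro Bochner_Integration.integral_cong refl) (auto simp: g_def indicator_def)
      finally show ?thesis by (simp only: log_integral_shift)
    qed
    then show "(\<Sum>i\<in>I. \<integral>x. ln (1 + g i x) \<partial>intensity K) = (\<Sum>i\<in>I. \<theta> * log_integral (b i - a i) (s i) (t i))"
      by simp
  qed
  show ?thesis using L unfolding 1 2 by (simp add: sum_distrib_left)
qed

lemma laplace_pair:
  assumes "0 \<le> a" "a \<le> b" "0 \<le> s" "0 \<le> t"
  shows "(\<integral>w. exp (- (s * discounted a b w + t * mass a b w)) \<partial>M) = exp (- (\<theta> * log_integral (b - a) s t))"
  using laplace_intervals[of "{()}" "\<lambda>_. a" "\<lambda>_. b" "\<lambda>_. s" "\<lambda>_. t"] assms
  by (simp add: disjoint_family_on_def)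

lemma indep_pairs:
  assumes I: "finite I" and ab: "\<And>i. i \<in> I \<Longrightarrow> 0 \<le> a i" "\<And>i. i \<in> I \<Longrightarrow> a i \<le> b i"
    and disj: "disjoint_family_on (\<lambda>i. {a i<..b i}) I"
  shows "indep_vars (\<lambda>_. borel \<Otimes>\<^sub>M borel) (\<lambda>i w. (discounted (a i) (b i) w, mass (a i) (b i) w)) I"
proof (rule indep_vars_laplace_pair[OF I])
  show "(\<lambda>w. (discounted (a i) (b i) w, mass (a i) (b i) w)) \<in> M \<rightarrow>\<^sub>M borel \<Otimes>\<^sub>M borel" if "i \<in> I" for i
    using discounted_measurable[OF ab[OF that]] by measurable
  show "0 \<le> fst (discounted (a i) (b i) x, mass (a i) (b i) x) \<and> 0 \<le> snd (discounted (a i) (b i) x, mass (a i) (b i) x)"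
    if "i \<in> I" for i x using ab(2)[OF that] by (simp add: discounted_nonneg mass_nonneg)
  fix s t :: "'b \<Rightarrow> real" assume st: "\<And>i. 0 \<le> s i" "\<And>i. 0 \<le> t i"
  show "(\<integral>x. (\<Prod>i\<in>I. exp (- (s i * fst (discounted (a i) (b i) x, mass (a i) (b i) x) + t i * snd (discounted (a i) (b i) x, mass (a i) (b i) x)))) \<partial>M) =
    (\<Prod>i\<in>I. \<integral>x. exp (- (s i * fst (discounted (a i) (b i) x, mass (a i) (b i) x) + t i * snd (discounted (a i) (b i) x, mass (a i) (b i) x))) \<partial>M)"
    using laplace_intervals[OF I ab disj st] I
    by (simp add: laplace_pair ab st sum_negf[symmetric] sum_distrib_left exp_sum[symmetric] del: minus_add_distrib)
qed

lemma mass_law: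
  assumes "0 \<le> a" "a \<le> b"
  shows "distr M borel (mass a b) = gamma_law (\<theta> * (b - a))"
proof (rule distr_eq_gamma_law)
  fix u :: real assume u: "0 \<le> u"
  then have "1 + u \<noteq> 0" by linarith
  then show "(\<integral>w. exp (- u * mass a b w) \<partial>M) = (1 + u) powr - (\<theta> * (b - a))"
    using laplace_pair[OF assms order.refl u] assms by (simp add: log_integral_0 powr_def mult_ac)
qed (use assms theta in \<open>auto simp: mass_nonneg\<close>)

definition ratio :: "real \<Rightarrow> real \<Rightarrow> 'a \<Rightarrow> real" where
  "ratio a b w = discounted a b w / mass a b w"

lemma pair_law_shift:
  assumes "0 \<le> a" "a \<le> b"
  shows "distr M (borel \<Otimes>\<^sub>M borel) (\<lambda>w. (discounted a b w, mass a b w)) =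
    distr M (borel \<Otimes>\<^sub>M borel) (\<lambda>w. (discounted 0 (b - a) w, mass 0 (b - a) w))"
proof (rule distr_eq_laplace_pair)
  show "(\<lambda>w. (discounted a b w, mass a b w)) \<in> M \<rightarrow>\<^sub>M borel \<Otimes>\<^sub>M borel"
    using discounted_measurable[OF assms] by measurable
  show "(\<lambda>w. (discounted 0 (b - a) w, mass 0 (b - a) w)) \<in> M \<rightarrow>\<^sub>M borel \<Otimes>\<^sub>M borel"
    using discounted_measurable[of 0 "b - a"] assms by (intro measurable_Pair) auto
qed (use assms in \<open>auto simp: finite_measure_axioms discounted_nonneg mass_nonneg laplace_pair simp del: minus_add_distrib\<close>)

lemma mass_indep_ratio:
  assumes ab: "0 \<le> a" "a \<le> b" and "A \<in> sets borel" "B \<in> sets borel"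
  shows "prob {w \<in> space M. mass a b w \<in> A \<and> ratio a b w \<in> B} =
    prob {w \<in> space M. mass a b w \<in> A} * prob {w \<in> space M. ratio a b w \<in> B}"
  unfolding ratio_def
proof (rule ratio_indep_total[where c="\<theta> * (b - a)"])
  fix r s u :: real assume rsu: "0 \<le> r" "0 \<le> s" "0 \<le> u"
  then have r1: "1 + r \<noteq> 0" by linarith
  have "(\<integral>w. exp (- (s * (discounted a b w / (1 + r)) + u * (mass a b w / (1 + r)))) \<partial>M) =
     (\<integral>w. exp (- (s / (1 + r) * discounted a b w + u / (1 + r) * mass a b w)) \<partial>M)" by simp
  also have "\<dots> = exp (- (\<theta> * log_integral (b - a) (s / (1 + r)) (u / (1 + r))))"
    by (rule laplace_pair) (use ab rsu in auto)
  finally have "(1 + r) powr - (\<theta> * (b - a)) * (\<integral>w. exp (- (s * (discounted a b w / (1 + r)) + u * (mass a b w / (1 + r)))) \<partial>M) =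
     exp (- (\<theta> * log_integral (b - a) s (u + r)))"
  proof (simp only:)
    have "log_integral (b - a) s (u + r) = (b - a) * ln (1 + r) + log_integral (b - a) (s / (1 + r)) (u / (1 + r))"
      by (rule log_integral_scale) (use ab rsu in auto)
    then have "- (\<theta> * log_integral (b - a) s (u + r)) =
        - (\<theta> * (b - a)) * ln (1 + r) + - (\<theta> * log_integral (b - a) (s / (1 + r)) (u / (1 + r)))"
      by (simp only:) (simp add: algebra_simps)
    then show "(1 + r) powr - (\<theta> * (b - a)) * exp (- (\<theta> * log_integral (b - a) (s / (1 + r)) (u / (1 + r)))) =
        exp (- (\<theta> * log_integral (b - a) s (u + r)))"
      using r1 by (simp only: exp_add powr_def if_False)
  qed
  then show "(\<integral>w. exp (- (s * discounted a b w + (u + r) * mass a b w)) \<partial>M) =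
    (1 + r) powr - (\<theta> * (b - a)) * (\<integral>w. exp (- (s * (discounted a b w / (1 + r)) + u * (mass a b w / (1 + r)))) \<partial>M)"
    using laplace_pair[OF ab rsu(2), of "u + r"] rsu by simp
qed (use assms theta in \<open>auto simp: discounted_nonneg mass_nonneg discounted_measurable\<close>)

lemma gamma_random_measure_jumps:
  assumes d: "0 < d"
  shows "gamma_random_measure M (scale_measure (ennreal (\<theta> * d)) (F_law d))
    (\<lambda>w. distr (jumps d w) borel (\<lambda>x. exp (x - d)))"
proof -
  have \<alpha>: "scale_measure (ennreal (\<theta> * d)) (F_law d) = distr (intensity d) borel (\<lambda>x. exp (x - d))"
    using scale_measure_F_law[OF d theta] by (simp add: intensity_def)
  show ?thesis
    unfolding \<alpha>
  proof (rule gamma_random_measureI[OF prob_space_axioms])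
    show "finite_measure (distr (intensity d) borel (\<lambda>x. exp (x - d)))"
      by (intro finite_measure.finite_measure_distr finite_intensity) simp
    show "sets (distr (jumps d w) borel (\<lambda>x. exp (x - d))) = sets (distr (intensity d) borel (\<lambda>x. exp (x - d))) \<and>
        finite_measure (distr (jumps d w) borel (\<lambda>x. exp (x - d)))" for w
      by (auto intro!: finite_measure.finite_measure_distr finite_jumps)
    fix f :: "real \<Rightarrow> real" and B
    assume "f \<in> borel_measurable (distr (intensity d) borel (\<lambda>x. exp (x - d)))" and bnd: "\<And>x. 0 \<le> f x \<and> f x \<le> B"
    then have [measurable]: "f \<in> borel_measurable borel" by simp
    have "gamma_laplace_at M (jumps d) (intensity d) (\<lambda>x. f (exp (x - d)))"
      by (rule laplace_borel[OF d]) (use bnd in auto)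
    moreover have "(\<integral>x. f x \<partial>distr (jumps d w) borel (\<lambda>x. exp (x - d))) = (\<integral>x. f (exp (x - d)) \<partial>jumps d w)" for w
      by (rule integral_distr) auto
    moreover have "(\<integral>x. ln (1 + f x) \<partial>distr (intensity d) borel (\<lambda>x. exp (x - d))) = (\<integral>x. ln (1 + f (exp (x - d))) \<partial>intensity d)"
      by (rule integral_distr) auto
    ultimately show "gamma_laplace_at M (\<lambda>w. distr (jumps d w) borel (\<lambda>x. exp (x - d))) (distr (intensity d) borel (\<lambda>x. exp (x - d))) f"
      by (simp add: gamma_laplace_at_def)
  qed
qed

end

section \<open>The Dirichlet mean law\<close>

lemma scale_measure_eq_density:
  "scale_measure r M = density M (\<lambda>_. r)"
  by (rule measure_eqI) (auto simp: emeasure_density nn_integral_cmult)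

text \<open>The mean is measurable on the whole sample space, including null events where the random measure
  vanishes or the identity is not integrable. Therefore it suffices to identify it almost surely in order to
  find its law.\<close>

lemma dirichlet_mean_measurable:
  assumes G: "gamma_random_measure N \<alpha> \<mu>" and \<alpha>: "sets \<alpha> = sets (borel :: real measure)"
  shows "(\<lambda>w. \<integral>x. x \<partial>scale_measure (inverse (emeasure (\<mu> w) (space \<alpha>))) (\<mu> w)) \<in> borel_measurable N"
proof (rule integral_kernel_measurable)
  have \<mu>: "sets (\<mu> w) = sets \<alpha>" "finite_measure (\<mu> w)" if "w \<in> space N" for w
    using G that by (auto simp: gamma_random_measure_def)
  show "sets (scale_measure (inverse (emeasure (\<mu> w) (space \<alpha>))) (\<mu> w)) = sets \<alpha>" if "w \<in> space N" for w
    using \<mu>[OF that] by simp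
  fix A assume A: "A \<in> sets \<alpha>"
  have e: "(\<lambda>w. emeasure (\<mu> w) A) \<in> borel_measurable N" if "A \<in> sets \<alpha>" for A
  proof (rule measurable_cong[THEN iffD2])
    show "emeasure (\<mu> w) A = ennreal (measure (\<mu> w) A)" if "w \<in> space N" for w
      using \<mu>(2)[OF that] by (rule finite_measure.emeasure_eq_measure)
    show "(\<lambda>w. ennreal (measure (\<mu> w) A)) \<in> borel_measurable N"
      using G that by (auto simp: gamma_random_measure_def)
  qed
  note [measurable] = e[OF A] e[OF sets.top]
  show "(\<lambda>w. emeasure (scale_measure (inverse (emeasure (\<mu> w) (space \<alpha>))) (\<mu> w)) A) \<in> borel_measurable N"
    by simp
next
  show "(\<lambda>x::real. x) \<in> borel_measurable \<alpha>" using measurable_ident_sets[OF \<alpha>] by simp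
qed

context gamma_paths
begin

text \<open>A Gamma random measure \<open>\<mu>\<close> with this shape lives on the unit interval, almost surely. There the identity
  agrees with its truncation \<open>c\<close>, a bounded function, and the Laplace functional gives the pair
  \<open>(\<integral>c \<partial>\<mu>, \<mu> UNIV)\<close> the same joint law as the discounted integral and the mass of the Gamma process. The mean of the
  normalised measure is the quotient.\<close>

lemma dirichlet_mean_unique:
  assumes d: "0 < d" and D: "dirichlet_process N (scale_measure (ennreal (\<theta> * d)) (F_law d)) P"
  shows "distr N borel (\<lambda>w. \<integral>x. x \<partial>P w) = distr M borel (ratio 0 d)"
proof -
  define \<alpha> where "\<alpha> = scale_measure (ennreal (\<theta> * d)) (F_law d)"
  have \<alpha>_distr: "\<alpha> = distr (intensity d) borel (\<lambda>x. exp (x - d))"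
    using scale_measure_F_law[OF d theta] by (simp add: intensity_def \<alpha>_def)
  have sets_\<alpha>: "sets \<alpha> = sets borel" and sp_\<alpha>: "space \<alpha> = UNIV" by (simp_all add: \<alpha>_distr)
  note [measurable_cong] = sets_\<alpha>
  interpret \<alpha>: finite_measure \<alpha>
    unfolding \<alpha>_distr by (intro finite_measure.finite_measure_distr finite_intensity) simp
  have int_\<alpha>: "(\<integral>x. g x \<partial>\<alpha>) = \<theta> * (\<integral>x. indicator {0<..d} x * g (exp (x - d)) \<partial>lborel)"
    if [measurable]: "g \<in> borel_measurable borel" for g :: "real \<Rightarrow> real"
  proof -
    have "(\<integral>x. g x \<partial>\<alpha>) = (\<integral>x. g (exp (x - d)) \<partial>intensity d)"
      unfolding \<alpha>_distr by (rule integral_distr) auto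
    also have "\<dots> = \<theta> * (\<integral>x. indicator {0<..d} x * g (exp (x - d)) \<partial>lborel)"
      by (rule integral_intensity) measurable
    finally show ?thesis .
  qed
  have total_\<alpha>: "measure \<alpha> UNIV = \<theta> * d"
    using int_\<alpha>[of "\<lambda>_. 1"] d sp_\<alpha> by simp
  have null_\<alpha>: "measure \<alpha> (- {0..1}) = 0"
  proof -
    have "measure \<alpha> (- {0..1}) = (\<integral>x. indicator (- {0..1}) x \<partial>\<alpha>)"
      using sp_\<alpha> by simp
    also have "\<dots> = \<theta> * (\<integral>x. indicator {0<..d} x * indicator (- {0..1}) (exp (x - d)) \<partial>lborel)"
      by (rule int_\<alpha>) measurable
    also have "(\<lambda>x. indicator {0<..d} x * indicator (- {0..1}) (exp (x - d))) = (\<lambda>x. 0 :: real)"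
      by (auto simp: indicator_def)
    finally show ?thesis by simp
  qed
  obtain \<mu> where G: "gamma_random_measure N \<alpha> \<mu>"
    and P: "P = (\<lambda>w. scale_measure (inverse (emeasure (\<mu> w) (space \<alpha>))) (\<mu> w))"
    using D unfolding dirichlet_process_def \<alpha>_def by blast
  interpret N: prob_space N using G by (simp add: gamma_random_measure_def)
  have \<mu>: "sets (\<mu> w) = sets borel" "finite_measure (\<mu> w)" "space (\<mu> w) = UNIV" if "w \<in> space N" for w
    using G that sets_eq_imp_space_eq[of "\<mu> w" \<alpha>] by (auto simp: gamma_random_measure_def sets_\<alpha> sp_\<alpha>)
  have G\<mu>: "(\<lambda>w. measure (\<mu> w) A) \<in> borel_measurable N"
    "distr N borel (\<lambda>w. measure (\<mu> w) A) = gamma_law (measure \<alpha> A)" if "A \<in> sets borel" for A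
    using G that by (auto simp: gamma_random_measure_def sets_\<alpha>)
  define c where "c x = max 0 (min 1 x)" for x :: real
  have c[measurable]: "c \<in> borel_measurable borel" unfolding c_def by measurable
  have c01: "0 \<le> c x" "c x \<le> 1" for x by (auto simp: c_def)
  define X where "X w = (\<integral>x. c x \<partial>\<mu> w)" for w
  define T where "T w = measure (\<mu> w) UNIV" for w
  have T[measurable]: "T \<in> borel_measurable N" using G\<mu>(1)[of UNIV] by (simp add: T_def[abs_def])
  have gl: "gamma_laplace_at N \<mu> \<alpha> (\<lambda>x. s * c x + t)" if "0 \<le> s" "0 \<le> t" for s t
    by (rule gamma_random_measure_laplace[OF G \<alpha>.finite_measure_axioms, where B="s + t"])
       (use that c01 in \<open>auto intro: mult_left_le\<close>)
  have int: "(\<integral>x. s * c x + t \<partial>\<mu> w) = s * X w + t * T w" if w: "w \<in> space N" for s t w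
  proof -
    interpret m: finite_measure "\<mu> w" using \<mu>[OF w] by simp
    have "c \<in> borel_measurable (\<mu> w)" using c measurable_cong_sets[OF \<mu>(1)[OF w] refl] by blast
    then have "integrable (\<mu> w) c"
      by (intro m.integrable_const_bound[where B=1]) (use c01 in auto)
    then show ?thesis using \<mu>(3)[OF w] by (simp add: X_def T_def mult.commute)
  qed
  have X[measurable]: "X \<in> borel_measurable N"
  proof (rule measurable_cong[THEN iffD1])
    show "(\<integral>x. 1 * c x + 0 \<partial>\<mu> w) = X w" if "w \<in> space N" for w using int[OF that, of 1 0] by simp
    show "(\<lambda>w. \<integral>x. 1 * c x + 0 \<partial>\<mu> w) \<in> borel_measurable N"
      using gl[of 1 0] unfolding gamma_laplace_at_def by simp
  qed
  have eq: "distr N (borel \<Otimes>\<^sub>M borel) (\<lambda>w. (X w, T w)) = distr M (borel \<Otimes>\<^sub>M borel) (\<lambda>w. (discounted 0 d w, mass 0 d w))"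
  proof (rule distr_eq_laplace_pair)
    fix s t :: real assume st: "0 \<le> s" "0 \<le> t"
    have "(\<integral>w. exp (- (s * fst (X w, T w) + t * snd (X w, T w))) \<partial>N) = (\<integral>w. exp (- (\<integral>x. s * c x + t \<partial>\<mu> w)) \<partial>N)"
      by (intro Bochner_Integration.integral_cong refl) (simp add: int)
    also have "\<dots> = exp (- (\<integral>x. ln (1 + (s * c x + t)) \<partial>\<alpha>))"
      using gl[OF st] by (simp add: gamma_laplace_at_def)
    also have "(\<integral>x. ln (1 + (s * c x + t)) \<partial>\<alpha>) = \<theta> * (\<integral>x. indicator {0<..d} x * ln (1 + (s * c (exp (x - d)) + t)) \<partial>lborel)"
      by (rule int_\<alpha>) measurable
    also have "(\<integral>x. indicator {0<..d} x * ln (1 + (s * c (exp (x - d)) + t)) \<partial>lborel) = log_integral d s t"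
      unfolding log_integral_def
      by (intro Bochner_Integration.integral_cong refl) (auto simp: indicator_def c_def)
    also have "exp (- (\<theta> * log_integral d s t)) = (\<integral>w. exp (- (s * fst (discounted 0 d w, mass 0 d w) + t * snd (discounted 0 d w, mass 0 d w))) \<partial>M)"
      using laplace_pair[of 0 d s t] st d by simp
    finally show "(\<integral>w. exp (- (s * fst (X w, T w) + t * snd (X w, T w))) \<partial>N) =
      (\<integral>w. exp (- (s * fst (discounted 0 d w, mass 0 d w) + t * snd (discounted 0 d w, mass 0 d w))) \<partial>M)" .
  next
    show "(\<lambda>w. (discounted 0 d w, mass 0 d w)) \<in> M \<rightarrow>\<^sub>M borel \<Otimes>\<^sub>M borel"
      using discounted_measurable[of 0 d] d by (intro measurable_Pair) auto
    show "AE w in N. 0 \<le> fst (X w, T w) \<and> 0 \<le> snd (X w, T w)"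
      using c01 by (auto simp: X_def T_def)
  qed (use d in \<open>auto simp: finite_measure_axioms N.finite_measure_axioms discounted_nonneg mass_nonneg\<close>)
  have AE_null: "AE w in N. measure (\<mu> w) (- {0..1}) = 0"
  proof -
    have "AE x in distr N borel (\<lambda>w. measure (\<mu> w) (- {0..1})). x = 0"
    proof (subst G\<mu>(2))
      have "AE x in return borel (0::real). x = 0" by (subst AE_return) auto
      moreover have "gamma_law 0 = return borel 0" by (simp add: gamma_law_def)
      ultimately show "AE x in gamma_law (measure \<alpha> (- {0..1})). x = 0" by (simp only: null_\<alpha>)
    qed auto
    then show ?thesis using G\<mu>(1)[of "- {0..1}"] by (subst (asm) AE_distr_iff) auto
  qed
  have AE_pos: "AE w in N. 0 < T w"
  proof -
    have "distr N borel T = gamma_law (\<theta> * d)"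
      using G\<mu>(2)[of UNIV] by (simp add: total_\<alpha> T_def[abs_def])
    then have "AE x in distr N borel T. 0 < x"
      using AE_gamma_law_pos[OF mult_pos_pos[OF theta d]] by (simp only:)
    then show ?thesis by (subst (asm) AE_distr_iff) auto
  qed
  have AE_mean: "AE w in N. (\<integral>x. x \<partial>P w) = X w / T w"
    using AE_null AE_pos AE_space
  proof eventually_elim
    fix w assume n: "measure (\<mu> w) (- {0..1}) = 0" and T0: "0 < T w" and w: "w \<in> space N"
    interpret m: finite_measure "\<mu> w" using \<mu>[OF w] by simp
    have [measurable_cong]: "sets (\<mu> w) = sets borel" using \<mu>[OF w] by simp
    have "inverse (emeasure (\<mu> w) (space \<alpha>)) = ennreal (1 / T w)"
      using T0 by (simp add: sp_\<alpha> m.emeasure_eq_measure T_def inverse_ennreal divide_inverse)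
    then have "(\<integral>x. x \<partial>P w) = (\<integral>x. x \<partial>density (\<mu> w) (\<lambda>_. ennreal (1 / T w)))"
      by (simp add: P scale_measure_eq_density)
    also have "\<dots> = (1 / T w) * (\<integral>x. x \<partial>\<mu> w)"
      using T0 by (subst integral_density) auto
    also have "(\<integral>x. x \<partial>\<mu> w) = X w"
      unfolding X_def
    proof (rule integral_cong_AE)
      have "emeasure (\<mu> w) (- {0..1}) = 0" using n by (simp add: m.emeasure_eq_measure)
      then have "AE x in \<mu> w. x \<notin> - {0..1}" by (intro AE_not_in) (auto simp: null_sets_def)
      then show "AE x in \<mu> w. x = c x" by eventually_elim (auto simp: c_def)
    qed auto
    finally show "(\<integral>x. x \<partial>P w) = X w / T w" by simp
  qed
  have "distr N borel (\<lambda>w. \<integral>x. x \<partial>P w) = distr N borel (\<lambda>w. X w / T w)"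
    using AE_mean dirichlet_mean_measurable[OF G sets_\<alpha>] by (intro distr_cong_AE) (auto simp: P)
  also have "\<dots> = distr (distr N (borel \<Otimes>\<^sub>M borel) (\<lambda>w. (X w, T w))) borel (\<lambda>p. fst p / snd p)"
    by (subst distr_distr) (auto simp: comp_def)
  also have "\<dots> = distr M borel (ratio 0 d)"
    unfolding eq using discounted_measurable[of 0 d] d
    by (subst distr_distr) (auto simp: comp_def ratio_def[abs_def])
  finally show ?thesis .
qed

text \<open>Existence of a Dirichlet process with this shape measure, without which the definite description says nothing,
  comes from the Gamma process itself.\<close>

lemma dirichlet_mean_law_eq:
  assumes d: "0 < d"
  shows "dirichlet_mean_law (scale_measure (ennreal (\<theta> * d)) (F_law d)) = distr M borel (ratio 0 d)"
proof -
  define \<alpha> where "\<alpha> = scale_measure (ennreal (\<theta> * d)) (F_law d)"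
  have "\<alpha> = distr (intensity d) borel (\<lambda>x. exp (x - d))"
    using scale_measure_F_law[OF d theta] by (simp add: intensity_def \<alpha>_def)
  then have "finite_measure \<alpha>"
    by (auto intro!: finite_measure.finite_measure_distr finite_intensity)
  then obtain N :: "real measure measure" where N: "gamma_random_measure N \<alpha> (\<lambda>m. m)"
    using gamma_random_measure_on_measures gamma_random_measure_jumps[OF d] unfolding \<alpha>_def by blast
  show ?thesis
    unfolding dirichlet_mean_law_def \<alpha>_def[symmetric]
  proof (rule the_equality)
    have "dirichlet_process N \<alpha> (\<lambda>w. scale_measure (inverse (emeasure w (space \<alpha>))) w)"
      unfolding dirichlet_process_def using N by blast
    then show "\<exists>(N :: real measure measure) P. dirichlet_process N \<alpha> P \<and> distr M borel (ratio 0 d) = distr N borel (\<lambda>w. \<integral>x. x \<partial>P w)"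
      using dirichlet_mean_unique[OF d] unfolding \<alpha>_def by metis
    show "\<nu> = distr M borel (ratio 0 d)"
      if "\<exists>(N :: real measure measure) P. dirichlet_process N \<alpha> P \<and> \<nu> = distr N borel (\<lambda>w. \<integral>x. x \<partial>P w)" for \<nu>
      using that dirichlet_mean_unique[OF d] unfolding \<alpha>_def by blast
  qed
qed

lemma ratio_law:
  assumes "0 \<le> a" "a < b"
  shows "distr M borel (ratio a b) = dirichlet_mean_law (scale_measure (ennreal (\<theta> * (b - a))) (F_law (b - a)))"
proof -
  have "distr M borel (ratio a b) = distr (distr M (borel \<Otimes>\<^sub>M borel) (\<lambda>w. (discounted a b w, mass a b w))) borel (\<lambda>p. fst p / snd p)"
    using discounted_measurable[of a b] assms by (subst distr_distr) (auto simp: comp_def ratio_def[abs_def])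
  also have "\<dots> = distr M borel (ratio 0 (b - a))"
    using discounted_measurable[of 0 "b - a"] assms pair_law_shift[of a b]
    by (simp, subst distr_distr) (auto simp: comp_def ratio_def[abs_def])
  finally show ?thesis using dirichlet_mean_law_eq[of "b - a"] assms by simp
qed

end

section \<open>Stieltjes integrals of nondecreasing paths\<close>

text \<open>Fubini on the triangle \<open>0 < x \<le> u \<le> K\<close>, with \<open>g K - g x\<close> written as the integral of \<open>g'\<close>. Used
  with \<open>g = exp\<close> to compute the exponential integral of a path, and with \<open>g = (\<lambda>u. - exp (- u))\<close> to integrate
  the Ornstein-Uhlenbeck process.\<close>

lemma stieltjes_by_parts:
  fixes m :: "real measure" and g g' h :: "real \<Rightarrow> real"
  assumes m[measurable_cong]: "sets m = sets borel" and fin: "emeasure m {0<..K} < \<infinity>" and K: "0 \<le> K"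
    and deriv: "\<And>u. u \<in> {0..K} \<Longrightarrow> (g has_real_derivative g' u) (at u)" and cont: "\<And>u. u \<in> {0..K} \<Longrightarrow> isCont g' u"
    and [measurable]: "g' \<in> borel_measurable borel" "h \<in> borel_measurable borel"
    and B: "\<And>u x. u \<in> {0..K} \<Longrightarrow> x \<in> {0<..K} \<Longrightarrow> \<bar>g' u * h x\<bar> \<le> B"
  shows "integrable lborel (\<lambda>u. indicator {0..K} u * (g' u * (\<integral>x. indicator {0<..u} x * h x \<partial>m)))" (is ?int)
    and "(\<integral>u. indicator {0..K} u * (g' u * (\<integral>x. indicator {0<..u} x * h x \<partial>m)) \<partial>lborel) =
      (\<integral>x. indicator {0<..K} x * (h x * (g K - g x)) \<partial>m)" (is ?eq)
proof -
  define L where "L = density lborel (\<lambda>u. ennreal (indicator {0..K} u))"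
  define N where "N = density m (\<lambda>x. ennreal (indicator {0<..K} x))"
  have [measurable_cong]: "sets L = sets borel" "sets N = sets borel" by (simp_all add: L_def N_def m)
  define \<Phi> where "\<Phi> u x = (if 0 \<le> u \<and> 0 < x \<and> x \<le> u \<and> u \<le> K then g' u * h x else 0)" for u x
  have [measurable]: "(\<lambda>p. \<Phi> (fst p) (snd p)) \<in> borel_measurable (borel \<Otimes>\<^sub>M borel)"
    unfolding \<Phi>_def by measurable
  have bnd: "\<bar>\<Phi> u x\<bar> \<le> max B 0" for u x
    using B[of u x] by (auto simp: \<Phi>_def)
  have L: "finite_measure L"
    using K by (intro finite_measureI) (simp add: L_def emeasure_density ennreal_indicator)
  have N: "finite_measure N"
    using fin sets_eq_imp_space_eq[OF m] by (intro finite_measureI) (simp add: N_def emeasure_density ennreal_indicator)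
  interpret L: finite_measure L by fact
  interpret N: finite_measure N by fact
  interpret LN: pair_sigma_finite L N ..
  interpret P: finite_measure "L \<Otimes>\<^sub>M N" by (rule finite_measure_pair_measure[OF N L])
  have int: "integrable (L \<Otimes>\<^sub>M N) (\<lambda>(u, x). \<Phi> u x)"
    by (rule P.integrable_const_bound[where B="max B 0"]) (use bnd in \<open>auto simp: split_beta'\<close>)
  have mu[measurable]: "(\<lambda>x. \<Phi> u x) \<in> borel_measurable borel" "(\<lambda>u. \<Phi> u x) \<in> borel_measurable borel" for u x
    unfolding \<Phi>_def by measurable
  have [measurable]: "(\<lambda>x. \<integral>u. \<Phi> u x \<partial>L) \<in> borel_measurable borel"
    by (rule L.borel_measurable_lebesgue_integral) (unfold \<Phi>_def, measurable)
  have inner1: "indicator {0..K} u * (\<integral>x. \<Phi> u x \<partial>N) = indicator {0..K} u * (g' u * (\<integral>x. indicator {0<..u} x * h x \<partial>m))" for u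
  proof (cases "u \<in> {0..K}")
    case True
    have "(\<integral>x. \<Phi> u x \<partial>N) = (\<integral>x. indicator {0<..K} x *\<^sub>R \<Phi> u x \<partial>m)"
      unfolding N_def by (rule integral_density) auto
    also have "\<dots> = (\<integral>x. g' u * (indicator {0<..u} x * h x) \<partial>m)"
      using True by (intro Bochner_Integration.integral_cong refl) (auto simp: \<Phi>_def indicator_def)
    finally show ?thesis by simp
  qed simp
  have inner2: "indicator {0<..K} x * (\<integral>u. \<Phi> u x \<partial>L) = indicator {0<..K} x * (h x * (g K - g x))" for x
  proof (cases "x \<in> {0<..K}")
    case True
    have "(\<integral>u. \<Phi> u x \<partial>L) = (\<integral>u. indicator {0..K} u *\<^sub>R \<Phi> u x \<partial>lborel)"
      unfolding L_def by (rule integral_density) auto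
    also have "\<dots> = (\<integral>u. h x * (g' u * indicator {x..K} u) \<partial>lborel)"
      using True by (intro Bochner_Integration.integral_cong refl) (auto simp: \<Phi>_def indicator_def)
    also have "\<dots> = h x * (g K - g x)"
    proof -
      have "(\<integral>u. g' u * indicator {x..K} u \<partial>lborel) = g K - g x"
      proof (rule integral_FTC_Icc_real)
        fix u assume "x \<le> u" "u \<le> K"
        with True show "(g has_real_derivative g' u) (at u)" by (intro deriv) auto
      next
        fix u assume "x \<le> u" "u \<le> K"
        with True show "isCont g' u" by (intro cont) auto
      qed (use True in auto)
      then show ?thesis by simp
    qed
    finally show ?thesis by simp
  qed simp
  have "(\<integral>u. indicator {0..K} u * (g' u * (\<integral>x. indicator {0<..u} x * h x \<partial>m)) \<partial>lborel) = (\<integral>u. (\<integral>x. \<Phi> u x \<partial>N) \<partial>L)"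
    unfolding inner1[symmetric] unfolding L_def by (subst integral_density) auto
  also have "\<dots> = (\<integral>x. (\<integral>u. \<Phi> u x \<partial>L) \<partial>N)"
    using LN.Fubini_integral[OF int] by simp
  also have "\<dots> = (\<integral>x. indicator {0<..K} x * (h x * (g K - g x)) \<partial>m)"
    unfolding inner2[symmetric] unfolding N_def by (subst integral_density) auto
  finally show ?eq .
  have "integrable L (\<lambda>u. \<integral>x. \<Phi> u x \<partial>N)"
    using LN.integrable_fst'[OF int] by simp
  then show ?int
    unfolding inner1[symmetric] unfolding L_def by (subst (asm) integrable_density) auto
qed

section \<open>Regularised paths\<close>

definition increasing_on_rats :: "(real \<Rightarrow> real) \<Rightarrow> bool" where
  "increasing_on_rats \<psi> \<longleftrightarrow> (\<forall>p\<in>\<rat>. \<forall>q\<in>\<rat>. 0 \<le> p \<longrightarrow> p \<le> q \<longrightarrow> \<psi> p \<le> \<psi> q)"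

text \<open>The right-continuous nondecreasing path determined by the values at nonnegative rational times. Unlike
  the original path it is regular without exception, and it is a measurable function of the
  values and the time jointly, because countably many values are involved. Almost surely it agrees
  with the path of a subordinator; negative times are sent to \<open>0\<close>, as in \<open>sub_integral\<close>.\<close>

definition reg :: "(real \<Rightarrow> real) \<Rightarrow> real \<Rightarrow> real" where
  "reg \<psi> t = (if increasing_on_rats \<psi> then INF q\<in>{q\<in>\<rat>. max 0 t < q}. \<psi> q else 0)"

lemma rat_above: "\<exists>q\<in>\<rat>. max 0 t < q \<and> q < max 0 t + e" if "0 < e" for t e :: real
  using Rats_dense_in_real[of "max 0 t" "max 0 t + e"] that by auto

lemma bdd_below_rats_above: "increasing_on_rats \<psi> \<Longrightarrow> bdd_below (\<psi> ` {q\<in>\<rat>. max 0 t < q})"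
  by (auto intro!: bdd_belowI[where m="\<psi> 0"] simp: increasing_on_rats_def)

lemma rats_above_nonempty: "{q\<in>\<rat>. max 0 t < q} \<noteq> ({} :: real set)"
  using rat_above[of 1 t] by auto

lemma reg_less_iff:
  assumes "increasing_on_rats \<psi>"
  shows "reg \<psi> t < c \<longleftrightarrow> (\<exists>q\<in>\<rat>. max 0 t < q \<and> \<psi> q < c)"
  unfolding reg_def using assms
  by (simp only: if_True cINF_less_iff[OF rats_above_nonempty bdd_below_rats_above[OF assms]]) blast

lemma reg_mono: "s \<le> t \<Longrightarrow> reg \<psi> s \<le> reg \<psi> t"
proof (cases "increasing_on_rats \<psi>")
  case True
  assume "s \<le> t"
  then have "(INF q\<in>{q\<in>\<rat>. max 0 s < q}. \<psi> q) \<le> (INF q\<in>{q\<in>\<rat>. max 0 t < q}. \<psi> q)"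
    by (intro cINF_superset_mono rats_above_nonempty bdd_below_rats_above[OF True]) auto
  then show ?thesis using True by (simp only: reg_def if_True)
qed (simp add: reg_def)

lemma reg_right_continuous: "continuous (at_right t) (reg \<psi>)"
proof (cases "increasing_on_rats \<psi>")
  case True
  show ?thesis
  proof (subst continuous_at_right_real_increasing)
    show "\<forall>e>0. \<exists>d>0. reg \<psi> (t + d) - reg \<psi> t < e"
    proof (intro allI impI)
      fix e :: real assume "0 < e"
      then have "reg \<psi> t < reg \<psi> t + e" by simp
      then obtain q where q: "q \<in> \<rat>" "max 0 t < q" "\<psi> q < reg \<psi> t + e"
        using reg_less_iff[OF True] by blast
      define d where "d = (q - max 0 t) / 2"
      have "max 0 (t + d) < q" "0 < d" using q(2) by (auto simp: d_def max_def field_simps split: if_splits)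
      then have "reg \<psi> (t + d) < reg \<psi> t + e" using q reg_less_iff[OF True] by blast
      then show "\<exists>d>0. reg \<psi> (t + d) - reg \<psi> t < e" using \<open>0 < d\<close> by (intro exI[of _ d]) auto
    qed
  qed (rule reg_mono)
next
  case False
  then have "reg \<psi> = (\<lambda>_. 0)" by (simp add: reg_def fun_eq_iff)
  then show ?thesis by simp
qed

lemma reg_eq:
  assumes mono: "mono_on {0..} \<psi>" and rc: "\<And>t. 0 \<le> t \<Longrightarrow> continuous (at_right t) \<psi>"
  shows "reg \<psi> t = \<psi> (max 0 t)"
proof -
  have inc: "increasing_on_rats \<psi>"
    using mono by (auto simp: increasing_on_rats_def mono_on_def)
  define s where "s = max 0 t"
  have s: "0 \<le> s" "max 0 s = s" by (auto simp: s_def)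
  have rs: "reg \<psi> t = reg \<psi> s" by (simp add: reg_def s_def)
  have "\<psi> s \<le> reg \<psi> s"
  proof -
    have "\<psi> s \<le> (INF q\<in>{q\<in>\<rat>. max 0 s < q}. \<psi> q)"
      by (rule cINF_greatest[OF rats_above_nonempty]) (use s mono in \<open>auto simp: mono_on_def\<close>)
    then show ?thesis using inc by (simp only: reg_def if_True)
  qed
  moreover have "\<not> \<psi> s < reg \<psi> s"
  proof
    assume lt: "\<psi> s < reg \<psi> s"
    have "(\<psi> \<longlongrightarrow> \<psi> s) (at_right s)" using rc[OF s(1)] by (simp add: continuous_within)
    from order_tendstoD(2)[OF this lt] obtain b where b: "s < b" "\<And>y. s < y \<Longrightarrow> y < b \<Longrightarrow> \<psi> y < reg \<psi> s"
      by (auto simp: eventually_at_right_field)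
    obtain q where q: "q \<in> \<rat>" "s < q" "q < b" using Rats_dense_in_real[OF b(1)] by auto
    then have "\<psi> q < reg \<psi> s" using b(2) by simp
    moreover have "reg \<psi> s \<le> \<psi> q"
    proof -
      have "(INF q\<in>{q\<in>\<rat>. max 0 s < q}. \<psi> q) \<le> \<psi> q"
        by (rule cINF_lower[OF bdd_below_rats_above[OF inc]]) (use q s in auto)
      then show ?thesis using inc by (simp only: reg_def if_True)
    qed
    ultimately show False by simp
  qed
  ultimately show ?thesis using rs s_def by simp
qed

lemma reg_cong: "(\<And>t. 0 \<le> t \<Longrightarrow> \<psi> t = \<phi> t) \<Longrightarrow> reg \<psi> t = reg \<phi> t"
proof -
  assume eq: "\<And>t. 0 \<le> t \<Longrightarrow> \<psi> t = \<phi> t"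
  have "increasing_on_rats \<psi> \<longleftrightarrow> increasing_on_rats \<phi>"
    unfolding increasing_on_rats_def by (intro ball_cong refl) (auto simp: eq)
  moreover have "(INF q\<in>{q\<in>\<rat>. max 0 t < q}. \<psi> q) = (INF q\<in>{q\<in>\<rat>. max 0 t < q}. \<phi> q)"
    by (intro INF_cong refl eq) auto
  ultimately show ?thesis by (simp add: reg_def)
qed

abbreviation (input) paths :: "(real \<Rightarrow> real) measure" where
  "paths \<equiv> PiM {0..} (\<lambda>_. borel)"

lemma reg_measurable[measurable]: "(\<lambda>p. reg (fst p) (snd p)) \<in> borel_measurable (paths \<Otimes>\<^sub>M borel)"
proof -
  have [measurable]: "(\<lambda>p. fst p q) \<in> borel_measurable (paths \<Otimes>\<^sub>M borel)" if "0 \<le> q" for q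
    using that by (intro measurable_compose[OF measurable_fst measurable_component_singleton]) simp
  have inc[measurable]: "Measurable.pred (paths \<Otimes>\<^sub>M borel) (\<lambda>p :: (real \<Rightarrow> real) \<times> real. increasing_on_rats (fst p))"
  proof -
    have "Measurable.pred (paths \<Otimes>\<^sub>M (borel :: real measure)) (\<lambda>z. 0 \<le> p \<longrightarrow> p \<le> q \<longrightarrow> fst z p \<le> fst z q)" for p q
      by (cases "0 \<le> p \<and> p \<le> q") auto
    note pq = this
    have "increasing_on_rats \<psi> \<longleftrightarrow> (\<forall>p q :: rat. 0 \<le> real_of_rat p \<longrightarrow> real_of_rat p \<le> real_of_rat q \<longrightarrow> \<psi> (real_of_rat p) \<le> \<psi> (real_of_rat q))" for \<psi>
      by (auto simp: increasing_on_rats_def Rats_def)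
    then show ?thesis by (simp only:) (intro pred_intros_countable pq)
  qed
  show ?thesis
  proof (subst borel_measurable_iff_less, intro allI)
    fix c :: real
    have "Measurable.pred (paths \<Otimes>\<^sub>M borel) (\<lambda>z. max 0 (snd z) < q \<and> fst z q < c)" for q :: real
    proof (cases "0 \<le> q")
      case False
      then have "(\<lambda>z. max 0 (snd z) < q \<and> fst z q < c) = (\<lambda>z. False)" by (auto simp: fun_eq_iff)
      then show ?thesis by simp
    qed measurable
    note pq = this
    have [measurable]: "Measurable.pred (paths \<Otimes>\<^sub>M borel) (\<lambda>z. \<exists>q\<in>\<rat>. max 0 (snd z) < q \<and> fst z q < c)"
    proof -
      have "(\<exists>q\<in>\<rat>. max 0 (snd z) < q \<and> fst z q < c) \<longleftrightarrow> (\<exists>q :: rat. max 0 (snd z) < real_of_rat q \<and> fst z (real_of_rat q) < c)" for z :: "(real \<Rightarrow> real) \<times> real"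
        by (auto simp: Rats_def)
      then show ?thesis by (simp only:) (intro pred_intros_countable pq)
    qed
    have "reg (fst z) (snd z) < c \<longleftrightarrow> (if increasing_on_rats (fst z) then \<exists>q\<in>\<rat>. max 0 (snd z) < q \<and> fst z q < c else 0 < c)" for z
      using reg_less_iff[of "fst z" "snd z" c] by (auto simp: reg_def)
    moreover have "Measurable.pred (paths \<Otimes>\<^sub>M borel) (\<lambda>z. if increasing_on_rats (fst z) then \<exists>q\<in>\<rat>. max 0 (snd z) < q \<and> fst z q < c else 0 < c)"
      by measurable
    ultimately show "{z \<in> space (paths \<Otimes>\<^sub>M borel). reg (fst z) (snd z) < c} \<in> sets (paths \<Otimes>\<^sub>M borel)"
      by (simp add: pred_def)
  qed
qed

text \<open>For \<open>0 \<le> K\<close> this is the Stieltjes integral of \<open>exp\<close> over \<open>{0<..K}\<close> (\<open>exp_integral_eq\<close>). The form after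
  integration by parts makes joint measurability in \<open>\<psi>\<close> and \<open>K\<close> evident.\<close>

definition exp_integral :: "(real \<Rightarrow> real) \<Rightarrow> real \<Rightarrow> real" where
  "exp_integral \<psi> K = exp K * (reg \<psi> K - reg \<psi> 0) -
     (\<integral>u. indicator {0..K} u * (exp u * (reg \<psi> u - reg \<psi> 0)) \<partial>lborel)"

lemma reg_measurable_compose[measurable (raw)]:
  assumes [measurable]: "f \<in> N \<rightarrow>\<^sub>M paths" "g \<in> borel_measurable N"
  shows "(\<lambda>x. reg (f x) (g x)) \<in> borel_measurable N"
  using measurable_compose[OF measurable_Pair[OF assms] reg_measurable] by simp

lemma exp_integral_measurable[measurable (raw)]:
  assumes [measurable]: "f \<in> N \<rightarrow>\<^sub>M paths" "g \<in> borel_measurable N"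
  shows "(\<lambda>x. exp_integral (f x) (g x)) \<in> borel_measurable N"
proof -
  have "(\<lambda>x. \<integral>u. (if 0 \<le> u \<and> u \<le> g x then exp u * (reg (f x) u - reg (f x) 0) else 0) \<partial>lborel) \<in> borel_measurable N"
    by measurable
  moreover have "(\<integral>u. (if 0 \<le> u \<and> u \<le> g x then exp u * (reg (f x) u - reg (f x) 0) else 0) \<partial>lborel) =
      (\<integral>u. indicator {0..g x} u * (exp u * (reg (f x) u - reg (f x) 0)) \<partial>lborel)" for x
    by (intro Bochner_Integration.integral_cong) (auto simp: indicator_def)
  ultimately have [measurable]: "(\<lambda>x. \<integral>u. indicator {0..g x} u * (exp u * (reg (f x) u - reg (f x) 0)) \<partial>lborel) \<in> borel_measurable N"
    by simp
  show ?thesis unfolding exp_integral_def by measurable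
qed

abbreviation reg_measure :: "(real \<Rightarrow> real) \<Rightarrow> real measure" where
  "reg_measure \<psi> \<equiv> interval_measure (reg \<psi>)"

lemma emeasure_reg: "a \<le> b \<Longrightarrow> emeasure (reg_measure \<psi>) {a<..b} = ennreal (reg \<psi> b - reg \<psi> a)"
  by (intro emeasure_interval_measure_Ioc reg_mono reg_right_continuous)

lemma measure_reg: "a \<le> b \<Longrightarrow> measure (reg_measure \<psi>) {a<..b} = reg \<psi> b - reg \<psi> a"
  by (simp add: measure_def emeasure_reg reg_mono)

lemma emeasure_reg_finite: "emeasure (reg_measure \<psi>) {a<..b} < \<infinity>"
  by (cases "a \<le> b") (auto simp: emeasure_reg)

lemma integrable_reg_exp: "integrable (reg_measure \<psi>) (\<lambda>x. indicator {a<..b} x * exp (x - c))"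
proof (rule Bochner_Integration.integrable_bound)
  show "integrable (reg_measure \<psi>) (\<lambda>x. indicator {a<..b} x * exp (b - c))"
    using emeasure_reg_finite[of \<psi> a b] by (intro integrable_mult_left integrable_real_indicator) auto
  show "AE x in reg_measure \<psi>. norm (indicator {a<..b} x * exp (x - c)) \<le> norm (indicator {a<..b} x * exp (b - c))"
    by (intro AE_I2) (auto simp: indicator_def)
qed simp

lemma exp_integral_eq:
  assumes K: "0 \<le> K"
  shows "exp_integral \<psi> K = (\<integral>x. indicator {0<..K} x * exp x \<partial>reg_measure \<psi>)"
proof -
  have i1: "integrable (reg_measure \<psi>) (indicator {0<..K} :: real \<Rightarrow> real)"
    using emeasure_reg_finite[of \<psi> 0 K] by (intro integrable_real_indicator) auto
  have i2: "integrable (reg_measure \<psi>) (\<lambda>x. indicator {0<..K} x * exp x)"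
    using integrable_reg_exp[of \<psi> 0 K 0] by simp
  have "(\<integral>u. indicator {0..K} u * (exp u * (\<integral>x. indicator {0<..u} x * 1 \<partial>reg_measure \<psi>)) \<partial>lborel) =
      (\<integral>x. indicator {0<..K} x * (1 * (exp K - exp x)) \<partial>reg_measure \<psi>)"
    by (rule stieltjes_by_parts(2)[where B="exp K"])
       (use K emeasure_reg_finite in \<open>auto intro!: derivative_eq_intros continuous_intros\<close>)
  also have "\<dots> = (\<integral>x. exp K * indicator {0<..K} x - indicator {0<..K} x * exp x \<partial>reg_measure \<psi>)"
    by (intro Bochner_Integration.integral_cong) (auto simp: algebra_simps)
  also have "\<dots> = exp K * (reg \<psi> K - reg \<psi> 0) - (\<integral>x. indicator {0<..K} x * exp x \<partial>reg_measure \<psi>)"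
    using K i1 i2 by (subst Bochner_Integration.integral_diff) (auto simp: measure_reg)
  finally have "(\<integral>x. indicator {0<..K} x * exp x \<partial>reg_measure \<psi>) = exp K * (reg \<psi> K - reg \<psi> 0) -
     (\<integral>u. indicator {0..K} u * (exp u * (\<integral>x. indicator {0<..u} x * 1 \<partial>reg_measure \<psi>)) \<partial>lborel)" by simp
  also have "(\<integral>u. indicator {0..K} u * (exp u * (\<integral>x. indicator {0<..u} x * 1 \<partial>reg_measure \<psi>)) \<partial>lborel) =
      (\<integral>u. indicator {0..K} u * (exp u * (reg \<psi> u - reg \<psi> 0)) \<partial>lborel)"
    by (intro Bochner_Integration.integral_cong refl)
       (simp add: indicator_def[of "{0..K}"] measure_reg)
  finally show ?thesis by (simp add: exp_integral_def)
qed

lemma exp_integral_diff: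
  assumes "0 \<le> a" "a \<le> b"
  shows "exp (- b) * (exp_integral \<psi> b - exp_integral \<psi> a) = (\<integral>x. indicator {a<..b} x * exp (x - b) \<partial>reg_measure \<psi>)"
proof -
  have i: "integrable (reg_measure \<psi>) (\<lambda>x. indicator {p<..q} x * exp x)" for p q
    using integrable_reg_exp[of \<psi> p q 0] by simp
  have "exp_integral \<psi> b - exp_integral \<psi> a = (\<integral>x. indicator {0<..b} x * exp x - indicator {0<..a} x * exp x \<partial>reg_measure \<psi>)"
    using assms i by (simp add: exp_integral_eq)
  also have "\<dots> = (\<integral>x. exp b * (indicator {a<..b} x * exp (x - b)) \<partial>reg_measure \<psi>)"
    using assms by (intro Bochner_Integration.integral_cong) (auto simp: indicator_def simp flip: exp_add)
  finally show ?thesis by (simp add: exp_minus)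
qed

lemma integral_exp_Icc:
  fixes K :: real
  shows "0 \<le> K \<Longrightarrow> (\<integral>u. indicator {0..K} u * exp (- u) \<partial>lborel) = 1 - exp (- K)"
proof -
  assume K: "0 \<le> K"
  have "(\<integral>u. exp (- u) * indicator {0..K} u \<partial>lborel) = - exp (- K) - (- exp (- 0))"
    by (rule integral_FTC_Icc_real[OF K]) (auto intro!: derivative_eq_intros)
  then show ?thesis by (simp add: mult.commute)
qed

text \<open>The integrated form of \<open>dv = - lam * v dt + dG(lam * t)\<close>: substitute \<open>u = lam * s\<close> and integrate by
  parts.\<close>

lemma int_ou_eq:
  assumes lam: "0 < lam" and t: "0 \<le> t"
    and reg: "\<And>s. reg (\<lambda>t\<in>{0..}. G t w) s = G (max 0 s) w"
  defines "\<psi> \<equiv> (\<lambda>t\<in>{0..}. G t w)"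
  shows "lam * int_ou lam G v0 t w = v0 w * (1 - exp (- (lam * t))) +
    (reg \<psi> (lam * t) - reg \<psi> 0) - exp (- (lam * t)) * exp_integral \<psi> (lam * t)"
proof -
  define K where "K = lam * t"
  have K: "0 \<le> K" using lam t by (simp add: K_def)
  define J where "J u = (\<integral>x. indicator {0<..u} x * exp x \<partial>reg_measure \<psi>)" for u
  have G: "(\<lambda>s. G (max 0 s) w) = reg \<psi>" using reg by (simp add: \<psi>_def fun_eq_iff)
  have ou: "ou_process lam G v0 s w = exp (- (lam * s)) * (v0 w + J (lam * s))" for s
    using lam by (simp add: ou_process_def sub_integral_def G J_def set_lebesgue_integral_def distrib_left)
  have i1: "integrable (reg_measure \<psi>) (indicator {0<..K} :: real \<Rightarrow> real)"
    using emeasure_reg_finite[of \<psi> 0 K] by (intro integrable_real_indicator) auto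
  have i2: "integrable (reg_measure \<psi>) (\<lambda>x. indicator {0<..K} x * exp x)"
    using integrable_reg_exp[of \<psi> 0 K 0] by simp
  have part: "integrable lborel (\<lambda>u. indicator {0..K} u * (exp (- u) * J u))"
      "(\<integral>u. indicator {0..K} u * (exp (- u) * J u) \<partial>lborel) =
      (\<integral>x. indicator {0<..K} x * (exp x * (- exp (- K) - (- exp (- x)))) \<partial>reg_measure \<psi>)"
    unfolding J_def
  proof -
    have b: "\<bar>exp (- u) * exp x\<bar> \<le> exp K" if "u \<in> {0..K}" "x \<in> {0<..K}" for u x
      using that by (auto simp flip: exp_add)
    note bp = stieltjes_by_parts[of "reg_measure \<psi>" K "\<lambda>u. - exp (- u)" "\<lambda>u. exp (- u)" exp, OF _ _ K _ _ _ _ b]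
    show "integrable lborel (\<lambda>u. indicator {0..K} u * (exp (- u) * (\<integral>x. indicator {0<..u} x * exp x \<partial>reg_measure \<psi>)))"
      by (rule bp(1)) (use emeasure_reg_finite in \<open>auto intro!: derivative_eq_intros continuous_intros\<close>)
    show "(\<integral>u. indicator {0..K} u * (exp (- u) * (\<integral>x. indicator {0<..u} x * exp x \<partial>reg_measure \<psi>)) \<partial>lborel) =
      (\<integral>x. indicator {0<..K} x * (exp x * (- exp (- K) - (- exp (- x)))) \<partial>reg_measure \<psi>)"
      by (rule bp(2)) (use emeasure_reg_finite in \<open>auto intro!: derivative_eq_intros continuous_intros\<close>)
  qed
  have "(\<integral>x. indicator {0<..K} x * (exp x * (- exp (- K) - (- exp (- x)))) \<partial>reg_measure \<psi>) =
      (\<integral>x. indicator {0<..K} x - exp (- K) * (indicator {0<..K} x * exp x) \<partial>reg_measure \<psi>)"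
    by (intro Bochner_Integration.integral_cong refl) (simp add: algebra_simps flip: exp_add)
  also have "\<dots> = (reg \<psi> K - reg \<psi> 0) - exp (- K) * J K"
    using K i1 i2 by (subst Bochner_Integration.integral_diff)
      (auto simp: measure_reg J_def)
  finally have part2: "(\<integral>u. indicator {0..K} u * (exp (- u) * J u) \<partial>lborel) = (reg \<psi> K - reg \<psi> 0) - exp (- K) * J K"
    using part(2) by simp
  have iv: "integrable lborel (\<lambda>u. indicator {0..K} u * exp (- u))"
  proof -
    have "continuous_on {0..K} (\<lambda>u. exp (- u))" by (intro continuous_intros)
    from borel_integrable_atLeastAtMost'[OF this] show ?thesis by (simp add: set_integrable_def)
  qed
  define H where "H u = indicator {0..K} u * (exp (- u) * (v0 w + J u))" for u
  have "(\<integral>u. H u \<partial>lborel) = (\<integral>u. v0 w * (indicator {0..K} u * exp (- u)) + indicator {0..K} u * (exp (- u) * J u) \<partial>lborel)"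
    unfolding H_def by (intro Bochner_Integration.integral_cong refl) (simp add: algebra_simps)
  also have "\<dots> = v0 w * (1 - exp (- K)) + ((reg \<psi> K - reg \<psi> 0) - exp (- K) * J K)"
    using iv part(1) by (subst Bochner_Integration.integral_add) (auto simp: integral_exp_Icc K part2)
  finally have H: "(\<integral>u. H u \<partial>lborel) = v0 w * (1 - exp (- K)) + ((reg \<psi> K - reg \<psi> 0) - exp (- K) * J K)" .
  have "(\<integral>u. H u \<partial>lborel) = \<bar>lam\<bar> *\<^sub>R (\<integral>s. H (0 + lam * s) \<partial>lborel)"
    using lam by (intro lborel_integral_real_affine) simp
  also have "(\<integral>s. H (0 + lam * s) \<partial>lborel) = int_ou lam G v0 t w"
    unfolding int_ou_def set_lebesgue_integral_def ou H_def
    using lam by (intro Bochner_Integration.integral_cong refl) (auto simp: indicator_def K_def zero_le_mult_iff)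
  finally show ?thesis using H lam exp_integral_eq[OF K, of \<psi>] by (simp add: J_def K_def)
qed

section \<open>Conditioning by freezing independent variables\<close>

lemma (in prob_space) indep_rv_prob:
  assumes "indep_rv M N X N' Y" "A \<in> sets N" "B \<in> sets N'"
  shows "prob {w \<in> space M. X w \<in> A \<and> Y w \<in> B} = prob {w \<in> space M. X w \<in> A} * prob {w \<in> space M. Y w \<in> B}"
proof -
  have "indep_set {X -` A \<inter> space M | A. A \<in> sets N} {Y -` B \<inter> space M | B. B \<in> sets N'}"
    using assms(1) by (simp add: indep_rv_def)
  then have "prob ((X -` A \<inter> space M) \<inter> (Y -` B \<inter> space M)) = prob (X -` A \<inter> space M) * prob (Y -` B \<inter> space M)"
    using assms(2,3) by (intro indep_setD) auto
  moreover have "(X -` A \<inter> space M) \<inter> (Y -` B \<inter> space M) = {w \<in> space M. X w \<in> A \<and> Y w \<in> B}"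
    "X -` A \<inter> space M = {w \<in> space M. X w \<in> A}" "Y -` B \<inter> space M = {w \<in> space M. Y w \<in> B}" by auto
  ultimately show ?thesis by simp
qed

lemma (in prob_space) indep_rvI:
  assumes X: "X \<in> M \<rightarrow>\<^sub>M N" and Y: "Y \<in> M \<rightarrow>\<^sub>M N'"
    and eq: "\<And>A B. A \<in> sets N \<Longrightarrow> B \<in> sets N' \<Longrightarrow>
      prob {w \<in> space M. X w \<in> A \<and> Y w \<in> B} = prob {w \<in> space M. X w \<in> A} * prob {w \<in> space M. Y w \<in> B}"
  shows "indep_rv M N X N' Y"
  unfolding indep_rv_def indep_sets2_eq
proof (intro conjI X Y ballI)
  show "{X -` A \<inter> space M |A. A \<in> sets N} \<subseteq> events" "{Y -` B \<inter> space M |B. B \<in> sets N'} \<subseteq> events"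
    using measurable_sets[OF X] measurable_sets[OF Y] by auto
  fix a b assume "a \<in> {X -` A \<inter> space M |A. A \<in> sets N}" "b \<in> {Y -` B \<inter> space M |B. B \<in> sets N'}"
  then obtain A B where ab: "a = X -` A \<inter> space M" "A \<in> sets N" "b = Y -` B \<inter> space M" "B \<in> sets N'" by auto
  have "a = {w \<in> space M. X w \<in> A}" "b = {w \<in> space M. Y w \<in> B}" "a \<inter> b = {w \<in> space M. X w \<in> A \<and> Y w \<in> B}"
    using ab by auto
  then show "prob (a \<inter> b) = prob a * prob b" using eq[OF ab(2,4)] by simp
qed

lemma (in prob_space) indep_rv_compose:
  assumes I: "indep_rv M N X N' Y" and f: "f \<in> N \<rightarrow>\<^sub>M K" and g: "g \<in> N' \<rightarrow>\<^sub>M K'"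
  shows "indep_rv M K (\<lambda>w. f (X w)) K' (\<lambda>w. g (Y w))"
proof (rule indep_rvI)
  have X: "X \<in> M \<rightarrow>\<^sub>M N" and Y: "Y \<in> M \<rightarrow>\<^sub>M N'" using I by (auto simp: indep_rv_def)
  show "(\<lambda>w. f (X w)) \<in> M \<rightarrow>\<^sub>M K" "(\<lambda>w. g (Y w)) \<in> M \<rightarrow>\<^sub>M K'"
    using X Y f g by (auto intro: measurable_compose)
  fix A B assume A: "A \<in> sets K" and B: "B \<in> sets K'"
  have "f (X w) \<in> A \<longleftrightarrow> X w \<in> f -` A \<inter> space N" "g (Y w) \<in> B \<longleftrightarrow> Y w \<in> g -` B \<inter> space N'" if "w \<in> space M" for w
    using measurable_space[OF X that] measurable_space[OF Y that] by auto
  then show "prob {w \<in> space M. f (X w) \<in> A \<and> g (Y w) \<in> B} = prob {w \<in> space M. f (X w) \<in> A} * prob {w \<in> space M. g (Y w) \<in> B}"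
    using indep_rv_prob[OF I measurable_sets[OF f A] measurable_sets[OF g B]] by (simp cong: conj_cong)
qed

lemma Int_stable_vimages: "Int_stable {X -` A \<inter> \<Omega> | A. A \<in> sets N}"
proof (rule Int_stableI)
  fix a b assume "a \<in> {X -` A \<inter> \<Omega> | A. A \<in> sets N}" "b \<in> {X -` A \<inter> \<Omega> | A. A \<in> sets N}"
  then obtain A B where "a = X -` A \<inter> \<Omega>" "b = X -` B \<inter> \<Omega>" "A \<in> sets N" "B \<in> sets N" by auto
  then show "a \<inter> b \<in> {X -` A \<inter> \<Omega> | A. A \<in> sets N}"
    by (intro CollectI exI[of _ "A \<inter> B"]) auto
qed

lemma (in prob_space) indep_rv_integral_mult:
  fixes X Y :: "'a \<Rightarrow> real"
  assumes I: "indep_rv M borel X borel Y" and "integrable M X" "integrable M Y"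
  shows "(\<integral>w. X w * Y w \<partial>M) = (\<integral>w. X w \<partial>M) * (\<integral>w. Y w \<partial>M)"
proof (rule indep_var_lebesgue_integral)
  show "indep_var borel X borel Y"
    unfolding indep_var_eq
  proof (intro conjI indep_set_sigma_sets Int_stable_vimages)
  qed (use I in \<open>auto simp: indep_rv_def\<close>)
qed fact+

text \<open>Fubini for the joint law of \<open>X\<close> and \<open>Y\<close>, which is the product of their laws.\<close>

lemma (in prob_space) freezing:
  assumes I: "indep_rv M N X N' Y" and C: "C \<in> sets (N \<Otimes>\<^sub>M N')"
  shows "(\<lambda>y. prob {w \<in> space M. (X w, y) \<in> C}) \<in> borel_measurable N'"
    and "prob {w \<in> space M. (X w, Y w) \<in> C} = (\<integral>w. prob {w' \<in> space M. (X w', Y w) \<in> C} \<partial>M)"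
proof -
  have X[measurable]: "X \<in> M \<rightarrow>\<^sub>M N" and Y[measurable]: "Y \<in> M \<rightarrow>\<^sub>M N'" using I by (auto simp: indep_rv_def)
  interpret X: prob_space "distr M N X" by (rule prob_space_distr) fact
  interpret Y: prob_space "distr M N' Y" by (rule prob_space_distr) fact
  interpret XY: pair_sigma_finite "distr M N X" "distr M N' Y" ..
  have C': "C \<in> sets (distr M N X \<Otimes>\<^sub>M distr M N' Y)"
    using C by (simp cong: sets_pair_measure_cong)
  have sec: "(\<lambda>x. (x, y)) -` C \<in> sets N" for y by (rule sets_Pair2[OF C])
  have k: "emeasure (distr M N X) ((\<lambda>x. (x, y)) -` C) = ennreal (prob {w \<in> space M. (X w, y) \<in> C})" for y
  proof -
    have "X -` ((\<lambda>x. (x, y)) -` C) \<inter> space M = {w \<in> space M. (X w, y) \<in> C}" by auto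
    then show ?thesis using sec[of y] by (simp add: emeasure_distr emeasure_eq_measure)
  qed
  have "(\<lambda>y. emeasure (distr M N X) ((\<lambda>x. (x, y)) -` C)) \<in> borel_measurable N'"
    using XY.measurable_emeasure_Pair2[OF C'] by simp
  then have "(\<lambda>y. enn2real (ennreal (prob {w \<in> space M. (X w, y) \<in> C}))) \<in> borel_measurable N'"
    unfolding k by measurable
  then show km[measurable]: "(\<lambda>y. prob {w \<in> space M. (X w, y) \<in> C}) \<in> borel_measurable N'" by simp
  have prod: "distr M N X \<Otimes>\<^sub>M distr M N' Y = distr M (N \<Otimes>\<^sub>M N') (\<lambda>w. (X w, Y w))"
  proof (rule pair_measure_eqI)
    fix A B assume "A \<in> sets (distr M N X)" "B \<in> sets (distr M N' Y)"
    then have AB: "A \<in> sets N" "B \<in> sets N'" by auto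
    have "emeasure (distr M (N \<Otimes>\<^sub>M N') (\<lambda>w. (X w, Y w))) (A \<times> B) = emeasure M {w \<in> space M. X w \<in> A \<and> Y w \<in> B}"
      using AB by (subst emeasure_distr) (auto intro!: arg_cong[where f="emeasure M"])
    moreover have "X -` A \<inter> space M = {w \<in> space M. X w \<in> A}" "Y -` B \<inter> space M = {w \<in> space M. Y w \<in> B}" by auto
    ultimately show "emeasure (distr M N X) A * emeasure (distr M N' Y) B = emeasure (distr M (N \<Otimes>\<^sub>M N') (\<lambda>w. (X w, Y w))) (A \<times> B)"
      using AB indep_rv_prob[OF I AB] by (simp add: emeasure_distr emeasure_eq_measure ennreal_mult)
  qed (auto intro: X.sigma_finite_measure_axioms Y.sigma_finite_measure_axioms)
  have "ennreal (prob {w \<in> space M. (X w, Y w) \<in> C}) = emeasure (distr M (N \<Otimes>\<^sub>M N') (\<lambda>w. (X w, Y w))) C"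
    using C by (subst emeasure_distr) (auto simp: emeasure_eq_measure[symmetric] intro!: arg_cong[where f="emeasure M"])
  also have "\<dots> = (\<integral>\<^sup>+y. emeasure (distr M N X) ((\<lambda>x. (x, y)) -` C) \<partial>distr M N' Y)"
    unfolding prod[symmetric] by (rule XY.emeasure_pair_measure_alt2[OF C'])
  also have "\<dots> = (\<integral>\<^sup>+w. ennreal (prob {w' \<in> space M. (X w', Y w) \<in> C}) \<partial>M)"
    unfolding k by (rule nn_integral_distr) auto
  also have "\<dots> = ennreal (\<integral>w. prob {w' \<in> space M. (X w', Y w) \<in> C} \<partial>M)"
    by (rule nn_integral_eq_integral) (auto intro!: integrable_const_bound[where B=1] measurable_compose[OF Y km])
  finally show "prob {w \<in> space M. (X w, Y w) \<in> C} = (\<integral>w. prob {w' \<in> space M. (X w', Y w) \<in> C} \<partial>M)"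
    by (simp add: integral_nonneg)
qed

lemma (in prob_space) freezing_cond:
  assumes I: "indep_rv M N X (N1 \<Otimes>\<^sub>M N2) (\<lambda>w. (U w, V w))"
    and C: "C \<in> sets (N \<Otimes>\<^sub>M N2)" and B: "B \<in> sets N1" and B': "B' \<in> sets N2"
  shows "prob {w \<in> space M. (X w, V w) \<in> C \<and> U w \<in> B \<and> V w \<in> B'} =
    (\<integral>w. indicator B' (V w) * (prob {w' \<in> space M. (X w', V w) \<in> C} * indicator B (U w)) \<partial>M)"
proof -
  have X[measurable]: "X \<in> M \<rightarrow>\<^sub>M N" and UV: "(\<lambda>w. (U w, V w)) \<in> M \<rightarrow>\<^sub>M N1 \<Otimes>\<^sub>M N2" using I by (auto simp: indep_rv_def)
  define C' where "C' = {p \<in> space (N \<Otimes>\<^sub>M (N1 \<Otimes>\<^sub>M N2)). (fst p, snd (snd p)) \<in> C \<and> fst (snd p) \<in> B \<and> snd (snd p) \<in> B'}"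
  have C': "C' \<in> sets (N \<Otimes>\<^sub>M (N1 \<Otimes>\<^sub>M N2))" unfolding C'_def using C B B' by measurable
  have UVs: "(U w, V w) \<in> space (N1 \<Otimes>\<^sub>M N2)" "X w \<in> space N" if "w \<in> space M" for w
    using measurable_space[OF UV that] measurable_space[OF X that] by auto
  have "{w \<in> space M. (X w, V w) \<in> C \<and> U w \<in> B \<and> V w \<in> B'} = {w \<in> space M. (X w, (U w, V w)) \<in> C'}"
    using UVs by (auto simp: C'_def space_pair_measure)
  then have "prob {w \<in> space M. (X w, V w) \<in> C \<and> U w \<in> B \<and> V w \<in> B'} = (\<integral>w. prob {w' \<in> space M. (X w', (U w, V w)) \<in> C'} \<partial>M)"
    using freezing(2)[OF I C'] by simp
  also have "\<dots> = (\<integral>w. indicator B' (V w) * (prob {w' \<in> space M. (X w', V w) \<in> C} * indicator B (U w)) \<partial>M)"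
  proof (rule Bochner_Integration.integral_cong[OF refl])
    fix w assume w: "w \<in> space M"
    have eq: "{w' \<in> space M. (X w', (U w, V w)) \<in> C'} = (if U w \<in> B \<and> V w \<in> B' then {w' \<in> space M. (X w', V w) \<in> C} else {})"
      using UVs w by (auto simp: C'_def space_pair_measure)
    show "prob {w' \<in> space M. (X w', (U w, V w)) \<in> C'} = indicator B' (V w) * (prob {w' \<in> space M. (X w', V w) \<in> C} * indicator B (U w))"
      unfolding eq by (cases "U w \<in> B"; cases "V w \<in> B'") simp_all
  qed
  finally show ?thesis .
qed

text \<open>Here \<open>X\<close> is independent of \<open>(U, V)\<close> jointly, while \<open>U\<close> and \<open>V\<close> may depend on each other:
  given \<open>V\<close>, the variable \<open>X\<close> keeps its law and is independent of \<open>U\<close>.\<close>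

lemma (in prob_space) prob_given_freezing:
  assumes I: "indep_rv M N X (N1 \<Otimes>\<^sub>M N2) (\<lambda>w. (U w, V w))"
    and C: "C \<in> sets (N \<Otimes>\<^sub>M N2)" and B[measurable]: "B \<in> sets N1"
  defines "F \<equiv> vimage_algebra (space M) V N2"
  shows "AE w in M. prob_given M F {w \<in> space M. (X w, V w) \<in> C \<and> U w \<in> B} w =
      prob {w' \<in> space M. (X w', V w) \<in> C} * prob_given M F {w \<in> space M. U w \<in> B} w"
    and "AE w in M. prob_given M F {w \<in> space M. (X w, V w) \<in> C} w = prob {w' \<in> space M. (X w', V w) \<in> C}"
proof -
  have X[measurable]: "X \<in> M \<rightarrow>\<^sub>M N" and UV: "(\<lambda>w. (U w, V w)) \<in> M \<rightarrow>\<^sub>M N1 \<Otimes>\<^sub>M N2" using I by (auto simp: indep_rv_def)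
  have U[measurable]: "U \<in> M \<rightarrow>\<^sub>M N1" and V[measurable]: "V \<in> M \<rightarrow>\<^sub>M N2"
    using measurable_compose[OF UV measurable_fst] measurable_compose[OF UV measurable_snd] by auto
  have VF: "V \<in> F \<rightarrow>\<^sub>M N2"
    unfolding F_def using measurable_space[OF V] by (intro measurable_vimage_algebra1) auto
  have setsF: "sets F = {V -` A \<inter> space M | A. A \<in> sets N2}"
    unfolding F_def using measurable_space[OF V] by (intro sets_vimage_algebra2) auto
  have sub: "subalgebra M F"
    unfolding subalgebra_def using setsF measurable_sets[OF V] by (auto simp: F_def)
  interpret F: finite_measure_subalgebra M F using sub by unfold_locales
  define k where "k y = prob {w' \<in> space M. (X w', y) \<in> C}" for y
  have IV: "indep_rv M N X N2 V"
    using indep_rv_compose[OF I measurable_ident measurable_snd] by simp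
  have k[measurable]: "k \<in> borel_measurable N2"
    unfolding k_def by (rule freezing(1)[OF IV C])
  have kF: "(\<lambda>w. k (V w)) \<in> borel_measurable F" by (rule measurable_compose[OF VF k])
  have k01: "0 \<le> k y" "k y \<le> 1" for y by (auto simp: k_def)
  have C2[measurable]: "{w \<in> space M. (X w, V w) \<in> C} \<in> events"
    using measurable_sets[OF measurable_Pair[OF X V] C] by (simp add: vimage_def Int_def conj_commute)
  have key: "AE w in M. prob_given M F {w \<in> space M. (X w, V w) \<in> C \<and> U w \<in> B} w = real_cond_exp M F (\<lambda>w. k (V w) * indicator B (U w)) w"
    if B[measurable]: "B \<in> sets N1" for B
    unfolding prob_given_def
  proof (rule F.real_cond_exp_charact)
    have ig: "integrable M (\<lambda>w. k (V w) * indicator B (U w))"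
      by (rule integrable_const_bound[where B=1]) (use k01 in \<open>auto simp: indicator_def\<close>)
    have E[measurable]: "{w \<in> space M. (X w, V w) \<in> C \<and> U w \<in> B} \<in> events"
    proof -
      have "{w \<in> space M. (X w, V w) \<in> C \<and> U w \<in> B} = {w \<in> space M. (X w, V w) \<in> C} \<inter> {w \<in> space M. U w \<in> B}" by auto
      then show ?thesis by simp
    qed
    then show "integrable M (indicator {w \<in> space M. (X w, V w) \<in> C \<and> U w \<in> B} :: 'a \<Rightarrow> real)"
      by (intro integrable_real_indicator) (auto simp: less_top[symmetric])
    show "integrable M (real_cond_exp M F (\<lambda>w. k (V w) * indicator B (U w)))"
      by (rule F.real_cond_exp_int(1)[OF ig])
    show "real_cond_exp M F (\<lambda>w. k (V w) * indicator B (U w)) \<in> borel_measurable F" by simp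
    fix A assume A: "A \<in> sets F"
    then obtain B' where B': "A = V -` B' \<inter> space M" "B' \<in> sets N2" using setsF by auto
    have [measurable]: "A \<in> events" using A sub by (auto simp: subalgebra_def)
    have "(\<integral>w\<in>A. indicator {w \<in> space M. (X w, V w) \<in> C \<and> U w \<in> B} w \<partial>M) =
       (\<integral>w. (indicator {w \<in> space M. (X w, V w) \<in> C \<and> U w \<in> B \<and> V w \<in> B'} w :: real) \<partial>M)"
      unfolding set_lebesgue_integral_def by (intro Bochner_Integration.integral_cong) (auto simp: indicator_def B'(1))
    also have "\<dots> = prob {w \<in> space M. (X w, V w) \<in> C \<and> U w \<in> B \<and> V w \<in> B'}"
      by (simp add: Int_absorb2)
    also have "\<dots> = (\<integral>w. indicator B' (V w) * (k (V w) * indicator B (U w)) \<partial>M)"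
      unfolding k_def by (rule freezing_cond[OF I C B B'(2)])
    also have "\<dots> = (\<integral>w\<in>A. k (V w) * indicator B (U w) \<partial>M)"
      unfolding set_lebesgue_integral_def by (intro Bochner_Integration.integral_cong) (auto simp: indicator_def B'(1))
    also have "\<dots> = (\<integral>w\<in>A. real_cond_exp M F (\<lambda>w. k (V w) * indicator B (U w)) w \<partial>M)"
      by (rule F.real_cond_exp_intA[OF ig A])
    finally show "(\<integral>w\<in>A. indicator {w \<in> space M. (X w, V w) \<in> C \<and> U w \<in> B} w \<partial>M) =
       (\<integral>w\<in>A. real_cond_exp M F (\<lambda>w. k (V w) * indicator B (U w)) w \<partial>M)" .
  qed
  have mult: "AE w in M. real_cond_exp M F (\<lambda>w. k (V w) * indicator {w \<in> space M. U w \<in> B} w) w =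
      k (V w) * real_cond_exp M F (indicator {w \<in> space M. U w \<in> B}) w"
    by (rule F.real_cond_exp_mult[OF kF])
       (auto intro!: integrable_const_bound[where B=1] simp: k01 indicator_def)
  have cong: "AE w in M. real_cond_exp M F (\<lambda>w. k (V w) * indicator B (U w)) w =
      real_cond_exp M F (\<lambda>w. k (V w) * indicator {w \<in> space M. U w \<in> B} w) w"
    by (rule F.real_cond_exp_cong) (auto simp: indicator_def)
  show "AE w in M. prob_given M F {w \<in> space M. (X w, V w) \<in> C \<and> U w \<in> B} w =
      prob {w' \<in> space M. (X w', V w) \<in> C} * prob_given M F {w \<in> space M. U w \<in> B} w"
    using key[OF B] mult cong unfolding prob_given_def k_def by eventually_elim simp
  have Us: "U w \<in> space N1" if "w \<in> space M" for w using measurable_space[OF U that] .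
  have "AE w in M. real_cond_exp M F (\<lambda>w. k (V w) * indicator (space N1) (U w)) w = real_cond_exp M F (\<lambda>w. k (V w)) w"
    by (rule F.real_cond_exp_cong) (auto simp: indicator_def Us)
  moreover have "AE w in M. real_cond_exp M F (\<lambda>w. k (V w)) w = k (V w)"
    by (rule F.real_cond_exp_F_meas[OF _ kF]) (auto intro!: integrable_const_bound[where B=1] simp: k01)
  moreover have "{w \<in> space M. (X w, V w) \<in> C \<and> U w \<in> space N1} = {w \<in> space M. (X w, V w) \<in> C}" using Us by auto
  ultimately show "AE w in M. prob_given M F {w \<in> space M. (X w, V w) \<in> C} w = prob {w' \<in> space M. (X w', V w) \<in> C}"
    using key[OF sets.top] unfolding k_def by auto
qed

lemma (in prob_space) indep_vars_cong_AE:
  assumes I: "indep_vars M' X I" "finite I" and Y: "\<And>i. i \<in> I \<Longrightarrow> Y i \<in> M \<rightarrow>\<^sub>M M' i"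
    and eq: "\<And>i. i \<in> I \<Longrightarrow> AE w in M. X i w = Y i w"
  shows "indep_vars M' Y I"
proof (cases "I = {}")
  case True then show ?thesis by (simp add: indep_vars_def indep_sets_def)
next
  case False
  have X: "X i \<in> M \<rightarrow>\<^sub>M M' i" if "i \<in> I" for i using I(1) that by (simp add: indep_vars_def)
  have "distr M (\<Pi>\<^sub>M i\<in>I. M' i) (\<lambda>x. \<lambda>i\<in>I. Y i x) = distr M (\<Pi>\<^sub>M i\<in>I. M' i) (\<lambda>x. \<lambda>i\<in>I. X i x)"
  proof (rule distr_cong_AE)
    have "AE w in M. \<forall>i\<in>I. X i w = Y i w" using eq I(2) by (intro AE_finite_allI)
    then show "AE w in M. (\<lambda>i\<in>I. Y i w) = (\<lambda>i\<in>I. X i w)" by eventually_elim auto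
  qed (use X Y in \<open>auto intro!: measurable_restrict\<close>)
  also have "\<dots> = (\<Pi>\<^sub>M i\<in>I. distr M (M' i) (X i))"
    using I(1) indep_vars_iff_distr_eq_PiM'[OF False X] by simp
  also have "\<dots> = (\<Pi>\<^sub>M i\<in>I. distr M (M' i) (Y i))"
    using X Y eq by (intro PiM_cong refl distr_cong_AE) auto
  finally show ?thesis using indep_vars_iff_distr_eq_PiM'[OF False Y] by simp
qed

lemma reg_path_eq:
  assumes "subordinator M G"
  shows "AE w in M. \<forall>s. reg (\<lambda>t\<in>{0..}. G t w) s = G (max 0 s) w"
proof -
  have "AE w in M. mono_on {0..} (\<lambda>t. G t w) \<and> (\<forall>t\<ge>0. continuous (at_right t) (\<lambda>s. G s w))"
    using assms by (simp add: subordinator_def)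
  then show ?thesis
  proof eventually_elim
    case (elim w)
    have "reg (\<lambda>t\<in>{0..}. G t w) s = reg (\<lambda>t. G t w) s" for s by (rule reg_cong) simp
    also have "reg (\<lambda>t. G t w) s = G (max 0 s) w" for s using elim by (intro reg_eq) auto
    finally show ?case by simp
  qed
qed

lemma gamma_process_paths:
  assumes GP: "gamma_process M \<theta> G" and \<theta>: "0 < \<theta>"
    and path[measurable]: "(\<lambda>w. \<lambda>t\<in>{0..}. G t w) \<in> M \<rightarrow>\<^sub>M paths"
  shows "gamma_paths M \<theta> (\<lambda>w. reg (\<lambda>t\<in>{0..}. G t w))"
proof -
  have S: "subordinator M G" using GP by (simp add: gamma_process_def)
  interpret prob_space M using S by (simp add: subordinator_def)
  have G[measurable]: "G t \<in> borel_measurable M" if "0 \<le> t" for t using S that by (simp add: subordinator_def)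
  have AEt: "AE w in M. reg (\<lambda>t\<in>{0..}. G t w) t = G t w" if "0 \<le> t" for t
    using reg_path_eq[OF S] by eventually_elim (use that in simp)
  have m[measurable]: "(\<lambda>w. reg (\<lambda>t\<in>{0..}. G t w) t) \<in> borel_measurable M" for t by measurable
  show ?thesis
  proof
    fix k :: nat and t :: "nat \<Rightarrow> real"
    assume t: "0 \<le> t 0" "\<And>i. i < k \<Longrightarrow> t i \<le> t (Suc i)"
    have t0: "0 \<le> t i" if "i \<le> k" for i
      using that t by (induction i) (auto intro: order_trans)
    have "indep_vars (\<lambda>_. borel) (\<lambda>i w. G (t (Suc i)) w - G (t i) w) {..<k}"
      using S t by (simp add: subordinator_def)
    then show "indep_vars (\<lambda>_. borel) (\<lambda>i w. reg (\<lambda>t\<in>{0..}. G t w) (t (Suc i)) - reg (\<lambda>t\<in>{0..}. G t w) (t i)) {..<k}"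
    proof (rule indep_vars_cong_AE)
      fix i assume "i \<in> {..<k}"
      then have "0 \<le> t i" "0 \<le> t (Suc i)" using t0 by auto
      from AEt[OF this(1)] AEt[OF this(2)]
      show "AE w in M. G (t (Suc i)) w - G (t i) w = reg (\<lambda>t\<in>{0..}. G t w) (t (Suc i)) - reg (\<lambda>t\<in>{0..}. G t w) (t i)"
        by eventually_elim simp
    qed auto
  next
    fix s t u :: real assume st: "0 \<le> s" "s \<le> t" "0 \<le> u"
    then have t: "0 \<le> t" "0 \<le> t - s" by auto
    have D: "distr M borel (\<lambda>w. G (s + (t - s)) w - G s w) = distr M borel (G (t - s))"
      using S st(1) t(2) unfolding subordinator_def by blast
    have "(\<integral>w. exp (- u * (reg (\<lambda>t\<in>{0..}. G t w) t - reg (\<lambda>t\<in>{0..}. G t w) s)) \<partial>M) = (\<integral>w. exp (- u * (G t w - G s w)) \<partial>M)"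
    proof (rule integral_cong_AE)
      show "AE w in M. exp (- u * (reg (\<lambda>t\<in>{0..}. G t w) t - reg (\<lambda>t\<in>{0..}. G t w) s)) = exp (- u * (G t w - G s w))"
        using AEt[OF st(1)] AEt[OF t(1)] by eventually_elim simp
    qed (use G[OF st(1)] G[OF t(1)] in auto)
    also have "\<dots> = (\<integral>x. exp (- u * x) \<partial>distr M borel (\<lambda>w. G (s + (t - s)) w - G s w))"
      using G[OF st(1)] G[OF t(1)] by (subst integral_distr) auto
    also have "\<dots> = (\<integral>w. exp (- u * G (t - s) w) \<partial>M)"
      unfolding D using G[OF t(2)] by (subst integral_distr) auto
    also have "\<dots> = (1 + u) powr (- (\<theta> * (t - s)))"
      using GP st(3) t(2) by (simp add: gamma_process_def)
    finally show "(\<integral>w. exp (- u * (reg (\<lambda>t\<in>{0..}. G t w) t - reg (\<lambda>t\<in>{0..}. G t w) s)) \<partial>M) = (1 + u) powr (- (\<theta> * (t - s)))" .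
  qed (use \<theta> in \<open>auto intro: reg_mono reg_right_continuous\<close>)
qed

section \<open>The pairs of masses and normalised means\<close>

text \<open>The mass and the normalised discounted integral over \<open>{a<..b}\<close> as a functional of the path, in a form that is
  jointly measurable in path and endpoints. If the mass is \<open>0\<close>, so is the second component.\<close>

definition interval_pair :: "(real \<Rightarrow> real) \<Rightarrow> real \<Rightarrow> real \<Rightarrow> real \<times> real" where
  "interval_pair \<psi> a b =
    (reg \<psi> b - reg \<psi> a,
     exp (- b) * (exp_integral \<psi> b - exp_integral \<psi> a) / (reg \<psi> b - reg \<psi> a))"

lemma interval_pair_measurable[measurable (raw)]:
  assumes [measurable]: "f \<in> N \<rightarrow>\<^sub>M paths" "g \<in> borel_measurable N" "h \<in> borel_measurable N"
  shows "(\<lambda>x. interval_pair (f x) (g x) (h x)) \<in> N \<rightarrow>\<^sub>M borel \<Otimes>\<^sub>M borel"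
  unfolding interval_pair_def by measurable

text \<open>If the mass vanishes, so does the discounted integral, so the division by \<open>0\<close> does no harm.\<close>

lemma interval_pair_exp:
  assumes "0 \<le> a" "a \<le> b"
  shows "fst (interval_pair \<psi> a b) * snd (interval_pair \<psi> a b) = exp (- b) * (exp_integral \<psi> b - exp_integral \<psi> a)"
proof (cases "reg \<psi> b - reg \<psi> a = 0")
  case True
  then have "emeasure (reg_measure \<psi>) {a<..b} = 0" using emeasure_reg[OF assms(2), of \<psi>] by simp
  then have "AE x in reg_measure \<psi>. x \<notin> {a<..b}" by (intro AE_not_in) (simp add: null_sets_def)
  then have "(\<integral>x. indicator {a<..b} x * exp (x - b) \<partial>reg_measure \<psi>) = (\<integral>x. 0 \<partial>reg_measure \<psi>)"
    by (intro integral_cong_AE) auto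
  then have "exp (- b) * (exp_integral \<psi> b - exp_integral \<psi> a) = 0"
    by (simp add: exp_integral_diff[OF assms])
  then show ?thesis by (simp add: interval_pair_def)
next
  case False
  then show ?thesis by (simp add: interval_pair_def)
qed

text \<open>Specialises the process to regularised paths, so that the laws obtained for \<open>mass\<close> and \<open>ratio\<close> apply to
  \<open>interval_pair\<close>.\<close>

locale gamma_reg_paths = gamma_paths M \<theta> "\<lambda>w. reg (path w)" for M :: "'a measure" and \<theta> path
begin

lemma interval_pair_eq:
  assumes "0 \<le> a" "a \<le> b"
  shows "interval_pair (path w) a b = (mass a b w, ratio a b w)"
  using exp_integral_diff[OF assms, of "path w"]
  by (simp add: interval_pair_def mass_def ratio_def discounted_def)

lemma interval_pair_rv:
  assumes "0 \<le> a" "a \<le> b"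
  shows "(\<lambda>w. interval_pair (path w) a b) \<in> M \<rightarrow>\<^sub>M borel \<Otimes>\<^sub>M borel"
proof -
  note [measurable] = discounted_measurable[OF assms]
  show ?thesis unfolding interval_pair_eq[OF assms] ratio_def by measurable
qed

lemma prob_interval_pair_shift:
  assumes ab: "0 \<le> a" "a \<le> b" and A[measurable]: "A \<in> sets (borel \<Otimes>\<^sub>M borel)"
  shows "prob {w \<in> space M. interval_pair (path w) a b \<in> A} = prob {w \<in> space M. interval_pair (path w) 0 (b - a) \<in> A}"
proof -
  have ab': "(0::real) \<le> 0" "0 \<le> b - a" using ab by auto
  have eq: "prob {w \<in> space M. interval_pair (path w) p q \<in> A} =
      measure (distr M (borel \<Otimes>\<^sub>M borel) (\<lambda>w. (discounted p q w, mass p q w))) {x. (snd x, fst x / snd x) \<in> A}"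
    if pq: "0 \<le> p" "p \<le> q" for p q
  proof -
    note [measurable] = discounted_measurable[OF pq]
    have "(\<lambda>x. (snd x, fst x / snd x)) \<in> borel \<Otimes>\<^sub>M borel \<rightarrow>\<^sub>M borel \<Otimes>\<^sub>M (borel :: real measure)" by measurable
    from measurable_sets[OF this A] have "{x. (snd x, fst x / snd x) \<in> A} \<in> sets (borel \<Otimes>\<^sub>M (borel :: real measure))"
      by (simp add: vimage_def space_pair_measure)
    then show ?thesis
      by (subst measure_distr) (auto simp: interval_pair_eq[OF pq] ratio_def intro!: arg_cong[where f=prob])
  qed
  show ?thesis unfolding eq[OF ab] eq[OF ab'] pair_law_shift[OF ab] by simp
qed

lemma prob_interval_pairs:
  assumes J: "finite J" and ab: "\<And>j. j \<in> J \<Longrightarrow> 0 \<le> a j" "\<And>j. j \<in> J \<Longrightarrow> a j \<le> b j"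
    and disj: "disjoint_family_on (\<lambda>j. {a j<..b j}) J" and A: "\<And>j. j \<in> J \<Longrightarrow> A j \<in> sets (borel \<Otimes>\<^sub>M borel)"
  shows "prob {w \<in> space M. \<forall>j\<in>J. interval_pair (path w) (a j) (b j) \<in> A j} =
    (\<Prod>j\<in>J. prob {w \<in> space M. interval_pair (path w) (a j) (b j) \<in> A j})"
proof (cases "J = {}")
  case True then show ?thesis by (simp add: prob_space)
next
  case False
  have "indep_vars (\<lambda>_. borel \<Otimes>\<^sub>M borel) (\<lambda>j w. (snd (discounted (a j) (b j) w, mass (a j) (b j) w),
     fst (discounted (a j) (b j) w, mass (a j) (b j) w) / snd (discounted (a j) (b j) w, mass (a j) (b j) w))) J"
    by (rule indep_vars_compose2[OF indep_pairs[OF J ab disj]]) (auto intro: measurable_Pair)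
  then have ind: "indep_vars (\<lambda>_. borel \<Otimes>\<^sub>M borel) (\<lambda>j w. interval_pair (path w) (a j) (b j)) J"
    by (rule indep_vars_cong_AE) (use J ab interval_pair_rv in \<open>auto simp: interval_pair_eq ratio_def\<close>)
  have "prob (\<Inter>j\<in>J. (\<lambda>w. interval_pair (path w) (a j) (b j)) -` A j \<inter> space M) =
     (\<Prod>j\<in>J. prob ((\<lambda>w. interval_pair (path w) (a j) (b j)) -` A j \<inter> space M))"
    by (rule indep_varsD[OF ind False J]) (use A in auto)
  moreover have "(\<Inter>j\<in>J. (\<lambda>w. interval_pair (path w) (a j) (b j)) -` A j \<inter> space M) =
      {w \<in> space M. \<forall>j\<in>J. interval_pair (path w) (a j) (b j) \<in> A j}" using False by auto
  moreover have "(\<lambda>w. interval_pair (path w) (a j) (b j)) -` A j \<inter> space M = {w \<in> space M. interval_pair (path w) (a j) (b j) \<in> A j}" for j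
    by auto
  ultimately show ?thesis by simp
qed

lemma prob_interval_pair_Times:
  assumes ab: "0 \<le> a" "a < b" and A: "A \<in> sets borel" and B: "B \<in> sets borel"
  shows "prob {w \<in> space M. fst (interval_pair (path w) a b) \<in> A \<and> snd (interval_pair (path w) a b) \<in> B} =
      prob {w \<in> space M. fst (interval_pair (path w) a b) \<in> A} * prob {w \<in> space M. snd (interval_pair (path w) a b) \<in> B}"
    and "prob {w \<in> space M. fst (interval_pair (path w) a b) \<in> A} = measure (gamma_law (\<theta> * (b - a))) A"
    and "prob {w \<in> space M. snd (interval_pair (path w) a b) \<in> B} =
      measure (dirichlet_mean_law (scale_measure (ennreal (\<theta> * (b - a))) (F_law (b - a)))) B"
proof -
  have ab': "0 \<le> a" "a \<le> b" using ab by auto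
  note [measurable] = discounted_measurable[OF ab']
  have r[measurable]: "ratio a b \<in> borel_measurable M" unfolding ratio_def by measurable
  show "prob {w \<in> space M. fst (interval_pair (path w) a b) \<in> A \<and> snd (interval_pair (path w) a b) \<in> B} =
      prob {w \<in> space M. fst (interval_pair (path w) a b) \<in> A} * prob {w \<in> space M. snd (interval_pair (path w) a b) \<in> B}"
    unfolding interval_pair_eq[OF ab'] fst_conv snd_conv by (rule mass_indep_ratio[OF ab' A B])
  have "mass a b -` A \<inter> space M = {w \<in> space M. mass a b w \<in> A}" "ratio a b -` B \<inter> space M = {w \<in> space M. ratio a b w \<in> B}" by auto
  then show "prob {w \<in> space M. fst (interval_pair (path w) a b) \<in> A} = measure (gamma_law (\<theta> * (b - a))) A"
    and "prob {w \<in> space M. snd (interval_pair (path w) a b) \<in> B} =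
      measure (dirichlet_mean_law (scale_measure (ennreal (\<theta> * (b - a))) (F_law (b - a)))) B"
    unfolding interval_pair_eq[OF ab'] fst_conv snd_conv mass_law[OF ab', symmetric] ratio_law[OF ab, symmetric]
    using A B by (simp_all add: measure_distr)
qed

end

theorem proposition3p8:
  fixes M :: "'a measure" and \<theta> lam :: real and G :: "real \<Rightarrow> 'a \<Rightarrow> real"
    and v0 :: "'a \<Rightarrow> real" and n :: nat and \<gamma> :: "nat \<Rightarrow> 'a \<Rightarrow> real"
  assumes "prob_space M" and "0 < \<theta>" and "0 < lam"
    and "gamma_process M \<theta> G"
    and "v0 \<in> borel_measurable M" and "AE w in M. 0 < v0 w"
    and "\<And>i. i \<le> n \<Longrightarrow> \<gamma> i \<in> borel_measurable M"
    and "AE w in M. \<gamma> 0 w = 0 \<and> (\<forall>i<n. \<gamma> i w < \<gamma> (Suc i) w)"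
    and "indep_rv M
           (PiM {0..} (\<lambda>_. borel)) (\<lambda>w. \<lambda>t\<in>{0..}. G t w)
           (borel \<Otimes>\<^sub>M PiM {..n} (\<lambda>_. borel)) (\<lambda>w. (v0 w, \<lambda>i\<in>{..n}. \<gamma> i w))"
  shows "\<exists>T D :: nat \<Rightarrow> 'a \<Rightarrow> real.
    (AE w in M. \<forall>i\<in>{1..n}.
       lam * tau_incr lam G v0 \<gamma> i w =
         (1 - exp (- lam * Delta \<gamma> i w)) * exp (- lam * \<gamma> (i - 1) w)
           * (v0 w + (\<Sum>j=1..i-1. r_coeff lam \<gamma> j w * T j w * D j w))
         + T i w * (1 - D i w)) \<and>
    cond_indep_vars M (sigma_Delta M \<gamma> n) (\<lambda>_. borel \<Otimes>\<^sub>M borel) (\<lambda>i w. (T i w, D i w)) {1..n} \<and>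
    cond_indep_var M (sigma_Delta M \<gamma> n)
      (PiM {1..n} (\<lambda>_. borel \<Otimes>\<^sub>M borel)) (\<lambda>w. \<lambda>i\<in>{1..n}. (T i w, D i w)) borel v0 \<and>
    (indep_rv M (PiM {1..n} (\<lambda>_. borel)) (Delta_vec \<gamma> n) borel v0 \<longrightarrow>
     indep_rv M
       (PiM {1..n} (\<lambda>_. borel \<Otimes>\<^sub>M borel)) (\<lambda>w. \<lambda>i\<in>{1..n}. (T i w, D i w)) borel v0) \<and>
    (\<forall>i\<in>{1..n}.
       cond_indep_var M (sigma_Delta M \<gamma> n) borel (T i) borel (D i) \<and>
       has_cond_law M (sigma_Delta M \<gamma> n) borel (T i)
         (\<lambda>w. gamma_law (\<theta> * lam * Delta \<gamma> i w)) \<and>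
       has_cond_law M (sigma_Delta M \<gamma> n) borel (D i)
         (\<lambda>w. dirichlet_mean_law
            (scale_measure (ennreal (\<theta> * lam * Delta \<gamma> i w)) (F_law (lam * Delta \<gamma> i w))))) \<and>
    (prob_space.indep_vars M (\<lambda>_. borel) (Delta \<gamma>) {1..n} \<longrightarrow>
     prob_space.indep_vars M (\<lambda>_. borel \<Otimes>\<^sub>M borel) (\<lambda>i w. (T i w, D i w)) {1..n})"
proof -
  interpret prob_space M by fact
  define path where "path w = (\<lambda>t\<in>{0..}. G t w)" for w
  define \<delta> where "\<delta> = Delta_vec \<gamma> n"
  let ?S = "PiM {1..n} (\<lambda>_. borel) :: (nat \<Rightarrow> real) measure"
  let ?F = "sigma_Delta M \<gamma> n"
  have F: "?F = vimage_algebra (space M) \<delta> ?S" by (simp add: sigma_Delta_def \<delta>_def)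
  have path[measurable]: "path \<in> M \<rightarrow>\<^sub>M paths"
    using assms(9) by (simp add: indep_rv_def path_def[abs_def])
  interpret gamma_reg_paths M \<theta> path
    unfolding gamma_reg_paths_def path_def
    by (rule gamma_process_paths[OF assms(4,2)]) (use path in \<open>simp add: path_def[abs_def]\<close>)
  note v0[measurable] = assms(5)
  have ind: "indep_rv M paths path (borel \<Otimes>\<^sub>M ?S) (\<lambda>w. (v0 w, \<delta> w))"
  proof -
    have "(\<lambda>p. (fst p, \<lambda>i\<in>{1..n}. snd p i - snd p (i - 1))) \<in> (borel \<Otimes>\<^sub>M PiM {..n} (\<lambda>_. borel :: real measure)) \<rightarrow>\<^sub>M (borel :: real measure) \<Otimes>\<^sub>M ?S"
      by (intro measurable_Pair measurable_fst measurable_restrict borel_measurable_diff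
            measurable_compose[OF measurable_snd measurable_component_singleton]) auto
    from indep_rv_compose[OF assms(9) measurable_ident this]
    have "indep_rv M paths path (borel \<Otimes>\<^sub>M ?S) (\<lambda>w. (v0 w, \<lambda>i\<in>{1..n}. (\<lambda>i\<in>{..n}. \<gamma> i w) i - (\<lambda>i\<in>{..n}. \<gamma> i w) (i - 1)))"
      by (simp add: path_def[abs_def])
    moreover have "(\<lambda>i\<in>{1..n}. (\<lambda>i\<in>{..n}. \<gamma> i w) i - (\<lambda>i\<in>{..n}. \<gamma> i w) (i - 1)) = \<delta> w" for w
      by (auto simp: \<delta>_def Delta_vec_def Delta_def fun_eq_iff)
    ultimately show ?thesis by simp
  qed
  have \<delta>[measurable]: "\<delta> \<in> M \<rightarrow>\<^sub>M ?S"
    using ind measurable_compose[OF _ measurable_snd, of "\<lambda>w. (v0 w, \<delta> w)" M borel ?S] by (simp add: indep_rv_def)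
  have ind\<delta>: "indep_rv M paths path ?S \<delta>"
    using indep_rv_compose[OF ind measurable_ident measurable_snd] by simp
  \<comment> \<open>The pairs are defined from the spacings alone, with each time replaced by a partial sum of spacings, so that freezing the spacings freezes the interval endpoints.\<close>
  define s where "s d i = lam * (\<Sum>j=1..i. d j)" for d :: "nat \<Rightarrow> real" and i :: nat
  define H where "H \<psi> d i = interval_pair \<psi> (s d (i - 1)) (s d i)" for \<psi> d i
  define T where "T i w = fst (H (path w) (\<delta> w) i)" for i w
  define D where "D i w = snd (H (path w) (\<delta> w) i)" for i w
  have TD: "(T i w, D i w) = H (path w) (\<delta> w) i" for i w by (simp add: T_def D_def)
  have sm[measurable]: "(\<lambda>d. s d i) \<in> borel_measurable ?S" if "i \<le> n" for i
    unfolding s_def using that by (intro borel_measurable_times borel_measurable_sum borel_measurable_const measurable_component_singleton) auto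
  have Hm[measurable]: "(\<lambda>p. H (fst p) (snd p) i) \<in> paths \<Otimes>\<^sub>M ?S \<rightarrow>\<^sub>M borel \<Otimes>\<^sub>M borel" if "i \<le> n" for i
    unfolding H_def using that
    by (intro interval_pair_measurable measurable_fst measurable_compose[OF measurable_snd sm]) auto
  have TDm[measurable]: "(\<lambda>w. (T i w, D i w)) \<in> M \<rightarrow>\<^sub>M borel \<Otimes>\<^sub>M borel" if "i \<le> n" for i
    unfolding TD using measurable_compose[OF measurable_Pair[OF path \<delta>] Hm[OF that]] by simp
  have Tm[measurable]: "T i \<in> borel_measurable M" and Dm[measurable]: "D i \<in> borel_measurable M" if "i \<le> n" for i
    using measurable_compose[OF TDm[OF that] measurable_fst] measurable_compose[OF TDm[OF that] measurable_snd] by auto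
  define vec where "vec w = (\<lambda>i\<in>{1..n}. (T i w, D i w))" for w
  have vecm[measurable]: "vec \<in> M \<rightarrow>\<^sub>M PiM {1..n} (\<lambda>_. borel \<Otimes>\<^sub>M borel)"
    unfolding vec_def by (intro measurable_restrict TDm) auto
  define pos where "pos d \<longleftrightarrow> (\<forall>i\<in>{1..n}. 0 < d i)" for d :: "nat \<Rightarrow> real"
  have AEpos: "AE w in M. pos (\<delta> w)"
    using assms(8)
  proof eventually_elim
    case (elim w)
    show ?case unfolding pos_def
    proof
      fix i assume i: "i \<in> {1..n}"
      then have "i - 1 < n" by auto
      then have "\<gamma> (i - 1) w < \<gamma> (Suc (i - 1)) w" using elim by blast
      then show "0 < \<delta> w i" using i by (simp add: \<delta>_def Delta_vec_def Delta_def)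
    qed
  qed
  have s0: "0 \<le> s d i" if "pos d" "i \<le> n" for d i
    unfolding s_def using assms(3) that by (intro mult_nonneg_nonneg sum_nonneg) (auto simp: pos_def less_imp_le)
  have sdiff: "s d i - s d (i - 1) = lam * d i" if "i \<in> {1..n}" for d i
  proof -
    from that obtain k where "i = Suc k" by (cases i) auto
    then show ?thesis by (simp add: s_def algebra_simps)
  qed
  have sless: "s d (i - 1) < s d i" if "pos d" "i \<in> {1..n}" for d i
    using sdiff[OF that(2), of d] that assms(3) by (simp add: pos_def) (metis diff_gt_0_iff_gt mult_pos_pos atLeastAtMost_iff)
  have smono: "s d i \<le> s d j" if "pos d" "i \<le> j" "j \<le> n" for d i j
    unfolding s_def using assms(3) that
    by (intro mult_left_mono sum_mono2) (auto simp: pos_def less_imp_le)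
  have disj: "disjoint_family_on (\<lambda>j. {s d (j - 1)<..s d j}) {1..n}" if "pos d" for d
  proof (unfold disjoint_family_on_def, intro ballI impI)
    fix i j assume ij: "i \<in> {1..n}" "j \<in> {1..n}" "i \<noteq> j"
    then consider "i \<le> j - 1" | "j \<le> i - 1" by fastforce
    then show "{s d (i - 1)<..s d i} \<inter> {s d (j - 1)<..s d j} = {}"
    proof cases
      case 1
      have "s d i \<le> s d (j - 1)" using ij by (intro smono[OF that 1]) auto
      then show ?thesis by auto
    next
      case 2
      have "s d j \<le> s d (i - 1)" using ij by (intro smono[OF that 2]) auto
      then show ?thesis by auto
    qed
  qed
  have disjJ: "disjoint_family_on (\<lambda>j. {s d (j - 1)<..s d j}) J" if "pos d" "J \<subseteq> {1..n}" for d J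
    using disj[OF that(1)] that(2) by (rule disjoint_family_on_mono[rotated])
  have multi: "prob {w \<in> space M. \<forall>j\<in>J. H (path w) d j \<in> A j} = (\<Prod>j\<in>J. prob {w \<in> space M. H (path w) d j \<in> A j})"
    if "pos d" "J \<subseteq> {1..n}" "\<And>j. j \<in> J \<Longrightarrow> A j \<in> sets (borel \<Otimes>\<^sub>M borel)" for d J A
    unfolding H_def
  proof (rule prob_interval_pairs)
    show "finite J" using that(2) by (rule finite_subset) simp
    fix j assume "j \<in> J"
    then have j: "j \<in> {1..n}" using that(2) by auto
    then show "0 \<le> s d (j - 1)" using s0[OF that(1), of "j - 1"] by auto
    show "s d (j - 1) \<le> s d j" using sless[OF that(1) j] by simp
  qed (use that disjJ in auto)
  have preim: "{p \<in> space (paths \<Otimes>\<^sub>M ?S). H (fst p) (snd p) i \<in> A} \<in> sets (paths \<Otimes>\<^sub>M ?S)"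
    if "i \<le> n" "A \<in> sets (borel \<Otimes>\<^sub>M borel)" for i A
    using measurable_sets[OF Hm[OF that(1)] that(2)] by (simp add: vimage_def Int_def conj_commute)
  have preimJ: "{p \<in> space (paths \<Otimes>\<^sub>M ?S). \<forall>j\<in>J. H (fst p) (snd p) j \<in> A j} \<in> sets (paths \<Otimes>\<^sub>M ?S)"
    if J: "J \<subseteq> {1..n}" and A: "\<And>j. j \<in> J \<Longrightarrow> A j \<in> sets (borel \<Otimes>\<^sub>M borel)" for J A
  proof (cases "J = {}")
    case True then show ?thesis by simp
  next
    case False
    have "finite J" using J by (rule finite_subset) simp
    with False have "(\<Inter>j\<in>J. {p \<in> space (paths \<Otimes>\<^sub>M ?S). H (fst p) (snd p) j \<in> A j}) \<in> sets (paths \<Otimes>\<^sub>M ?S)"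
      using J A by (intro sets.finite_INT preim) auto
    moreover have "(\<Inter>j\<in>J. {p \<in> space (paths \<Otimes>\<^sub>M ?S). H (fst p) (snd p) j \<in> A j}) =
      {p \<in> space (paths \<Otimes>\<^sub>M ?S). \<forall>j\<in>J. H (fst p) (snd p) j \<in> A j}" using False by auto
    ultimately show ?thesis by simp
  qed
  have inS: "(path w, \<delta> w') \<in> space (paths \<Otimes>\<^sub>M ?S)" if "w \<in> space M" "w' \<in> space M" for w w'
    using measurable_space[OF path that(1)] measurable_space[OF \<delta> that(2)] by (simp add: space_pair_measure)
  \<comment> \<open>Conditionally on the spacings, events about the pairs have their frozen probability.\<close>
  have givenJ: "AE w in M. prob_given M ?F {x \<in> space M. \<forall>j\<in>J. (T j x, D j x) \<in> A j} w =
      prob {x \<in> space M. \<forall>j\<in>J. H (path x) (\<delta> w) j \<in> A j}"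
    if J: "J \<subseteq> {1..n}" and A: "\<And>j. j \<in> J \<Longrightarrow> A j \<in> sets (borel \<Otimes>\<^sub>M borel)" for J A
  proof -
    let ?C = "{p \<in> space (paths \<Otimes>\<^sub>M ?S). \<forall>j\<in>J. H (fst p) (snd p) j \<in> A j}"
    have "AE w in M. prob_given M ?F {x \<in> space M. (path x, \<delta> x) \<in> ?C} w = prob {x \<in> space M. (path x, \<delta> w) \<in> ?C}"
      unfolding F by (rule prob_given_freezing(2)[OF ind preimJ[OF J A]]) (auto simp: space_borel)
    moreover have "{x \<in> space M. (path x, \<delta> x) \<in> ?C} = {x \<in> space M. \<forall>j\<in>J. (T j x, D j x) \<in> A j}"
      using inS by (auto simp: TD)
    moreover have "{x \<in> space M. (path x, \<delta> w) \<in> ?C} = {x \<in> space M. \<forall>j\<in>J. H (path x) (\<delta> w) j \<in> A j}" if "w \<in> space M" for w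
      using inS[OF _ that] by auto
    ultimately show ?thesis using AE_space by (auto elim!: AE_mp)
  qed
  have given1: "AE w in M. prob_given M ?F {x \<in> space M. (T j x, D j x) \<in> A} w =
      prob {x \<in> space M. H (path x) (\<delta> w) j \<in> A}"
    if "j \<in> {1..n}" "A \<in> sets (borel \<Otimes>\<^sub>M borel)" for j A
    using givenJ[of "{j}" "\<lambda>_. A"] that by simp
  have cond_pairs: "cond_indep_vars M ?F (\<lambda>_. borel \<Otimes>\<^sub>M borel) (\<lambda>i w. (T i w, D i w)) {1..n}"
    unfolding cond_indep_vars_def
  proof (intro conjI ballI allI impI)
    fix J and A :: "nat \<Rightarrow> (real \<times> real) set"
    assume J: "J \<subseteq> {1..n}" "finite J" and "\<forall>j\<in>J. A j \<in> sets (borel \<Otimes>\<^sub>M borel)"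
    then have A: "\<And>j. j \<in> J \<Longrightarrow> A j \<in> sets (borel \<Otimes>\<^sub>M borel)" by auto
    have "AE w in M. \<forall>j\<in>J. prob_given M ?F {x \<in> space M. (T j x, D j x) \<in> A j} w =
      prob {x \<in> space M. H (path x) (\<delta> w) j \<in> A j}"
      using J A by (intro AE_finite_allI given1) auto
    moreover have "AE w in M. prob_given M ?F {x \<in> space M. \<forall>j\<in>J. (T j x, D j x) \<in> A j} w =
      prob {x \<in> space M. \<forall>j\<in>J. H (path x) (\<delta> w) j \<in> A j}"
      by (rule givenJ[OF J(1) A])
    ultimately show "AE w in M. prob_given M ?F {x \<in> space M. \<forall>j\<in>J. (T j x, D j x) \<in> A j} w =
      (\<Prod>j\<in>J. prob_given M ?F {x \<in> space M. (T j x, D j x) \<in> A j} w)"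
      using AEpos
    proof eventually_elim
      case (elim w)
      have "prob {x \<in> space M. \<forall>j\<in>J. H (path x) (\<delta> w) j \<in> A j} = (\<Prod>j\<in>J. prob {x \<in> space M. H (path x) (\<delta> w) j \<in> A j})"
        by (rule multi[OF elim(3) J(1) A])
      then show ?case using elim(1,2) by simp
    qed
  qed (auto intro: TDm)
  have Vm: "(\<lambda>p. \<lambda>i\<in>{1..n}. H (fst p) (snd p) i) \<in> paths \<Otimes>\<^sub>M ?S \<rightarrow>\<^sub>M PiM {1..n} (\<lambda>_. borel \<Otimes>\<^sub>M borel)"
    by (intro measurable_restrict Hm) auto
  have vec_eq: "vec w = (\<lambda>i\<in>{1..n}. H (path w) (\<delta> w) i)" for w by (simp add: vec_def TD)
  have Vset: "{p \<in> space (paths \<Otimes>\<^sub>M ?S). (\<lambda>i\<in>{1..n}. H (fst p) (snd p) i) \<in> A} \<in> sets (paths \<Otimes>\<^sub>M ?S)"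
    if "A \<in> sets (PiM {1..n} (\<lambda>_. borel \<Otimes>\<^sub>M borel))" for A
    using measurable_sets[OF Vm that] by (simp add: vimage_def Int_def conj_commute)
  have cond_v0: "cond_indep_var M ?F (PiM {1..n} (\<lambda>_. borel \<Otimes>\<^sub>M borel)) vec borel v0"
    unfolding cond_indep_var_def
  proof (intro conjI ballI vecm v0)
    fix A B assume A: "A \<in> sets (PiM {1..n} (\<lambda>_. borel \<Otimes>\<^sub>M borel) :: (nat \<Rightarrow> real \<times> real) measure)" and B: "B \<in> sets (borel :: real measure)"
    let ?C = "{p \<in> space (paths \<Otimes>\<^sub>M ?S). (\<lambda>i\<in>{1..n}. H (fst p) (snd p) i) \<in> A}"
    have e: "{x \<in> space M. (path x, \<delta> x) \<in> ?C \<and> v0 x \<in> B} = {x \<in> space M. vec x \<in> A \<and> v0 x \<in> B}"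
      "{x \<in> space M. (path x, \<delta> x) \<in> ?C} = {x \<in> space M. vec x \<in> A}"
      using inS by (auto simp: vec_eq)
    show "AE w in M. prob_given M ?F {x \<in> space M. vec x \<in> A \<and> v0 x \<in> B} w =
      prob_given M ?F {x \<in> space M. vec x \<in> A} w * prob_given M ?F {x \<in> space M. v0 x \<in> B} w"
      using prob_given_freezing[OF ind Vset[OF A] B] unfolding F[symmetric] e by eventually_elim simp
  qed
  have indep_v0: "indep_rv M (PiM {1..n} (\<lambda>_. borel \<Otimes>\<^sub>M borel)) vec borel v0" if iv: "indep_rv M ?S \<delta> borel v0"
  proof (rule indep_rvI[OF vecm v0])
    fix A B assume A: "A \<in> sets (PiM {1..n} (\<lambda>_. borel \<Otimes>\<^sub>M borel) :: (nat \<Rightarrow> real \<times> real) measure)" and B[measurable]: "B \<in> sets (borel :: real measure)"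
    let ?C = "{p \<in> space (paths \<Otimes>\<^sub>M ?S). (\<lambda>i\<in>{1..n}. H (fst p) (snd p) i) \<in> A}"
    define k where "k d = prob {x \<in> space M. (path x, d) \<in> ?C}" for d
    have k[measurable]: "k \<in> borel_measurable ?S" unfolding k_def by (rule freezing(1)[OF ind\<delta> Vset[OF A]])
    have k01: "0 \<le> k d" "k d \<le> 1" for d by (auto simp: k_def)
    have e: "{x \<in> space M. (path x, \<delta> x) \<in> ?C \<and> v0 x \<in> B \<and> \<delta> x \<in> space ?S} = {x \<in> space M. vec x \<in> A \<and> v0 x \<in> B}"
      "{x \<in> space M. (path x, \<delta> x) \<in> ?C} = {x \<in> space M. vec x \<in> A}"
      using inS measurable_space[OF \<delta>] by (auto simp: vec_eq)
    have "prob {x \<in> space M. vec x \<in> A \<and> v0 x \<in> B} = (\<integral>w. indicator (space ?S) (\<delta> w) * (k (\<delta> w) * indicator B (v0 w)) \<partial>M)"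
      using freezing_cond[OF ind Vset[OF A] B sets.top] unfolding e k_def .
    also have "\<dots> = (\<integral>w. k (\<delta> w) * indicator B (v0 w) \<partial>M)"
      using measurable_space[OF \<delta>] by (intro Bochner_Integration.integral_cong) auto
    also have "\<dots> = (\<integral>w. k (\<delta> w) \<partial>M) * (\<integral>w. indicator B (v0 w) \<partial>M)"
      by (rule indep_rv_integral_mult[OF indep_rv_compose[OF iv k]])
         (auto intro!: integrable_const_bound[where B=1] simp: k01 indicator_def)
    also have "(\<integral>w. k (\<delta> w) \<partial>M) = prob {x \<in> space M. vec x \<in> A}"
      using freezing(2)[OF ind\<delta> Vset[OF A]] unfolding e k_def by simp
    also have "(\<integral>w. indicator B (v0 w) \<partial>M) = prob {x \<in> space M. v0 x \<in> B}"
      by (rule expectation_indicator_rv[OF v0 B])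
    finally show "prob {x \<in> space M. vec x \<in> A \<and> v0 x \<in> B} = prob {x \<in> space M. vec x \<in> A} * prob {x \<in> space M. v0 x \<in> B}" .
  qed
  have laws: "cond_indep_var M ?F borel (T i) borel (D i) \<and>
       has_cond_law M ?F borel (T i) (\<lambda>w. gamma_law (\<theta> * lam * Delta \<gamma> i w)) \<and>
       has_cond_law M ?F borel (D i)
         (\<lambda>w. dirichlet_mean_law
            (scale_measure (ennreal (\<theta> * lam * Delta \<gamma> i w)) (F_law (lam * Delta \<gamma> i w))))"
    if i: "i \<in> {1..n}" for i
  proof -
    have gAB: "AE w in M. prob_given M ?F {x \<in> space M. T i x \<in> A \<and> D i x \<in> B} w =
        prob {x \<in> space M. fst (H (path x) (\<delta> w) i) \<in> A \<and> snd (H (path x) (\<delta> w) i) \<in> B}"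
      if "A \<in> sets borel" "B \<in> sets borel" for A B
      using given1[OF i pair_measureI[OF that]] by (simp add: mem_Times_iff)
    have gA: "AE w in M. prob_given M ?F {x \<in> space M. T i x \<in> A} w = prob {x \<in> space M. fst (H (path x) (\<delta> w) i) \<in> A}"
      if "A \<in> sets borel" for A using gAB[OF that, of UNIV] by simp
    have gB: "AE w in M. prob_given M ?F {x \<in> space M. D i x \<in> B} w = prob {x \<in> space M. snd (H (path x) (\<delta> w) i) \<in> B}"
      if "B \<in> sets borel" for B using gAB[OF _ that, of UNIV] by simp
    have st: "0 \<le> s (\<delta> w) (i - 1)" "s (\<delta> w) (i - 1) < s (\<delta> w) i" if "pos (\<delta> w)" for w
      using s0[OF that, of "i - 1"] sless[OF that i] i by auto
    have d: "\<theta> * (s (\<delta> w) i - s (\<delta> w) (i - 1)) = \<theta> * lam * Delta \<gamma> i w" "s (\<delta> w) i - s (\<delta> w) (i - 1) = lam * Delta \<gamma> i w" for w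
      using sdiff[OF i, of "\<delta> w"] i by (simp_all add: \<delta>_def Delta_vec_def)
    have i': "i \<le> n" using i by simp
    show ?thesis
    proof (intro conjI)
      show "cond_indep_var M ?F borel (T i) borel (D i)"
        unfolding cond_indep_var_def
      proof (intro conjI ballI Tm[OF i'] Dm[OF i'])
        fix A B :: "real set" assume AB: "A \<in> sets borel" "B \<in> sets borel"
        show "AE w in M. prob_given M ?F {x \<in> space M. T i x \<in> A \<and> D i x \<in> B} w =
          prob_given M ?F {x \<in> space M. T i x \<in> A} w * prob_given M ?F {x \<in> space M. D i x \<in> B} w"
          using gAB[OF AB] gA[OF AB(1)] gB[OF AB(2)] AEpos
        proof eventually_elim
          case (elim w)
          show ?case unfolding elim(1-3) H_def by (rule prob_interval_pair_Times(1)[OF st[OF elim(4)] AB])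
        qed
      qed
      show "has_cond_law M ?F borel (T i) (\<lambda>w. gamma_law (\<theta> * lam * Delta \<gamma> i w))"
        unfolding has_cond_law_def
      proof (intro conjI ballI Tm[OF i'])
        fix A :: "real set" assume A: "A \<in> sets borel"
        show "AE w in M. prob_given M ?F {x \<in> space M. T i x \<in> A} w = measure (gamma_law (\<theta> * lam * Delta \<gamma> i w)) A"
          using gA[OF A] AEpos
        proof eventually_elim
          case (elim w)
          show ?case unfolding elim(1) H_def prob_interval_pair_Times(2)[OF st[OF elim(2)] A A] d by (simp only: mult.assoc)
        qed
      qed
      show "has_cond_law M ?F borel (D i)
         (\<lambda>w. dirichlet_mean_law (scale_measure (ennreal (\<theta> * lam * Delta \<gamma> i w)) (F_law (lam * Delta \<gamma> i w))))"
        unfolding has_cond_law_def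
      proof (intro conjI ballI Dm[OF i'])
        fix A :: "real set" assume A: "A \<in> sets borel"
        show "AE w in M. prob_given M ?F {x \<in> space M. D i x \<in> A} w =
          measure (dirichlet_mean_law (scale_measure (ennreal (\<theta> * lam * Delta \<gamma> i w)) (F_law (lam * Delta \<gamma> i w)))) A"
          using gB[OF A] AEpos
        proof eventually_elim
          case (elim w)
          show ?case unfolding elim(1) H_def prob_interval_pair_Times(3)[OF st[OF elim(2)] A A] d by (simp only: mult.assoc)
        qed
      qed
    qed
  qed
  \<comment> \<open>The frozen law of each pair depends on its own spacing only, so the pairs inherit independence from the spacings.\<close>
  have indep_pairs: "indep_vars (\<lambda>_. borel \<Otimes>\<^sub>M borel) (\<lambda>i w. (T i w, D i w)) {1..n}"
    if iD: "indep_vars (\<lambda>_. borel) (Delta \<gamma>) {1..n}"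
  proof -
    define k where "k A d = prob {x \<in> space M. interval_pair (path x) 0 (lam * d) \<in> A}" for A and d :: real
    have km: "k A \<in> borel_measurable borel" if A: "A \<in> sets (borel \<Otimes>\<^sub>M borel)" for A
    proof -
      have m: "(\<lambda>p. interval_pair (fst p) 0 (lam * snd p)) \<in> paths \<Otimes>\<^sub>M borel \<rightarrow>\<^sub>M borel \<Otimes>\<^sub>M borel" by measurable
      have C: "{p \<in> space (paths \<Otimes>\<^sub>M borel). interval_pair (fst p) 0 (lam * snd p) \<in> A} \<in> sets (paths \<Otimes>\<^sub>M borel)"
        using measurable_sets[OF m A] by (simp add: vimage_def Int_def conj_commute)
      have "indep_rv M paths path borel v0"
        using indep_rv_compose[OF ind measurable_ident measurable_fst] by simp
      from freezing(1)[OF this C]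
      have "(\<lambda>y. prob {w \<in> space M. (path w, y) \<in> {p \<in> space (paths \<Otimes>\<^sub>M borel). interval_pair (fst p) 0 (lam * snd p) \<in> A}}) \<in> borel_measurable borel" .
      moreover have "{w \<in> space M. (path w, y) \<in> {p \<in> space (paths \<Otimes>\<^sub>M borel). interval_pair (fst p) 0 (lam * snd p) \<in> A}} =
          {x \<in> space M. interval_pair (path x) 0 (lam * y) \<in> A}" for y
        using measurable_space[OF path] by (auto simp: space_pair_measure)
      ultimately show ?thesis by (simp add: k_def[abs_def])
    qed
    have k01: "0 \<le> k A d" "k A d \<le> 1" for A d by (auto simp: k_def)
    have kH: "prob {x \<in> space M. H (path x) (\<delta> w) j \<in> A} = k A (Delta \<gamma> j w)"
      if "pos (\<delta> w)" "j \<in> {1..n}" "A \<in> sets (borel \<Otimes>\<^sub>M borel)" for w j A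
    proof -
      have ab: "0 \<le> s (\<delta> w) (j - 1)" "s (\<delta> w) (j - 1) \<le> s (\<delta> w) j"
        using s0[OF that(1), of "j - 1"] sless[OF that(1,2)] that(2) by auto
      have d: "s (\<delta> w) j - s (\<delta> w) (j - 1) = lam * Delta \<gamma> j w"
        using sdiff[OF that(2), of "\<delta> w"] that(2) by (simp add: \<delta>_def Delta_vec_def)
      show ?thesis
        unfolding H_def k_def prob_interval_pair_shift[OF ab that(3)] d ..
    qed
    have Deltam: "Delta \<gamma> j \<in> borel_measurable M" if "j \<in> {1..n}" for j
      using iD that by (simp add: indep_vars_def)
    have kDm: "(\<lambda>w. k A (Delta \<gamma> j w)) \<in> borel_measurable M" if "j \<in> {1..n}" "A \<in> sets (borel \<Otimes>\<^sub>M borel)" for j A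
      by (rule measurable_compose[OF Deltam[OF that(1)] km[OF that(2)]])
    have probJ: "prob {x \<in> space M. \<forall>j\<in>J. (T j x, D j x) \<in> A j} = (\<integral>w. (\<Prod>j\<in>J. k (A j) (Delta \<gamma> j w)) \<partial>M)"
      if J: "J \<subseteq> {1..n}" and A: "\<And>j. j \<in> J \<Longrightarrow> A j \<in> sets (borel \<Otimes>\<^sub>M borel)" for J A
    proof -
      let ?C = "{p \<in> space (paths \<Otimes>\<^sub>M ?S). \<forall>j\<in>J. H (fst p) (snd p) j \<in> A j}"
      have C: "?C \<in> sets (paths \<Otimes>\<^sub>M ?S)" by (rule preimJ[OF J A])
      have "{x \<in> space M. (path x, \<delta> x) \<in> ?C} = {x \<in> space M. \<forall>j\<in>J. (T j x, D j x) \<in> A j}"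
        using inS by (auto simp: TD)
      then have "prob {x \<in> space M. \<forall>j\<in>J. (T j x, D j x) \<in> A j} = (\<integral>w. prob {x \<in> space M. (path x, \<delta> w) \<in> ?C} \<partial>M)"
        using freezing(2)[OF ind\<delta> C] by simp
      also have "\<dots> = (\<integral>w. (\<Prod>j\<in>J. k (A j) (Delta \<gamma> j w)) \<partial>M)"
      proof (rule integral_cong_AE)
        show "(\<lambda>w. prob {x \<in> space M. (path x, \<delta> w) \<in> ?C}) \<in> borel_measurable M"
          by (rule measurable_compose[OF \<delta> freezing(1)[OF ind\<delta> C]])
        show "(\<lambda>w. \<Prod>j\<in>J. k (A j) (Delta \<gamma> j w)) \<in> borel_measurable M"
          using J A by (intro borel_measurable_prod kDm) auto
        show "AE w in M. prob {x \<in> space M. (path x, \<delta> w) \<in> ?C} = (\<Prod>j\<in>J. k (A j) (Delta \<gamma> j w))"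
          using AEpos AE_space
        proof eventually_elim
          case (elim w)
          have "{x \<in> space M. (path x, \<delta> w) \<in> ?C} = {x \<in> space M. \<forall>j\<in>J. H (path x) (\<delta> w) j \<in> A j}"
            using inS[OF _ elim(2)] by auto
          then show ?case using J A elim(1) by (simp add: multi) (intro prod.cong refl kH; auto)
        qed
      qed
      finally show ?thesis .
    qed
    show ?thesis
    proof (rule indep_varsI)
      fix A :: "nat \<Rightarrow> (real \<times> real) set"
      assume A: "\<And>j. j \<in> {1..n} \<Longrightarrow> A j \<in> sets (borel \<Otimes>\<^sub>M borel)"
      have "prob {x \<in> space M. \<forall>j\<in>{1..n}. (T j x, D j x) \<in> A j} = (\<integral>w. (\<Prod>j\<in>{1..n}. k (A j) (Delta \<gamma> j w)) \<partial>M)"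
        using A by (intro probJ) auto
      also have "\<dots> = (\<Prod>j\<in>{1..n}. \<integral>w. k (A j) (Delta \<gamma> j w) \<partial>M)"
      proof (rule indep_vars_lebesgue_integral)
        show "indep_vars (\<lambda>_. borel) (\<lambda>j w. k (A j) (Delta \<gamma> j w)) {1..n}"
          by (rule indep_vars_compose2[OF iD]) (use A km in auto)
        show "integrable M (\<lambda>w. k (A j) (Delta \<gamma> j w))" if "j \<in> {1..n}" for j
          by (rule integrable_const_bound[where B=1]) (use k01 kDm[OF that A[OF that]] in auto)
      qed simp
      also have "\<dots> = (\<Prod>j\<in>{1..n}. prob {x \<in> space M. (T j x, D j x) \<in> A j})"
        using probJ[of "{j}" A for j] A by (intro prod.cong refl) simp
      finally show "prob {x \<in> space M. \<forall>j\<in>{1..n}. (T j x, D j x) \<in> A j} =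
        (\<Prod>j\<in>{1..n}. prob {x \<in> space M. (T j x, D j x) \<in> A j})" .
    qed (auto intro: TDm)
  qed
  have identity: "AE w in M. \<forall>i\<in>{1..n}.
       lam * tau_incr lam G v0 \<gamma> i w =
         (1 - exp (- lam * Delta \<gamma> i w)) * exp (- lam * \<gamma> (i - 1) w)
           * (v0 w + (\<Sum>j=1..i-1. r_coeff lam \<gamma> j w * T j w * D j w))
         + T i w * (1 - D i w)"
  proof -
    have S: "subordinator M G" using assms(4) by (simp add: gamma_process_def)
    show ?thesis using assms(8) AEpos reg_path_eq[OF S]
    proof eventually_elim
      case (elim w)
      then have p: "pos (\<delta> w)" and g0: "\<gamma> 0 w = 0" and reg: "\<And>t. reg (path w) t = G (max 0 t) w"
        by (auto simp: path_def)
      have sg: "s (\<delta> w) i = lam * \<gamma> i w" if "i \<le> n" for i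
        using that
      proof (induction i)
        case 0 then show ?case by (simp add: s_def g0)
      next
        case (Suc i)
        have "s (\<delta> w) (Suc i) - s (\<delta> w) i = lam * \<delta> w (Suc i)"
          using sdiff[of "Suc i" "\<delta> w"] Suc.prems by simp
        moreover have "\<delta> w (Suc i) = \<gamma> (Suc i) w - \<gamma> i w"
          using Suc.prems by (simp add: \<delta>_def Delta_vec_def Delta_def)
        ultimately show ?case using Suc by (simp add: right_diff_distrib)
      qed
      have g: "0 \<le> \<gamma> i w" if "i \<le> n" for i
        using s0[OF p that] sg[OF that] assms(3) by (simp add: zero_le_mult_iff)
      define E where "E i = exp_integral (path w) (s (\<delta> w) i)" for i
      have E0: "E 0 = 0" by (simp add: E_def s_def exp_integral_eq)
      have TDi: "T i w * D i w = exp (- (s (\<delta> w) i)) * (E i - E (i - 1))" if "i \<in> {1..n}" for i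
        unfolding T_def D_def H_def E_def
        using s0[OF p, of "i - 1"] sless[OF p that] that by (intro interval_pair_exp) auto
      have sumE: "(\<Sum>j=1..i. r_coeff lam \<gamma> j w * T j w * D j w) = E i" if "i \<le> n" for i
        using that
      proof (induction i)
        case 0 then show ?case by (simp add: E0)
      next
        case (Suc i)
        have "r_coeff lam \<gamma> (Suc i) w * T (Suc i) w * D (Suc i) w = E (Suc i) - E i"
          using TDi[of "Suc i"] sg[of "Suc i"] Suc.prems by (simp add: r_coeff_def mult.assoc flip: exp_add)
        then show ?case using Suc by simp
      qed
      show ?case
      proof
        fix i assume i: "i \<in> {1..n}"
        have i1: "i - 1 \<le> n" using i by auto
        define a b where "a = s (\<delta> w) (i - 1)" and "b = s (\<delta> w) i"
        have ab: "a = lam * \<gamma> (i - 1) w" "b = lam * \<gamma> i w" using sg[of i] sg[of "i - 1"] i by (auto simp: a_def b_def)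
        have ou: "lam * int_ou lam G v0 (\<gamma> k w) w = v0 w * (1 - exp (- (lam * \<gamma> k w))) +
           (reg (path w) (lam * \<gamma> k w) - reg (path w) 0) - exp (- (lam * \<gamma> k w)) * exp_integral (path w) (lam * \<gamma> k w)" if "k \<le> n" for k
          using int_ou_eq[OF assms(3) g[OF that], of G w v0] reg unfolding path_def by simp
        have "lam * tau_incr lam G v0 \<gamma> i w = v0 w * (exp (- a) - exp (- b)) + T i w - exp (- b) * E i + exp (- a) * E (i - 1)"
        proof -
          have "lam * int_ou lam G v0 (\<gamma> i w) w = v0 w * (1 - exp (- b)) + (reg (path w) b - reg (path w) 0) - exp (- b) * E i"
            using ou[of i] i by (simp only: ab(2)[symmetric] E_def b_def) simp
          moreover have "lam * int_ou lam G v0 (\<gamma> (i - 1) w) w = v0 w * (1 - exp (- a)) + (reg (path w) a - reg (path w) 0) - exp (- a) * E (i - 1)"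
            using ou[OF i1] by (simp only: ab(1)[symmetric] E_def a_def)
          moreover have "T i w = reg (path w) b - reg (path w) a"
            by (simp add: T_def H_def interval_pair_def a_def b_def)
          ultimately show ?thesis
            unfolding tau_incr_def right_diff_distrib[of lam] by (simp only:) (simp add: algebra_simps)
        qed
        also have "\<dots> = (1 - exp (a - b)) * exp (- a) * (v0 w + E (i - 1)) + T i w * (1 - D i w)"
        proof -
          have "T i w * (1 - D i w) = T i w - exp (- b) * (E i - E (i - 1))"
            using TDi[OF i] by (simp add: right_diff_distrib b_def)
          moreover have "exp (a - b) * exp (- a) = exp (- b)" by (simp flip: exp_add)
          ultimately show ?thesis by (simp add: algebra_simps)
        qed
        also have "a - b = - lam * Delta \<gamma> i w" by (simp add: ab Delta_def algebra_simps)
        also have "- a = - lam * \<gamma> (i - 1) w" by (simp add: ab)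
        also have "E (i - 1) = (\<Sum>j=1..i-1. r_coeff lam \<gamma> j w * T j w * D j w)"
          using i by (intro sumE[symmetric]) auto
        finally show "lam * tau_incr lam G v0 \<gamma> i w =
         (1 - exp (- lam * Delta \<gamma> i w)) * exp (- lam * \<gamma> (i - 1) w)
           * (v0 w + (\<Sum>j=1..i-1. r_coeff lam \<gamma> j w * T j w * D j w))
         + T i w * (1 - D i w)" .
      qed
    qed
  qed
  show ?thesis
    using identity cond_pairs cond_v0 indep_v0 laws indep_pairs
    unfolding vec_def[abs_def] \<delta>_def by blast
qed

end
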